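(* Let $K\subset\mathbb{R}^3$ be any polyhedron (not necessarily convex), and let $X,Y$ be independent random points, each uniformly distributed in $K$. Then the mean distance $\mathbb{E}\,\|X-Y\|$ can be expressed in terms of elementary functions of the location of the vertices and sides of $K$; and the same holds for all natural moments $\mathbb{E}\,\|X-Y\|^p$, $p\in\{1,2,3,\dots\}$. That is, for every polyhedron $K$ and every positive integer $p$, the number $\mathbb{E}\,\|X-Y\|^p$ is obtained from the coordinates of the vertices of $K$ by finitely many applications of field operations and elementary functions.
   Context: A polyhedron is a three-dimensional polytope in $\mathbb{R}^3$, i.e. a connected finite union of (nondegenerate) 3-dimensional simplices; it is not necessarily convex. Its sides are its faces (polygons whose union is the boundary of $K$). $\|\cdot\|$ is the Euclidean norm. "Elementary functions" means the closed field of functions containing radicals, exponential, trigonometric and hyperbolic functions and their inverses; thus an expression in elementary functions of given real quantities is one built from these quantities and rational constants by finitely many field operations ($+,-,\cdot,/$), extraction of radicals, and applications of exponential, trigonometric and hyperbolic functions and their inverses. *)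

theory Defs
  imports "HOL-Probability.Probability"
begin

(* The library constant polyhedron denotes a finite intersection of half-spaces, hence the name. *)
definition solid_polyhedron :: "(real^3) set \<Rightarrow> bool" where
  "solid_polyhedron K \<longleftrightarrow> connected K \<and>
     (\<exists>\<S>. finite \<S> \<and> \<S> \<noteq> {} \<and> (\<forall>T\<in>\<S>. 3 simplex T) \<and> K = \<Union>\<S>)"

(* Near v, the set K is a union of line segments parallel to u. *)
definition locally_cylindrical :: "'a::real_normed_vector set \<Rightarrow> 'a \<Rightarrow> 'a \<Rightarrow> bool" where
  "locally_cylindrical K u v \<longleftrightarrow>
     (\<exists>e>0. \<forall>x\<in>ball v e. \<forall>t. x + t *\<^sub>R u \<in> ball v e \<longrightarrow> (x \<in> K \<longleftrightarrow> x + t *\<^sub>R u \<in> K))"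

(* The vertices of a possibly non-convex polyhedron, as in Nef's theory: the points at which the
   local cone of K has trivial lineality space.  Interior and exterior points are locally
   cylindrical in every direction, relative interior points of a side in the directions of its
   plane, relative interior points of an edge in the direction of the edge.  Extreme points would
   not do, since they omit the reentrant vertices. *)
definition vertices_of :: "'a::real_normed_vector set \<Rightarrow> 'a set" where
  "vertices_of K = {v. \<forall>u. locally_cylindrical K u v \<longrightarrow> u = 0}"

definition vertex_coordinates :: "(real^3) set \<Rightarrow> real set" where
  "vertex_coordinates K = {v $ i | v i. v \<in> vertices_of K}"

(* The real numbers with an expression in elementary functions of the members of A.  A partially
   defined function is only applied inside its domain, so that the default values of the total
   HOL functions play no role. *)
inductive_set elementary_in :: "real set \<Rightarrow> real set" for A :: "real set" where
  base: "x \<in> A \<Longrightarrow> x \<in> elementary_in A"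
| rat: "x \<in> \<rat> \<Longrightarrow> x \<in> elementary_in A"
| add: "x \<in> elementary_in A \<Longrightarrow> y \<in> elementary_in A \<Longrightarrow> x + y \<in> elementary_in A"
| diff: "x \<in> elementary_in A \<Longrightarrow> y \<in> elementary_in A \<Longrightarrow> x - y \<in> elementary_in A"
| mult: "x \<in> elementary_in A \<Longrightarrow> y \<in> elementary_in A \<Longrightarrow> x * y \<in> elementary_in A"
| divide: "x \<in> elementary_in A \<Longrightarrow> y \<in> elementary_in A \<Longrightarrow> y \<noteq> 0 \<Longrightarrow> x / y \<in> elementary_in A"
| root: "x \<in> elementary_in A \<Longrightarrow> n > 0 \<Longrightarrow> x \<ge> 0 \<or> odd n \<Longrightarrow> root n x \<in> elementary_in A"
| exp: "x \<in> elementary_in A \<Longrightarrow> exp x \<in> elementary_in A"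
| ln: "x \<in> elementary_in A \<Longrightarrow> x > 0 \<Longrightarrow> ln x \<in> elementary_in A"
| sin: "x \<in> elementary_in A \<Longrightarrow> sin x \<in> elementary_in A"
| cos: "x \<in> elementary_in A \<Longrightarrow> cos x \<in> elementary_in A"
| tan: "x \<in> elementary_in A \<Longrightarrow> cos x \<noteq> 0 \<Longrightarrow> tan x \<in> elementary_in A"
| arcsin: "x \<in> elementary_in A \<Longrightarrow> \<bar>x\<bar> \<le> 1 \<Longrightarrow> arcsin x \<in> elementary_in A"
| arccos: "x \<in> elementary_in A \<Longrightarrow> \<bar>x\<bar> \<le> 1 \<Longrightarrow> arccos x \<in> elementary_in A"
| arctan: "x \<in> elementary_in A \<Longrightarrow> arctan x \<in> elementary_in A"
| sinh: "x \<in> elementary_in A \<Longrightarrow> sinh x \<in> elementary_in A"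
| cosh: "x \<in> elementary_in A \<Longrightarrow> cosh x \<in> elementary_in A"
| tanh: "x \<in> elementary_in A \<Longrightarrow> tanh x \<in> elementary_in A"
| arsinh: "x \<in> elementary_in A \<Longrightarrow> arsinh x \<in> elementary_in A"
| arcosh: "x \<in> elementary_in A \<Longrightarrow> x \<ge> 1 \<Longrightarrow> arcosh x \<in> elementary_in A"
| artanh: "x \<in> elementary_in A \<Longrightarrow> \<bar>x\<bar> < 1 \<Longrightarrow> artanh x \<in> elementary_in A"

end

theory Submission imports Defs begin

text \<open>
  Let \<open>E\<close> be the field of numbers elementary in the vertex coordinates.  A facet of \<open>K\<close> is a
  bounded subset of its plane, and the extreme points of its convex hull are vertices of \<open>K\<close>, so the
  facet plane passes through three non-collinear vertices and has an equation over \<open>E\<close>.  Hence the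
  indicator of \<open>K\<close> is, almost everywhere, a combination of indicators of half-spaces over \<open>E\<close>.

  The substitution \<open>z = y - x\<close> turns the moment into an integral of \<open>\<parallel>z\<parallel>\<^sup>p G(z)\<close>, where \<open>G\<close> is the
  covariogram of \<open>K\<close>.  Fourier-Motzkin elimination shows that \<open>G\<close> is piecewise polynomial over \<open>E\<close>;
  for even \<open>p\<close> this already suffices.  For odd \<open>p\<close>, cut the cells into pyramids with apex 0 and rotate the
  base of each pyramid so that it becomes orthogonal to the first axis (\<open>E\<close> is closed under square
  roots); the substitution \<open>z = x (1, w)\<close> then removes one dimension.  Doing this twice leaves the
  integrals of \<open>x\<^sup>k\<^sup>+\<^sup>1 t\<^sup>j / sqrt (1 + x\<^sup>2 (1 + t\<^sup>2))\<close> with \<open>j \<le> k\<close> over rectangles, which integration by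
  parts reduces to inverse trigonometric and hyperbolic functions.
\<close>

subsection \<open>Lebesgue integrals over Euclidean spaces\<close>

text \<open>No cell decomposition is ever built. Each elimination works in the linear span of
  generators that carry a single bound in the direction to be integrated (\<open>fibre_span\<close>,
  \<open>cone_span\<close>, \<open>step_poly\<close>). Multiplication by a second half-space is
  settled by asking which of the two bounds is sharper; the comparison is itself a half-space in the
  remaining data, or one between two constants, so the span stays closed. The obstacle is that the
  double integrals at the end are under control only for a restricted range of exponents.
  Homogeneity supplies the restriction: a pyramid carries a polynomial of some degree k, so scaling
  its slice produces at least as many factors x as there are factors t. This is why polynomials are
  split by degree before the radial integration. Both radial passes are instances of one lemma, with
  the kernels s and 1 / sqrt (1 + s^2). Transcendental functions enter only in the last
  two-dimensional integral; everything before it uses closure under field operations and square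
  roots.\<close>

lemma integrable_bounded_support:
  fixes f :: "'a::euclidean_space \<Rightarrow> real"
  assumes [measurable]: "f \<in> borel_measurable borel"
    and "\<And>x. \<bar>f x\<bar> \<le> B" "\<And>x. f x \<noteq> 0 \<Longrightarrow> norm x \<le> r"
  shows "integrable lborel f"
proof (rule Bochner_Integration.integrable_bound)
  show "integrable lborel (\<lambda>x. indicator (cball 0 r) x * B)"
    by (intro integrable_mult_left integrable_real_indicator) (auto simp: emeasure_lborel_cball_finite[unfolded infinity_ennreal_def])
  show "AE x in lborel. norm (f x) \<le> norm (indicator (cball 0 r) x * B)"
  proof (rule AE_I2)
    show "norm (f x) \<le> norm (indicator (cball 0 r) x * B)" for x
      using assms(2,3)[of x] by (cases "f x = 0") (auto simp: indicator_def)
  qed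
qed simp

lemma nn_integral_lborel_shift:
  fixes f :: "'a::euclidean_space \<Rightarrow> ennreal"
  assumes [measurable]: "f \<in> borel_measurable borel"
  shows "(\<integral>\<^sup>+x. f (c + x) \<partial>lborel) = (\<integral>\<^sup>+x. f x \<partial>lborel)"
  by (subst (2) lborel_distr_plus[symmetric, of c]) (simp add: nn_integral_distr)

lemma integral_lborel_shift:
  fixes f :: "'a::euclidean_space \<Rightarrow> real"
  assumes [measurable]: "f \<in> borel_measurable borel"
  shows "(\<integral>x. f (c + x) \<partial>lborel) = (\<integral>x. f x \<partial>lborel)"
  by (subst (2) lborel_distr_plus[symmetric, of c]) (simp add: integral_distr)

text \<open>The usual argument for the uniqueness of Haar measure, with the unit ball as test set.\<close>

lemma lborel_distr_isometry:
  fixes H :: "'a::euclidean_space \<Rightarrow> 'b::euclidean_space"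
  assumes lin: "linear H" and iso: "\<And>x. norm (H x) = norm x" and "surj H" and dim: "DIM('a) = DIM('b)"
  shows "distr lborel borel H = lborel"
proof (rule measure_eqI)
  have [measurable]: "H \<in> borel_measurable borel"
    using lin by (intro borel_measurable_continuous_onI linear_continuous_on) (simp add: linear_conv_bounded_linear)
  fix A assume "A \<in> sets (distr lborel borel H)"
  then have [measurable]: "A \<in> sets borel" by simp
  define f :: "'b \<Rightarrow> ennreal" where "f = indicator A"
  define g :: "'b \<Rightarrow> ennreal" where "g = indicator (cball 0 1)"
  define c where "c = emeasure lborel (cball (0::'b) 1)"
  have [measurable]: "f \<in> borel_measurable borel" unfolding f_def by measurable
  have [measurable]: "cball (0::'a) 1 \<in> sets borel" "cball (0::'b) 1 \<in> sets borel" by (simp_all add: borel_closed)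
  have [measurable]: "g \<in> borel_measurable borel" unfolding g_def by measurable
  \<comment> \<open>Domain and target may be different types; equal dimension gives their unit balls
    the same volume.\<close>
  have c: "c > 0" "c < \<infinity>" and c': "c = emeasure lborel (cball (0::'a) 1)"
    unfolding c_def using dim by (auto simp: emeasure_cball unit_ball_vol_pos)
  have "(\<integral>\<^sup>+x. f (H x) \<partial>lborel) * c = (\<integral>\<^sup>+x. f (H x) * (\<integral>\<^sup>+y. g (- H x + y) \<partial>lborel) \<partial>lborel)"
    by (subst nn_integral_lborel_shift) (simp_all add: g_def c_def nn_integral_multc)
  also have "\<dots> = (\<integral>\<^sup>+x. \<integral>\<^sup>+y. f (H x) * g (- H x + y) \<partial>lborel \<partial>lborel)"
    by (simp add: nn_integral_cmult)
  also have "\<dots> = (\<integral>\<^sup>+y. \<integral>\<^sup>+x. f (H x) * g (- H x + y) \<partial>lborel \<partial>lborel)"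
    by (rule lborel_pair.Fubini') measurable
  also have "\<dots> = (\<integral>\<^sup>+y. \<integral>\<^sup>+x. f (H x + y) * indicator (cball 0 1) x \<partial>lborel \<partial>lborel)"
  proof (rule nn_integral_cong)
    fix y
    \<comment> \<open>Shifting \<open>x\<close> by a preimage of \<open>y\<close> moves the test
      ball to the origin, where \<open>H\<close> preserves it. Afterwards \<open>y\<close> occurs
      only in \<open>f\<close> and disappears by translation invariance.\<close>
    obtain u where u: "y = H u" using \<open>surj H\<close> by (metis surjD)
    have "(\<integral>\<^sup>+x. f (H x) * g (- H x + y) \<partial>lborel) = (\<integral>\<^sup>+x. f (H (u + x)) * g (- H (u + x) + y) \<partial>lborel)"
      by (rule nn_integral_lborel_shift[symmetric]) measurable
    also have "\<dots> = (\<integral>\<^sup>+x. f (H x + y) * indicator (cball 0 1) x \<partial>lborel)"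
      using lin by (intro nn_integral_cong) (auto simp: u linear_add g_def indicator_def iso add.commute)
    finally show "(\<integral>\<^sup>+x. f (H x) * g (- H x + y) \<partial>lborel) = (\<integral>\<^sup>+x. f (H x + y) * indicator (cball 0 1) x \<partial>lborel)" .
  qed
  also have "\<dots> = (\<integral>\<^sup>+x. \<integral>\<^sup>+y. f (H x + y) * indicator (cball 0 1) x \<partial>lborel \<partial>lborel)"
    by (rule lborel_pair.Fubini'[symmetric]) (auto simp del: mem_cball)
  also have "\<dots> = (\<integral>\<^sup>+x. (\<integral>\<^sup>+y. f y \<partial>lborel) * indicator (cball (0::'a) 1) x \<partial>lborel)"
    by (simp add: nn_integral_multc nn_integral_lborel_shift)
  also have "\<dots> = (\<integral>\<^sup>+y. f y \<partial>lborel) * c"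
    by (simp add: nn_integral_cmult c')
  finally have "(\<integral>\<^sup>+x. f (H x) \<partial>lborel) * c = (\<integral>\<^sup>+y. f y \<partial>lborel) * c" .
  then have "(\<integral>\<^sup>+x. f (H x) \<partial>lborel) = (\<integral>\<^sup>+y. f y \<partial>lborel)"
    using c by (metis ennreal_mult_cancel_left infinity_ennreal_def less_irrefl mult.commute)
  moreover have "(\<integral>\<^sup>+x. f (H x) \<partial>lborel) = emeasure (distr lborel borel H) A"
  proof -
    have "(\<integral>\<^sup>+x. f (H x) \<partial>lborel) = (\<integral>\<^sup>+x. f x \<partial>distr lborel borel H)"
      by (simp add: nn_integral_distr)
    then show ?thesis by (simp add: f_def)
  qed
  ultimately show "emeasure (distr lborel borel H) A = emeasure lborel A"
    by (simp add: f_def)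
qed simp

lemma integral_lborel_isometry:
  fixes H :: "'a::euclidean_space \<Rightarrow> 'b::euclidean_space" and f :: "'b \<Rightarrow> real"
  assumes lin: "linear H" and "\<And>x. norm (H x) = norm x" "surj H" "DIM('a) = DIM('b)"
    and [measurable]: "f \<in> borel_measurable borel"
  shows "(\<integral>x. f (H x) \<partial>lborel) = (\<integral>x. f x \<partial>lborel)"
proof -
  have [measurable]: "H \<in> borel_measurable borel"
    using lin by (intro borel_measurable_continuous_onI linear_continuous_on) (simp add: linear_conv_bounded_linear)
  have "(\<integral>x. f x \<partial>lborel) = (\<integral>x. f x \<partial>distr lborel borel H)"
    using lborel_distr_isometry[OF assms(1-4)] by simp
  also have "\<dots> = (\<integral>x. f (H x) \<partial>lborel)" by (simp add: integral_distr)
  finally show ?thesis by simp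
qed

lemma integral_lborel_Pair:
  fixes f :: "'a::euclidean_space \<times> 'b::euclidean_space \<Rightarrow> real"
  assumes "integrable lborel f"
  shows "(\<integral>z. f z \<partial>lborel) = (\<integral>x. \<integral>y. f (x, y) \<partial>lborel \<partial>lborel)"
  using assms by (simp add: lborel_prod[symmetric] lborel_pair.integral_fst')

lemma integral_lborel_swap:
  fixes f :: "'a::euclidean_space \<times> 'b::euclidean_space \<Rightarrow> real"
  assumes "integrable lborel f"
  shows "(\<integral>x. \<integral>y. f (x, y) \<partial>lborel \<partial>lborel) = (\<integral>y. \<integral>x. f (x, y) \<partial>lborel \<partial>lborel)"
  using lborel_pair.Fubini_integral[of "\<lambda>x y. f (x, y)"] assms by (simp add: lborel_prod)

subsection \<open>Elementary integrals over a wedge\<close>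

lemma elementary_numeral [simp]: "numeral n \<in> elementary_in A"
  by (rule elementary_in.rat) simp

lemma elementary_0 [simp]: "0 \<in> elementary_in A" and elementary_1 [simp]: "1 \<in> elementary_in A"
  by (rule elementary_in.rat; simp)+

lemma elementary_of_nat [simp]: "of_nat n \<in> elementary_in A"
  by (rule elementary_in.rat) simp

lemma elementary_power: "x \<in> elementary_in A \<Longrightarrow> x ^ n \<in> elementary_in A"
  by (induction n) (auto intro: elementary_in.mult)

lemma elementary_uminus: "x \<in> elementary_in A \<Longrightarrow> - x \<in> elementary_in A"
  using elementary_in.diff[OF elementary_0] by force

lemma elementary_sqrt: "x \<in> elementary_in A \<Longrightarrow> x \<ge> 0 \<Longrightarrow> sqrt x \<in> elementary_in A"
  unfolding sqrt_def by (rule elementary_in.root) auto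

lemmas elementary_intros = elementary_in.add elementary_in.diff elementary_in.mult elementary_in.divide
  elementary_power elementary_uminus elementary_sqrt
  elementary_0 elementary_1 elementary_numeral elementary_of_nat

text \<open>The primitive must exist on the whole line, so one \<open>F\<close> serves all
  endpoints. Its values are tested only at elementary arguments, which avoids a syntax of elementary
  functions.\<close>

definition elementary_primitive :: "real set \<Rightarrow> (real \<Rightarrow> real) \<Rightarrow> bool" where
  "elementary_primitive A f \<longleftrightarrow>
     (\<exists>F. (\<forall>x. (F has_real_derivative f x) (at x)) \<and> (\<forall>x\<in>elementary_in A. F x \<in> elementary_in A))"

lemma elementary_primitiveI:
  "(\<And>x. (F has_real_derivative f x) (at x)) \<Longrightarrow> (\<And>x. x \<in> elementary_in A \<Longrightarrow> F x \<in> elementary_in A)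
    \<Longrightarrow> elementary_primitive A f"
  unfolding elementary_primitive_def by blast

lemma elementary_primitive_diff:
  assumes "elementary_primitive A f" "elementary_primitive A g"
  shows "elementary_primitive A (\<lambda>x. f x - g x)"
proof -
  obtain F G where "\<And>x. (F has_real_derivative f x) (at x)" "\<And>x. x \<in> elementary_in A \<Longrightarrow> F x \<in> elementary_in A"
    "\<And>x. (G has_real_derivative g x) (at x)" "\<And>x. x \<in> elementary_in A \<Longrightarrow> G x \<in> elementary_in A"
    using assms unfolding elementary_primitive_def by blast
  then show ?thesis
    by (intro elementary_primitiveI[where F="\<lambda>x. F x - G x"]) (auto intro!: derivative_intros elementary_intros)
qed

lemma elementary_primitive_cmult:
  assumes "elementary_primitive A f" "c \<in> elementary_in A"
  shows "elementary_primitive A (\<lambda>x. c * f x)"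
proof -
  obtain F where "\<And>x. (F has_real_derivative f x) (at x)" "\<And>x. x \<in> elementary_in A \<Longrightarrow> F x \<in> elementary_in A"
    using assms unfolding elementary_primitive_def by blast
  then show ?thesis using assms(2)
    by (intro elementary_primitiveI[where F="\<lambda>x. c * F x"]) (auto intro!: elementary_intros DERIV_cmult)
qed

lemma elementary_primitive_add:
  assumes "elementary_primitive A f" "elementary_primitive A g"
  shows "elementary_primitive A (\<lambda>x. f x + g x)"
  using elementary_primitive_diff[OF assms(1) elementary_primitive_cmult[OF assms(2), of "-1"]]
  by (simp add: elementary_uminus)

lemma elementary_primitive_integral:
  assumes "elementary_primitive A f" "a \<in> elementary_in A" "b \<in> elementary_in A" "a \<le> b"
  shows "integral {a..b} f \<in> elementary_in A"
proof -
  obtain F where F: "\<And>x. (F has_real_derivative f x) (at x)" "\<And>x. x \<in> elementary_in A \<Longrightarrow> F x \<in> elementary_in A"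
    using assms unfolding elementary_primitive_def by blast
  have "(f has_integral (F b - F a)) {a..b}"
    using assms(4) F(1) by (intro fundamental_theorem_of_calculus)
      (auto simp: has_real_derivative_iff_has_vector_derivative[symmetric] intro: DERIV_subset)
  then have "integral {a..b} f = F b - F a" by (rule integral_unique)
  then show ?thesis using F(2) assms by (auto intro: elementary_intros)
qed

text \<open>Replacing \<open>\<beta> * t\<^sup>2\<close> by \<open>s t * s t - \<alpha>\<close> in
  the product rule leaves only the families \<open>t ^ j * s t\<close> and
  \<open>t ^ j / s t\<close>; the identity is the recursion between them.\<close>

lemma DERIV_power_mult_sqrt:
  fixes \<alpha> \<beta> t :: real
  assumes "\<alpha> > 0" "\<beta> > 0"
  defines "s \<equiv> \<lambda>t. sqrt (\<alpha> + \<beta> * t\<^sup>2)"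
  shows "((\<lambda>t. t ^ Suc j * s t) has_real_derivative (real (j + 2) * (t ^ j * s t) - \<alpha> * (t ^ j / s t))) (at t)"
proof -
  have pos: "\<alpha> + \<beta> * t\<^sup>2 > 0" for t using assms by (simp add: add_pos_nonneg)
  then have sp: "s t > 0" by (simp add: s_def)
  have ss: "s t * s t = \<alpha> + \<beta> * t\<^sup>2" using pos[of t] by (simp add: s_def)
  have "((\<lambda>t. t ^ Suc j * s t) has_real_derivative (real (Suc j) * t ^ j * s t + t ^ Suc j * (\<beta> * t / s t))) (at t)"
  proof -
    have "(s has_real_derivative \<beta> * t / s t) (at t)"
      unfolding s_def using pos[of t] by (auto intro!: derivative_eq_intros simp: divide_simps)
    from DERIV_mult[OF DERIV_pow[of "Suc j"] this] show ?thesis by (simp add: mult_ac)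
  qed
  moreover have "real (Suc j) * t ^ j * s t + t ^ Suc j * (\<beta> * t / s t) = real (j + 2) * (t ^ j * s t) - \<alpha> * (t ^ j / s t)"
  proof -
    have "t ^ Suc j * (\<beta> * t / s t) = t ^ j * (\<beta> * t\<^sup>2) / s t" by (simp add: power2_eq_square)
    also have "\<beta> * t\<^sup>2 = s t * s t - \<alpha>" using ss by simp
    also have "t ^ j * (s t * s t - \<alpha>) / s t = t ^ j * s t - \<alpha> * (t ^ j / s t)"
      using sp by (simp add: field_simps)
    finally show ?thesis by (simp add: algebra_simps)
  qed
  ultimately show ?thesis by simp
qed

text \<open>The two families are treated together since each feeds the other: the preceding
  derivative turns a primitive of the quotient into one of the product, and expressing
  \<open>\<beta> * t\<^sup>2\<close> by the square of the root turns both at \<open>j\<close> into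
  the quotient at \<open>j + 2\<close>. The recursion starts with an arsinh and with the root
  itself.\<close>

lemma elementary_primitive_power_sqrt:
  assumes "\<alpha> > 0" "\<beta> > 0" "\<alpha> \<in> elementary_in A" "\<beta> \<in> elementary_in A"
  shows "elementary_primitive A (\<lambda>t. t ^ j / sqrt (\<alpha> + \<beta> * t\<^sup>2)) \<and>
         elementary_primitive A (\<lambda>t. t ^ j * sqrt (\<alpha> + \<beta> * t\<^sup>2))"
proof -
  let ?s = "\<lambda>t::real. sqrt (\<alpha> + \<beta> * t\<^sup>2)"
  have pos: "\<alpha> + \<beta> * t\<^sup>2 > 0" for t using assms by (simp add: add_pos_nonneg)
  have el: "?s x \<in> elementary_in A" if "x \<in> elementary_in A" for x
    using that assms less_imp_le[OF pos[of x]] by (intro elementary_intros)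
  have D: "elementary_primitive A (\<lambda>t. real (j + 2) * (t ^ j * ?s t) - \<alpha> * (t ^ j / ?s t))" for j :: nat
    by (rule elementary_primitiveI[OF DERIV_power_mult_sqrt[OF assms(1,2)]])
      (intro elementary_in.mult elementary_power el; assumption)
  have M: "elementary_primitive A (\<lambda>t. t ^ j * ?s t)" if "elementary_primitive A (\<lambda>t. t ^ j / ?s t)" for j
  proof -
    have "elementary_primitive A (\<lambda>t. 1 / real (j + 2) *
        ((real (j + 2) * (t ^ j * ?s t) - \<alpha> * (t ^ j / ?s t)) + \<alpha> * (t ^ j / ?s t)))"
      by (intro elementary_primitive_cmult elementary_primitive_add D that assms elementary_intros) simp
    moreover have "1 / n * ((n * X - Y) + Y) = X" if "n \<noteq> 0" for n X Y :: real
      using that by simp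
    ultimately show ?thesis by (metis (no_types, lifting) ext of_nat_eq_0_iff add_is_0 zero_neq_numeral)
  qed
  have "elementary_primitive A (\<lambda>t. t ^ j / ?s t)"
  proof (induction j rule: induct_nat_012)
    case 0
    show ?case
    proof (rule elementary_primitiveI[where F="\<lambda>t. arsinh (t * sqrt (\<beta> / \<alpha>)) / sqrt \<beta>"])
      fix x :: real
      have "sqrt \<alpha> * sqrt ((x * sqrt (\<beta> / \<alpha>))\<^sup>2 + 1) = ?s x"
        using assms by (simp add: real_sqrt_mult[symmetric] power_mult_distrib field_simps)
      then have eq: "1 / sqrt ((x * sqrt (\<beta> / \<alpha>))\<^sup>2 + 1) = sqrt \<alpha> / ?s x"
        using assms pos[of x] by (auto simp: field_simps)
      have "((\<lambda>t. arsinh (t * sqrt (\<beta> / \<alpha>)) / sqrt \<beta>) has_real_derivative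
          1 / sqrt ((x * sqrt (\<beta> / \<alpha>))\<^sup>2 + 1) * (1 * sqrt (\<beta> / \<alpha>)) / sqrt \<beta>) (at x)"
        by (intro DERIV_cdivide DERIV_chain2[OF arsinh_real_has_field_derivative] DERIV_cmult_right DERIV_ident)
      then show "((\<lambda>t. arsinh (t * sqrt (\<beta> / \<alpha>)) / sqrt \<beta>) has_real_derivative x ^ 0 / ?s x) (at x)"
        by (rule DERIV_cong) (simp only: eq, use assms in \<open>simp add: real_sqrt_divide\<close>)
    next
      fix x assume "x \<in> elementary_in A"
      then show "arsinh (x * sqrt (\<beta> / \<alpha>)) / sqrt \<beta> \<in> elementary_in A"
        using assms by (intro elementary_intros elementary_in.arsinh) auto
    qed
  next
    case 1
    show ?case
    proof (rule elementary_primitiveI[where F="\<lambda>t. ?s t / \<beta>"])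
      show "((\<lambda>t. ?s t / \<beta>) has_real_derivative x ^ Suc 0 / ?s x) (at x)" for x
        using assms pos[of x] by (auto intro!: derivative_eq_intros simp: field_simps)
    qed (use assms el in \<open>auto intro!: elementary_in.divide\<close>)
  next
    case (ge2 j)
    have "elementary_primitive A (\<lambda>t. 1 / \<beta> * (t ^ j * ?s t - \<alpha> * (t ^ j / ?s t)))"
      using assms ge2(1) M[OF ge2(1)]
      by (intro elementary_primitive_cmult elementary_primitive_diff elementary_intros) auto
    moreover have "1 / \<beta> * (t ^ j * ?s t - \<alpha> * (t ^ j / ?s t)) = t ^ Suc (Suc j) / ?s t" for t
    proof -
      have "?s t * ?s t = \<alpha> + \<beta> * t\<^sup>2" "?s t \<noteq> 0" using pos[of t] by auto
      then have "t ^ j * ?s t - \<alpha> * (t ^ j / ?s t) = \<beta> * (t ^ Suc (Suc j) / ?s t)"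
        by (simp add: field_simps power2_eq_square del: real_sqrt_mult_self)
      then show ?thesis using assms by simp
    qed
    ultimately show ?case by simp
  qed
  then show ?thesis using M by blast
qed

section \<open>Double integrals with one explicit inner primitive\<close>

lemma integral_cbox_primitive_fst:
  fixes f :: "real \<times> real \<Rightarrow> real"
  assumes "continuous_on UNIV f" "0 \<le> R" "\<And>x t. ((\<lambda>x. F x t) has_real_derivative f (x, t)) (at x)"
  shows "integral (cbox (0,0) (R,m)) f = integral {0..m} (\<lambda>t. F R t - F 0 t)"
proof -
  have c: "continuous_on (cbox (0,0) (R,m)) (\<lambda>(x,t). f (x,t))"
    using assms(1) by (auto intro: continuous_on_subset)
  have "integral {0..R} (\<lambda>x. f (x, t)) = F R t - F 0 t" for t
    using assms(2,3) by (intro integral_unique fundamental_theorem_of_calculus)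
      (auto simp: has_real_derivative_iff_has_vector_derivative[symmetric] intro: DERIV_subset)
  moreover have "integral (cbox (0,0) (R,m)) f = integral (cbox 0 m) (\<lambda>t. integral (cbox 0 R) (\<lambda>x. f (x, t)))"
    using integral_swap_continuous[OF c] integral_prod_continuous[OF c] by simp
  ultimately show ?thesis by simp
qed

lemma integral_cbox_primitive_snd:
  fixes f :: "real \<times> real \<Rightarrow> real"
  assumes "continuous_on UNIV f" "0 \<le> m" "\<And>x t. ((\<lambda>t. F x t) has_real_derivative f (x, t)) (at t)"
  shows "integral (cbox (0,0) (R,m)) f = integral {0..R} (\<lambda>x. F x m - F x 0)"
proof -
  have c: "continuous_on (cbox (0,0) (R,m)) (\<lambda>(x,t). f (x,t))"
    using assms(1) by (auto intro: continuous_on_subset)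
  have "integral {0..m} (\<lambda>t. f (x, t)) = F x m - F x 0" for x
    using assms(2,3) by (intro integral_unique fundamental_theorem_of_calculus)
      (auto simp: has_real_derivative_iff_has_vector_derivative[symmetric] intro: DERIV_subset)
  then show ?thesis using integral_prod_continuous[OF c] by simp
qed

text \<open>This is the length of \<open>(1, x, x * t)\<close>: up to a positive factor, the form
  that the norm takes after the radial substitution has been made twice.\<close>

definition slant :: "real \<Rightarrow> real \<Rightarrow> real" where
  "slant x t = sqrt (1 + x\<^sup>2 * (1 + t\<^sup>2))"

lemma slant_pos: "slant x t > 0"
  by (simp add: slant_def add_pos_nonneg)

lemma slant_neq_0 [simp]: "slant x t \<noteq> 0"
  using slant_pos[of x t] by simp

lemma slant_square: "slant x t * slant x t = 1 + x\<^sup>2 * (1 + t\<^sup>2)"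
  by (simp add: slant_def add_nonneg_nonneg)

lemma continuous_on_slant [continuous_intros]:
  assumes "continuous_on S f" "continuous_on S g" shows "continuous_on S (\<lambda>x. slant (f x) (g x))"
  unfolding slant_def by (intro continuous_intros assms)

lemma DERIV_slant_fst: "((\<lambda>x. slant x t) has_real_derivative x * (1 + t\<^sup>2) / slant x t) (at x)"
proof -
  have "1 + x\<^sup>2 * (1 + t\<^sup>2) > 0" by (simp add: add_pos_nonneg)
  then show ?thesis unfolding slant_def
    by (auto intro!: derivative_eq_intros simp: divide_simps)
qed

lemma DERIV_slant_snd: "((\<lambda>t. slant x t) has_real_derivative x\<^sup>2 * t / slant x t) (at t)"
proof -
  have "1 + x\<^sup>2 * (1 + t\<^sup>2) > 0" by (simp add: add_pos_nonneg)
  then show ?thesis unfolding slant_def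
    by (auto intro!: derivative_eq_intros simp: divide_simps)
qed

lemma slant_eq_fst: "slant x t = sqrt ((1 + x\<^sup>2) + x\<^sup>2 * t\<^sup>2)"
  and slant_eq_snd: "slant x t = sqrt (1 + (1 + t\<^sup>2) * x\<^sup>2)"
  by (simp_all add: slant_def algebra_simps)

text \<open>The exponent of the first variable is the degree \<open>k\<close> of a homogeneous
  integrand plus 1 for the Jacobian of \<open>(x, t)\<close> to \<open>(x, x * t)\<close>. The
  companion \<open>wedge_mult\<close> is what integration by parts produces.\<close>

definition wedge_quot :: "real \<Rightarrow> real \<Rightarrow> nat \<Rightarrow> nat \<Rightarrow> real" where
  "wedge_quot R m k j = integral (cbox (0,0) (R,m)) (\<lambda>z. fst z ^ Suc k * snd z ^ j / slant (fst z) (snd z))"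

definition wedge_mult :: "real \<Rightarrow> real \<Rightarrow> nat \<Rightarrow> nat \<Rightarrow> real" where
  "wedge_mult R m k j = integral (cbox (0,0) (R,m)) (\<lambda>z. fst z ^ Suc k * snd z ^ j * slant (fst z) (snd z))"

context
  fixes A :: "real set" and R m :: real
  assumes R: "R > 0" "R \<in> elementary_in A" and m: "m \<ge> 0" "m \<in> elementary_in A"
begin

private abbreviation (input) "E \<equiv> elementary_in A"
private abbreviation (input) "B \<equiv> cbox (0::real,0::real) (R,m)"

private lemma int_quot: "(\<lambda>z. fst z ^ k * snd z ^ j / slant (fst z) (snd z)) integrable_on B"
  and int_mult: "(\<lambda>z. fst z ^ k * snd z ^ j * slant (fst z) (snd z)) integrable_on B"
  by (intro integrable_continuous continuous_intros; simp)+

private lemma power_slant_primitive: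
  "elementary_primitive A (\<lambda>t. t ^ j / slant R t) \<and> elementary_primitive A (\<lambda>t. t ^ j * slant R t)"
  unfolding slant_eq_fst using R
  by (intro elementary_primitive_power_sqrt) (auto intro!: elementary_intros simp: add_pos_nonneg)

private lemma slant_power_primitive:
  "t \<in> E \<Longrightarrow> elementary_primitive A (\<lambda>x. x ^ j / slant x t) \<and> elementary_primitive A (\<lambda>x. x ^ j * slant x t)"
  unfolding slant_eq_snd
  by (intro elementary_primitive_power_sqrt) (auto intro!: elementary_intros simp: add_pos_nonneg)

private lemma power_slant_integral: "integral {0..m} (\<lambda>t. t ^ j * slant R t) \<in> E"
  using m by (intro elementary_primitive_integral power_slant_primitive[THEN conjunct2]) auto

private lemma slant_power_integral: "t \<in> E \<Longrightarrow> integral {0..R} (\<lambda>x. x ^ j * slant x t) \<in> E"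
  using R by (intro elementary_primitive_integral slant_power_primitive[THEN conjunct2]) auto

text \<open>Comes from integrating the \<open>x\<close>-derivative of
  \<open>x ^ (k + 2) * t ^ j * slant x t\<close> over the rectangle: the side \<open>x = 0\<close>
  contributes nothing, the side \<open>x = R\<close> a one-variable integral.\<close>

lemma wedge_mult_reduce:
  "real (k + 3) * wedge_mult R m k j = wedge_quot R m k j + R ^ (k + 2) * integral {0..m} (\<lambda>t. t ^ j * slant R t)"
proof -
  have "((\<lambda>x. x ^ (k + 2) * t ^ j * slant x t) has_real_derivative
      (real (k + 3) * (x ^ Suc k * t ^ j * slant x t) - x ^ Suc k * t ^ j / slant x t)) (at x)" for x t
  proof -
    have "((\<lambda>x. x ^ Suc (Suc k) * slant x t) has_real_derivative
       (real (Suc k + 2) * (x ^ Suc k * slant x t) - 1 * (x ^ Suc k / slant x t))) (at x)"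
      unfolding slant_eq_snd by (rule DERIV_power_mult_sqrt) (auto simp: add_pos_nonneg)
    from DERIV_cmult[OF this, of "t ^ j"] show ?thesis by (simp add: field_simps)
  qed
  then have "integral B (\<lambda>z. real (k + 3) * (fst z ^ Suc k * snd z ^ j * slant (fst z) (snd z))
       - fst z ^ Suc k * snd z ^ j / slant (fst z) (snd z))
     = integral {0..m} (\<lambda>t. R ^ (k + 2) * t ^ j * slant R t - 0 ^ (k + 2) * t ^ j * slant 0 t)"
    using R by (intro integral_cbox_primitive_fst continuous_intros) auto
  also have "\<dots> = R ^ (k + 2) * integral {0..m} (\<lambda>t. t ^ j * slant R t)"
    by (simp add: mult.assoc)
  also have "integral B (\<lambda>z. real (k + 3) * (fst z ^ Suc k * snd z ^ j * slant (fst z) (snd z))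
       - fst z ^ Suc k * snd z ^ j / slant (fst z) (snd z)) = real (k + 3) * wedge_mult R m k j - wedge_quot R m k j"
    unfolding wedge_mult_def wedge_quot_def
    by (subst integral_diff[OF integrable_on_mult_right[OF int_mult] int_quot]) (simp only: integral_mult_right)
  finally show ?thesis by simp
qed

lemma wedge_mult_elementary: "wedge_quot R m k j \<in> E \<Longrightarrow> wedge_mult R m k j \<in> E"
proof -
  assume "wedge_quot R m k j \<in> E"
  then have "(wedge_quot R m k j + R ^ (k + 2) * integral {0..m} (\<lambda>t. t ^ j * slant R t)) / real (k + 3) \<in> E"
    using R by (intro elementary_intros power_slant_integral elementary_of_nat) auto
  then show ?thesis
    unfolding wedge_mult_reduce[symmetric] by (subst (asm) nonzero_mult_div_cancel_left) simp_all
qed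

text \<open>Two of the factors \<open>x\<close>, together with \<open>t / slant x t\<close>, form
  the \<open>t\<close>-derivative of \<open>slant\<close>; there are at least two because the first
  index is a successor.\<close>

lemma wedge_quot_1: "wedge_quot R m (Suc k) 1 \<in> E"
proof -
  have "wedge_quot R m (Suc k) 1 = integral {0..R} (\<lambda>x. x ^ k * slant x m - x ^ k * slant x 0)"
    unfolding wedge_quot_def
  proof (rule integral_cbox_primitive_snd)
    show "((\<lambda>t. x ^ k * slant x t) has_real_derivative
       fst (x, t) ^ Suc (Suc k) * snd (x, t) ^ 1 / slant (fst (x, t)) (snd (x, t))) (at t)" for x t
      using DERIV_cmult[OF DERIV_slant_snd[of x t], of "x ^ k"] by (simp add: power2_eq_square mult_ac)
  qed (use m in \<open>auto intro!: continuous_intros\<close>)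
  also have "\<dots> = integral {0..R} (\<lambda>x. x ^ k * slant x m) - integral {0..R} (\<lambda>x. x ^ k * slant x 0)"
    by (intro integral_diff integrable_continuous_real continuous_intros)
  also have "\<dots> \<in> E" using m by (intro elementary_intros slant_power_integral) auto
  finally show ?thesis .
qed

text \<open>Integration by parts in \<open>t\<close> applied to
  \<open>t ^ Suc j * slant x t\<close>: the derivative of \<open>slant\<close> raises the exponents
  of \<open>x\<close> and \<open>t\<close> together by two, so \<open>k - j\<close> is
  preserved.\<close>

lemma wedge_quot_step:
  assumes "wedge_quot R m k j \<in> E" shows "wedge_quot R m (k + 2) (j + 2) \<in> E"
proof -
  let ?q = "\<lambda>z. fst z ^ Suc (k + 2) * snd z ^ (j + 2) / slant (fst z) (snd z)"
  let ?s = "\<lambda>z. fst z ^ Suc k * snd z ^ j * slant (fst z) (snd z)"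
  have "integral B (\<lambda>z. (j + 1) * ?s z + ?q z)
     = integral {0..R} (\<lambda>x. x ^ Suc k * (m ^ Suc j * slant x m) - x ^ Suc k * (0 ^ Suc j * slant x 0))"
  proof (rule integral_cbox_primitive_snd)
    fix x t
    have "((\<lambda>t. x ^ Suc k * (t ^ Suc j * slant x t)) has_real_derivative
      x ^ Suc k * (real (Suc j) * t ^ j * slant x t + x\<^sup>2 * t / slant x t * t ^ Suc j)) (at t)"
      using DERIV_pow[of "Suc j" t] by (intro DERIV_cmult DERIV_mult DERIV_slant_snd) simp
    then show "((\<lambda>t. x ^ Suc k * (t ^ Suc j * slant x t)) has_real_derivative
       (j + 1) * ?s (x, t) + ?q (x, t)) (at t)"
      by (rule DERIV_cong) (simp add: field_simps power2_eq_square)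
  qed (use m in \<open>auto intro!: continuous_intros\<close>)
  also have "\<dots> = m ^ Suc j * integral {0..R} (\<lambda>x. x ^ Suc k * slant x m)"
    by (simp only: integral_mult_right[symmetric]) (simp add: mult_ac)
  also have "integral B (\<lambda>z. (j + 1) * ?s z + ?q z) = (j + 1) * wedge_mult R m k j + wedge_quot R m (k + 2) (j + 2)"
    unfolding wedge_mult_def wedge_quot_def
    by (subst integral_add[OF integrable_on_mult_right[OF int_mult] int_quot]) (simp only: integral_mult_right)
  finally have "wedge_quot R m (k + 2) (j + 2) =
      m ^ Suc j * integral {0..R} (\<lambda>x. x ^ Suc k * slant x m) - real (j + 1) * wedge_mult R m k j"
    by (simp add: algebra_simps)
  also have "\<dots> \<in> E" using m assms
    by (intro elementary_intros slant_power_integral wedge_mult_elementary elementary_of_nat)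
  finally show ?thesis .
qed

text \<open>Divide \<open>x\<^sup>2 = slant x t * slant x t - 1 - x\<^sup>2 * t\<^sup>2\<close> by
  \<open>slant x t\<close>. This serves the column \<open>j = 0\<close>, which integration by parts
  in \<open>t\<close> cannot lower.\<close>

lemma wedge_quot_step_0:
  "wedge_quot R m (k + 2) 0 = wedge_mult R m k 0 - wedge_quot R m k 0 - wedge_quot R m (k + 2) 2"
proof -
  let ?q = "\<lambda>k j z. fst z ^ Suc k * snd z ^ j / slant (fst z) (snd z)"
  let ?s = "\<lambda>z. fst z ^ Suc k * snd z ^ 0 * slant (fst z) (snd z)"
  have "?q (k + 2) 0 z = (?s z - ?q k 0 z) - ?q (k + 2) 2 z" for z
    using slant_square[of "fst z" "snd z"]
    by (simp add: field_simps power2_eq_square)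
  then have "wedge_quot R m (k + 2) 0 = integral B (\<lambda>z. (?s z - ?q k 0 z) - ?q (k + 2) 2 z)"
    unfolding wedge_quot_def by presburger
  also have "\<dots> = wedge_mult R m k 0 - wedge_quot R m k 0 - wedge_quot R m (k + 2) 2"
    unfolding wedge_mult_def wedge_quot_def
    by (subst integral_diff[OF integrable_diff[OF int_mult int_quot] int_quot],
        subst integral_diff[OF int_mult int_quot]) simp
  finally show ?thesis .
qed

text \<open>After the \<open>x\<close>-integral, expanding the square of \<open>slant R t\<close>
  cancels the denominator \<open>1 + t\<^sup>2\<close> from one term. The other,
  \<open>1 / ((1 + t\<^sup>2) * slant R t)\<close>, has the primitive
  \<open>arctan (t / slant R t)\<close>.\<close>

lemma wedge_quot_0_0: "wedge_quot R m 0 0 \<in> E"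
proof -
  have "wedge_quot R m 0 0 = integral {0..m} (\<lambda>t. slant R t / (1 + t\<^sup>2) - slant 0 t / (1 + t\<^sup>2))"
    unfolding wedge_quot_def
  proof (rule integral_cbox_primitive_fst)
    fix x t :: real
    have "1 + t\<^sup>2 > 0" by (simp add: add_pos_nonneg)
    then show "((\<lambda>x. slant x t / (1 + t\<^sup>2)) has_real_derivative
       fst (x, t) ^ Suc 0 * snd (x, t) ^ 0 / slant (fst (x, t)) (snd (x, t))) (at x)"
      using DERIV_cdivide[OF DERIV_slant_fst[of t x], of "1 + t\<^sup>2"] by simp
  qed (use R in \<open>auto intro!: continuous_intros\<close>)
  also have "\<dots> = integral {0..m} (\<lambda>t. R\<^sup>2 * (t ^ 0 / slant R t) + (1 / ((1 + t\<^sup>2) * slant R t) - 1 / (1 + t\<^sup>2)))"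
  proof (rule arg_cong[where f="integral _"], rule ext)
    fix t :: real
    have "1 + t\<^sup>2 > 0" by (simp add: add_pos_nonneg)
    moreover have "slant R t / (1 + t\<^sup>2) = (slant R t * slant R t) / ((1 + t\<^sup>2) * slant R t)" by simp
    ultimately have "slant R t / (1 + t\<^sup>2) = R\<^sup>2 / slant R t + 1 / ((1 + t\<^sup>2) * slant R t)"
      unfolding slant_square by (simp add: divide_simps)
    then show "slant R t / (1 + t\<^sup>2) - slant 0 t / (1 + t\<^sup>2)
       = R\<^sup>2 * (t ^ 0 / slant R t) + (1 / ((1 + t\<^sup>2) * slant R t) - 1 / (1 + t\<^sup>2))"
      by (simp add: slant_def)
  qed
  also have "\<dots> \<in> E"
  proof (rule elementary_primitive_integral)
    have "elementary_primitive A (\<lambda>t. 1 / ((1 + t\<^sup>2) * slant R t) - 1 / (1 + t\<^sup>2))"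
    proof (rule elementary_primitiveI[where F="\<lambda>t. arctan (t / slant R t) - arctan t"])
      fix t :: real
      let ?s = "slant R t"
      have p: "1 + t\<^sup>2 > 0" "1 + R\<^sup>2 > 0" by (simp_all add: add_pos_nonneg)
      \<comment> \<open>The numerator \<open>?s * ?s + t\<^sup>2\<close> factors as
        \<open>(1 + R\<^sup>2) * (1 + t\<^sup>2)\<close>; the factor \<open>1 + R\<^sup>2\<close>
        cancels against the next equation.\<close>
      have 1: "1 + (t / ?s)\<^sup>2 = (1 + R\<^sup>2) * (1 + t\<^sup>2) / (?s * ?s)"
      proof -
        have "(1 + (t / ?s)\<^sup>2) * (?s * ?s) = ?s * ?s + t\<^sup>2"
          by (simp add: power2_eq_square field_simps)
        also have "\<dots> = (1 + R\<^sup>2) * (1 + t\<^sup>2)" by (simp add: slant_square algebra_simps)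
        finally show ?thesis by (simp add: eq_divide_eq)
      qed
      have 2: "?s - t * (R\<^sup>2 * t / ?s) = (1 + R\<^sup>2) / ?s"
        using slant_square[of R t] by (simp add: field_simps power2_eq_square)
      have "((\<lambda>t. t / slant R t) has_real_derivative (?s - t * (R\<^sup>2 * t / ?s)) / (?s * ?s)) (at t)"
        using DERIV_divide[OF DERIV_ident DERIV_slant_snd[of R t]] by simp
      then have "((\<lambda>t. arctan (t / slant R t)) has_real_derivative
          inverse (1 + (t / ?s)\<^sup>2) * ((?s - t * (R\<^sup>2 * t / ?s)) / (?s * ?s))) (at t)"
        by (rule DERIV_chain2[OF DERIV_arctan])
      then have "((\<lambda>t. arctan (t / slant R t)) has_real_derivative 1 / ((1 + t\<^sup>2) * ?s)) (at t)"
        by (rule DERIV_cong) (simp only: 1 2, use p in \<open>simp add: divide_simps\<close>)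
      then show "((\<lambda>t. arctan (t / slant R t) - arctan t) has_real_derivative
          1 / ((1 + t\<^sup>2) * ?s) - 1 / (1 + t\<^sup>2)) (at t)"
        using DERIV_arctan[of t] by (auto intro!: DERIV_diff simp: inverse_eq_divide)
    next
      fix x assume "x \<in> E"
      then show "arctan (x / slant R x) - arctan x \<in> E"
        using R slant_pos[of R x]
        by (intro elementary_intros elementary_in.arctan) (auto simp: slant_def intro!: elementary_intros)
    qed
    moreover have "elementary_primitive A (\<lambda>t. R\<^sup>2 * (t ^ 0 / slant R t))"
      using R by (intro elementary_primitive_cmult power_slant_primitive[THEN conjunct1] elementary_intros)
    ultimately show "elementary_primitive A
       (\<lambda>t. R\<^sup>2 * (t ^ 0 / slant R t) + (1 / ((1 + t\<^sup>2) * slant R t) - 1 / (1 + t\<^sup>2)))"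
      by (intro elementary_primitive_add)
  qed (use m in auto)
  finally show ?thesis .
qed

text \<open>Here the \<open>t\<close>-integral is an arsinh, to be integrated against
  \<open>x\<close>. Its \<open>x\<close>-derivative has the denominator
  \<open>1 + x\<^sup>2\<close>; choosing \<open>(1 + x\<^sup>2) / 2\<close> as the primitive of
  \<open>x\<close> cancels it and leaves \<open>m / (2 * slant x m)\<close>.\<close>

lemma wedge_quot_1_0: "wedge_quot R m 1 0 \<in> E"
proof -
  define q where "q x = m * x / sqrt (1 + x\<^sup>2)" for x
  have p: "1 + x\<^sup>2 > 0" for x :: real by (simp add: add_pos_nonneg)
  have sq: "sqrt ((m * x / sqrt (1 + x\<^sup>2))\<^sup>2 + 1) = slant x m / sqrt (1 + x\<^sup>2)" for x
  proof -
    have "(m * x / sqrt (1 + x\<^sup>2))\<^sup>2 + 1 = (1 + x\<^sup>2 * (1 + m\<^sup>2)) / (1 + x\<^sup>2)"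
      using p[of x] by (simp add: power_divide power_mult_distrib field_simps)
    then show ?thesis by (simp add: slant_def real_sqrt_divide)
  qed
  have "wedge_quot R m 1 0 = integral {0..R} (\<lambda>x. x * arsinh (m * x / sqrt (1 + x\<^sup>2))
      - x * arsinh (0 * x / sqrt (1 + x\<^sup>2)))"
    unfolding wedge_quot_def
  proof (rule integral_cbox_primitive_snd)
    fix x t :: real
    have 1: "sqrt ((t * x / sqrt (1 + x\<^sup>2))\<^sup>2 + 1) = slant x t / sqrt (1 + x\<^sup>2)"
    proof -
      have "(t * x / sqrt (1 + x\<^sup>2))\<^sup>2 + 1 = (1 + x\<^sup>2 * (1 + t\<^sup>2)) / (1 + x\<^sup>2)"
        using p[of x] by (simp add: power_divide power_mult_distrib field_simps)
      then show ?thesis by (simp add: slant_def real_sqrt_divide)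
    qed
    have "((\<lambda>t. x * arsinh (t * x / sqrt (1 + x\<^sup>2))) has_real_derivative
       x * (1 / sqrt ((t * x / sqrt (1 + x\<^sup>2))\<^sup>2 + 1) * (1 * x / sqrt (1 + x\<^sup>2)))) (at t)"
      by (intro DERIV_cmult DERIV_chain2[OF arsinh_real_has_field_derivative] DERIV_cdivide DERIV_cmult_right DERIV_ident)
    then show "((\<lambda>t. x * arsinh (t * x / sqrt (1 + x\<^sup>2))) has_real_derivative
        fst (x, t) ^ Suc 1 * snd (x, t) ^ 0 / slant (fst (x, t)) (snd (x, t))) (at t)"
      by (rule DERIV_cong) (simp only: 1, use p[of x] in \<open>simp add: power2_eq_square\<close>)
  qed (use m in \<open>auto intro!: continuous_intros\<close>)
  also have "\<dots> = integral {0..R} (\<lambda>x. x * arsinh (m * x / sqrt (1 + x\<^sup>2)))" by simp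
  also have "\<dots> = integral {0..R} (\<lambda>x. (x * arsinh (m * x / sqrt (1 + x\<^sup>2)) + (m / 2) * (x ^ 0 / slant x m)) -
     (m / 2) * (x ^ 0 / slant x m))" by simp
  also have "\<dots> \<in> E"
  proof (rule elementary_primitive_integral)
    have "elementary_primitive A (\<lambda>x. x * arsinh (m * x / sqrt (1 + x\<^sup>2)) + (m / 2) * (x ^ 0 / slant x m))"
    proof (rule elementary_primitiveI[where F="\<lambda>x. (1 + x\<^sup>2) / 2 * arsinh (m * x / sqrt (1 + x\<^sup>2))"])
      fix x :: real
      let ?w = "sqrt (1 + x\<^sup>2)"
      have w: "?w > 0" "?w * ?w = 1 + x\<^sup>2" using p[of x] by auto
      have "((\<lambda>x. m * x / sqrt (1 + x\<^sup>2)) has_real_derivative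
          (m * ?w - m * x * (x / ?w)) / (?w * ?w)) (at x)"
        using p[of x] by (auto intro!: derivative_eq_intros simp: inverse_eq_divide)
      moreover have "(m * ?w - m * x * (x / ?w)) / (?w * ?w) = m / ((1 + x\<^sup>2) * ?w)"
      proof -
        have "m * ?w - m * x * (x / ?w) = m * (?w * ?w - x\<^sup>2) / ?w" using w(1) by (simp add: field_simps power2_eq_square)
        then show ?thesis using w by simp
      qed
      ultimately have d: "((\<lambda>x. m * x / sqrt (1 + x\<^sup>2)) has_real_derivative m / ((1 + x\<^sup>2) * ?w)) (at x)" by simp
      have "((\<lambda>x. arsinh (m * x / sqrt (1 + x\<^sup>2))) has_real_derivative
         1 / sqrt ((m * x / sqrt (1 + x\<^sup>2))\<^sup>2 + 1) * (m / ((1 + x\<^sup>2) * ?w))) (at x)"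
        by (rule DERIV_chain2[OF arsinh_real_has_field_derivative d])
      moreover have "1 / sqrt ((m * x / sqrt (1 + x\<^sup>2))\<^sup>2 + 1) * (m / ((1 + x\<^sup>2) * ?w)) = m / ((1 + x\<^sup>2) * slant x m)"
        unfolding sq using w p[of x] by simp
      ultimately have d2: "((\<lambda>x. arsinh (m * x / sqrt (1 + x\<^sup>2))) has_real_derivative m / ((1 + x\<^sup>2) * slant x m)) (at x)" by (rule DERIV_cong)
      have d1: "((\<lambda>x::real. (1 + x\<^sup>2) / 2) has_real_derivative x) (at x)"
        by (auto intro!: derivative_eq_intros)
      show "((\<lambda>x. (1 + x\<^sup>2) / 2 * arsinh (m * x / sqrt (1 + x\<^sup>2))) has_real_derivative
         x * arsinh (m * x / sqrt (1 + x\<^sup>2)) + (m / 2) * (x ^ 0 / slant x m)) (at x)"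
        using DERIV_mult[OF d1 d2] by (rule DERIV_cong) (use p[of x] in simp)
    next
      fix x assume "x \<in> E"
      then show "(1 + x\<^sup>2) / 2 * arsinh (m * x / sqrt (1 + x\<^sup>2)) \<in> E"
        using m p[of x] by (intro elementary_intros elementary_in.arsinh) auto
    qed
    moreover have "elementary_primitive A (\<lambda>x. (m / 2) * (x ^ 0 / slant x m))"
      using m by (intro elementary_primitive_cmult slant_power_primitive[THEN conjunct1] elementary_intros) auto
    ultimately show "elementary_primitive A (\<lambda>x. (x * arsinh (m * x / sqrt (1 + x\<^sup>2))
        + (m / 2) * (x ^ 0 / slant x m)) - (m / 2) * (x ^ 0 / slant x m))"
      by (intro elementary_primitive_diff)
  qed (use R in auto)
  finally show ?thesis .
qed

text \<open>Each reduction lowers both exponents by two, or keeps \<open>j\<close> at 0 and lowers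
  \<open>k\<close>, so \<open>j \<le> k\<close> survives and no negative power of \<open>x\<close>
  arises.\<close>

lemma wedge_quot_elementary: "j \<le> k \<Longrightarrow> wedge_quot R m k j \<in> E"
proof (induction k arbitrary: j rule: induct_nat_012)
  case 0
  then show ?case using wedge_quot_0_0 by simp
next
  case 1
  then have "j = 0 \<or> j = 1" by auto
  then show ?case using wedge_quot_1_0 wedge_quot_1[of 0] by auto
next
  case (ge2 k)
  consider "j = 0" | "j = 1" | i where "j = i + 2" "i \<le> k"
    using ge2.prems by (metis One_nat_def Suc_le_mono add_2_eq_Suc' not0_implies_Suc)
  then show ?case
  proof cases
    case 1
    have "wedge_mult R m k 0 - wedge_quot R m k 0 - wedge_quot R m (k + 2) (0 + 2) \<in> E"
      by (intro elementary_intros wedge_mult_elementary wedge_quot_step ge2.IH) auto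
    then show ?thesis using 1 wedge_quot_step_0[of k] by (simp add: numeral_2_eq_2)
  next
    case 2
    then show ?thesis using wedge_quot_1[of "Suc k"] by simp
  next
    case 3
    then show ?thesis using wedge_quot_step[OF ge2.IH(1)] by simp
  qed
qed

end

subsection \<open>Piecewise polynomials over a subfield of the reals\<close>

text \<open>The polyhedral part is linear algebra and polynomial integration, so it is done over an
  abstract field \<open>E\<close>; closure under square roots is added later, for the
  rotations.\<close>

locale real_subfield =
  fixes E :: "real set"
  assumes rat: "x \<in> \<rat> \<Longrightarrow> x \<in> E"
    and add: "x \<in> E \<Longrightarrow> y \<in> E \<Longrightarrow> x + y \<in> E"
    and diff: "x \<in> E \<Longrightarrow> y \<in> E \<Longrightarrow> x - y \<in> E"
    and mult: "x \<in> E \<Longrightarrow> y \<in> E \<Longrightarrow> x * y \<in> E"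
    and divide: "x \<in> E \<Longrightarrow> y \<in> E \<Longrightarrow> y \<noteq> 0 \<Longrightarrow> x / y \<in> E"
begin

lemma numeral_in [simp]: "numeral n \<in> E" and of_nat_in [simp]: "of_nat k \<in> E"
  and zero_in [simp]: "0 \<in> E" and one_in [simp]: "1 \<in> E"
  by (rule rat; simp)+

lemma divide_in: "x \<in> E \<Longrightarrow> y \<in> E \<Longrightarrow> x / y \<in> E"
  using divide by (cases "y = 0") auto

lemma uminus_in: "x \<in> E \<Longrightarrow> - x \<in> E"
  using diff[OF zero_in] by force

lemma power_in: "x \<in> E \<Longrightarrow> x ^ k \<in> E"
  by (induction k) (auto intro: mult)

lemma sum_in: "(\<And>i. i \<in> I \<Longrightarrow> f i \<in> E) \<Longrightarrow> (\<Sum>i\<in>I. f i) \<in> E"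
  by (induction I rule: infinite_finite_induct) (auto intro: add)

lemmas in_intros = add diff mult divide_in uminus_in power_in sum_in numeral_in of_nat_in zero_in one_in

definition points :: "'a::euclidean_space set" where
  "points = {v. \<forall>b\<in>Basis. v \<bullet> b \<in> E}"

lemma points_real [simp]: "(c::real) \<in> points \<longleftrightarrow> c \<in> E"
  by (simp add: points_def)

lemma points_zero [simp]: "0 \<in> points"
  by (simp add: points_def)

lemma points_Basis: "b \<in> Basis \<Longrightarrow> b \<in> points"
  by (auto simp: points_def inner_Basis)

lemma points_add: "v \<in> points \<Longrightarrow> w \<in> points \<Longrightarrow> v + w \<in> points"
  and points_diff: "v \<in> points \<Longrightarrow> w \<in> points \<Longrightarrow> v - w \<in> points"
  and points_uminus: "v \<in> points \<Longrightarrow> - v \<in> points"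
  and points_scaleR: "c \<in> E \<Longrightarrow> v \<in> points \<Longrightarrow> c *\<^sub>R v \<in> points"
  by (auto simp: points_def inner_add_left inner_diff_left intro: in_intros)

lemma inner_in: "v \<in> points \<Longrightarrow> w \<in> points \<Longrightarrow> v \<bullet> w \<in> E"
  by (subst euclidean_inner) (auto simp: points_def intro!: in_intros)

lemma points_Pair [simp]: "(v, w) \<in> points \<longleftrightarrow> v \<in> points \<and> w \<in> points"
  by (auto simp: points_def Basis_prod_def ball_Un)

lemma points_fst: "z \<in> points \<Longrightarrow> fst z \<in> points" and points_snd: "z \<in> points \<Longrightarrow> snd z \<in> points"
  using points_Pair[of "fst z" "snd z"] by auto

text \<open>Half-space indicators are adjoined to the polynomials instead of naming cells, so
  products such as the integrand of the covariogram need no common refinement. Closed half-spaces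
  arise as 1 minus an open one.\<close>

inductive_set pw_poly :: "('a::euclidean_space \<Rightarrow> real) set" where
  pw_poly_const: "c \<in> E \<Longrightarrow> (\<lambda>_. c) \<in> pw_poly"
| pw_poly_inner: "v \<in> points \<Longrightarrow> (\<lambda>x. v \<bullet> x) \<in> pw_poly"
| pw_poly_pos: "v \<in> points \<Longrightarrow> b \<in> E \<Longrightarrow> (\<lambda>x. of_bool (v \<bullet> x + b > 0)) \<in> pw_poly"
| pw_poly_add: "f \<in> pw_poly \<Longrightarrow> g \<in> pw_poly \<Longrightarrow> (\<lambda>x. f x + g x) \<in> pw_poly"
| pw_poly_mult: "f \<in> pw_poly \<Longrightarrow> g \<in> pw_poly \<Longrightarrow> (\<lambda>x. f x * g x) \<in> pw_poly"

lemma pw_poly_uminus: "f \<in> pw_poly \<Longrightarrow> (\<lambda>x. - f x) \<in> pw_poly"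
  using pw_poly_mult[OF pw_poly_const[of "-1"]] by (simp add: uminus_in)

lemma pw_poly_diff: "f \<in> pw_poly \<Longrightarrow> g \<in> pw_poly \<Longrightarrow> (\<lambda>x. f x - g x) \<in> pw_poly"
  using pw_poly_add[OF _ pw_poly_uminus, of f g] by simp

lemma pw_poly_power: "f \<in> pw_poly \<Longrightarrow> (\<lambda>x. f x ^ k) \<in> pw_poly"
  by (induction k) (auto intro: pw_poly_const pw_poly_mult)

lemma pw_poly_sum: "(\<And>i. i \<in> I \<Longrightarrow> f i \<in> pw_poly) \<Longrightarrow> (\<lambda>x. \<Sum>i\<in>I. f i x) \<in> pw_poly"
  by (induction I rule: infinite_finite_induct) (auto intro: pw_poly_const pw_poly_add)

lemma pw_poly_prod: "(\<And>i. i \<in> I \<Longrightarrow> f i \<in> pw_poly) \<Longrightarrow> (\<lambda>x. \<Prod>i\<in>I. f i x) \<in> pw_poly"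
  by (induction I rule: infinite_finite_induct) (auto intro: pw_poly_const pw_poly_mult)

lemma pw_poly_affine: "v \<in> points \<Longrightarrow> b \<in> E \<Longrightarrow> (\<lambda>x. v \<bullet> x + b) \<in> pw_poly"
  by (intro pw_poly_add pw_poly_inner pw_poly_const)

lemma pw_poly_norm_power2: "(\<lambda>x. (norm x)\<^sup>2) \<in> pw_poly"
proof -
  have "(\<lambda>x::'a. \<Sum>b\<in>Basis. (b \<bullet> x)\<^sup>2) \<in> pw_poly"
    by (intro pw_poly_sum pw_poly_power pw_poly_inner points_Basis)
  moreover have "(\<Sum>b\<in>Basis. (b \<bullet> x)\<^sup>2) = (norm x)\<^sup>2" for x :: 'a
    unfolding power2_norm_eq_inner by (subst euclidean_inner) (simp add: power2_eq_square inner_commute)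
  ultimately show ?thesis by simp
qed

lemma pw_poly_in: "f \<in> pw_poly \<Longrightarrow> x \<in> points \<Longrightarrow> f x \<in> E"
  by (induction f rule: pw_poly.induct) (auto intro: in_intros inner_in simp: of_bool_def)

lemma pw_poly_measurable [measurable_dest]: "f \<in> pw_poly \<Longrightarrow> f \<in> borel_measurable borel"
  by (induction f rule: pw_poly.induct) auto

lemma pw_poly_bounded: "f \<in> pw_poly \<Longrightarrow> \<exists>B. \<forall>x. norm x \<le> r \<longrightarrow> \<bar>f x\<bar> \<le> B"
proof (induction f rule: pw_poly.induct)
  case (pw_poly_inner v)
  have "\<bar>v \<bullet> x\<bar> \<le> norm v * r" if "norm x \<le> r" for x
    using Cauchy_Schwarz_ineq2[of v x] mult_left_mono[OF that norm_ge_zero[of v]] by linarith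
  then show ?case by blast
next
  case (pw_poly_pos v b)
  then show ?case by (intro exI[of _ 1]) auto
next
  case (pw_poly_add f g)
  then obtain B C where "\<forall>x. norm x \<le> r \<longrightarrow> \<bar>f x\<bar> \<le> B" "\<forall>x. norm x \<le> r \<longrightarrow> \<bar>g x\<bar> \<le> C" by blast
  then show ?case by (intro exI[of _ "B + C"]) (fastforce intro: order_trans[OF abs_triangle_ineq])
next
  case (pw_poly_mult f g)
  then obtain B C where "\<forall>x. norm x \<le> r \<longrightarrow> \<bar>f x\<bar> \<le> B" "\<forall>x. norm x \<le> r \<longrightarrow> \<bar>g x\<bar> \<le> C" by blast
  then show ?case by (intro exI[of _ "B * C"]) (auto simp: abs_mult intro!: mult_mono order_trans[OF abs_ge_zero])
qed auto

text \<open>Stated through the pullback of functionals: this is what substitution into the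
  generators of \<open>pw_poly\<close> requires, and it avoids matrices.\<close>

definition affine_over :: "('a::euclidean_space \<Rightarrow> 'b::euclidean_space) \<Rightarrow> bool" where
  "affine_over L \<longleftrightarrow> (\<forall>v\<in>points. \<exists>w\<in>points. \<exists>c\<in>E. \<forall>x. v \<bullet> L x = w \<bullet> x + c)"

lemma pw_poly_compose:
  assumes L: "affine_over L" and "f \<in> pw_poly" shows "(\<lambda>x. f (L x)) \<in> pw_poly"
  using assms(2)
proof (induction f rule: pw_poly.induct)
  case (pw_poly_inner v)
  then obtain w c where "w \<in> points" "c \<in> E" "\<And>x. v \<bullet> L x = w \<bullet> x + c" using L unfolding affine_over_def by blast
  then show ?case by (auto intro: pw_poly_affine)
next
  case (pw_poly_pos v b)
  then obtain w c where "w \<in> points" "c \<in> E" "\<And>x. v \<bullet> L x = w \<bullet> x + c" using L unfolding affine_over_def by blast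
  then show ?case using pw_poly.pw_poly_pos[of w "c + b"] pw_poly_pos by (auto intro: add simp: add.assoc)
qed (auto intro: pw_poly.intros)

lemma affine_over_id: "affine_over (\<lambda>x. x)"
  unfolding affine_over_def by (metis add.right_neutral zero_in)

lemma affine_over_const: "p \<in> points \<Longrightarrow> affine_over (\<lambda>_. p)"
  unfolding affine_over_def by (metis add_0 inner_in inner_zero_left points_zero)

lemma affine_over_add:
  assumes "affine_over L" "affine_over M" shows "affine_over (\<lambda>x. L x + M x)"
  unfolding affine_over_def
proof
  fix v :: 'b assume "v \<in> points"
  then obtain w c w' c' where "w \<in> points" "c \<in> E" "\<And>x. v \<bullet> L x = w \<bullet> x + c"
    "w' \<in> points" "c' \<in> E" "\<And>x. v \<bullet> M x = w' \<bullet> x + c'"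
    using assms unfolding affine_over_def by meson
  then show "\<exists>w\<in>points. \<exists>c\<in>E. \<forall>x. v \<bullet> (L x + M x) = w \<bullet> x + c"
    by (intro bexI[of _ "w + w'"] bexI[of _ "c + c'"]) (auto simp: inner_add_left inner_add_right intro: add points_add)
qed

lemma affine_over_Pair:
  assumes "affine_over L" "affine_over M" shows "affine_over (\<lambda>x. (L x, M x))"
  unfolding affine_over_def
proof
  fix v :: "'b \<times> 'c" assume "v \<in> points"
  then have "fst v \<in> points" "snd v \<in> points" by (auto intro: points_fst points_snd)
  then obtain w c w' c' where "w \<in> points" "c \<in> E" "\<And>x. fst v \<bullet> L x = w \<bullet> x + c"
    "w' \<in> points" "c' \<in> E" "\<And>x. snd v \<bullet> M x = w' \<bullet> x + c'"
    using assms unfolding affine_over_def by meson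
  then show "\<exists>w\<in>points. \<exists>c\<in>E. \<forall>x. v \<bullet> (L x, M x) = w \<bullet> x + c"
    by (intro bexI[of _ "w + w'"] bexI[of _ "c + c'"]) (auto simp: inner_Pair_0 inner_prod_def inner_add_left intro: add points_add)
qed

lemma affine_over_fst: assumes "affine_over L" shows "affine_over (\<lambda>x. fst (L x))"
  unfolding affine_over_def
proof
  fix v :: 'b assume "v \<in> points"
  then have "(v, 0) \<in> points" by simp
  then obtain w c where "w \<in> points" "c \<in> E" "\<And>x. (v, 0) \<bullet> L x = w \<bullet> x + c"
    using assms unfolding affine_over_def by meson
  then show "\<exists>w\<in>points. \<exists>c\<in>E. \<forall>x. v \<bullet> fst (L x) = w \<bullet> x + c" by (auto simp: inner_prod_def)
qed

lemma affine_over_snd: assumes "affine_over L" shows "affine_over (\<lambda>x. snd (L x))"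
  unfolding affine_over_def
proof
  fix v :: 'c assume "v \<in> points"
  then have "(0, v) \<in> points" by simp
  then obtain w c where "w \<in> points" "c \<in> E" "\<And>x. (0, v) \<bullet> L x = w \<bullet> x + c"
    using assms unfolding affine_over_def by meson
  then show "\<exists>w\<in>points. \<exists>c\<in>E. \<forall>x. v \<bullet> snd (L x) = w \<bullet> x + c" by (auto simp: inner_prod_def)
qed

lemmas affine_over_intros = affine_over_id affine_over_const affine_over_add affine_over_Pair affine_over_fst affine_over_snd

section \<open>Integrating out one real coordinate\<close>

definition above :: "bool \<Rightarrow> real \<Rightarrow> bool" where
  "above s y \<longleftrightarrow> (if s then y > 0 else y \<ge> 0)"

lemma above_conj:
  "above s (t - m) \<and> above s' (t - m') \<longleftrightarrow>
    (if m > m' then above s (t - m) else if m < m' then above s' (t - m') else above (s \<or> s') (t - m))"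
  by (auto simp: above_def)

text \<open>Normal form in the last coordinate: one coefficient from the base, one power, one lower
  bound. An upper bound is the complement of a lower one. The flag of \<open>above\<close> records
  strictness so that the identities hold at every point; only the integration forgets it.\<close>

inductive_set fibre_span :: "('a::euclidean_space \<times> real \<Rightarrow> real) set" where
  fibre_span_zero: "(\<lambda>_. 0) \<in> fibre_span"
| fibre_span_add: "f \<in> fibre_span \<Longrightarrow> g \<in> fibre_span \<Longrightarrow> (\<lambda>z. f z + g z) \<in> fibre_span"
| fibre_span_gen: "g \<in> pw_poly \<Longrightarrow> w \<in> points \<Longrightarrow> c \<in> E \<Longrightarrow>
    (\<lambda>z. g (fst z) * snd z ^ k * of_bool (above s (snd z - (w \<bullet> fst z + c)))) \<in> fibre_span"

lemma fibre_span_mult_base: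
  assumes "f \<in> fibre_span" "h \<in> pw_poly" shows "(\<lambda>z. f z * h (fst z)) \<in> fibre_span"
  using assms(1)
proof (induction f rule: fibre_span.induct)
  case (fibre_span_gen g w c k s)
  then have "(\<lambda>x. g x * h x) \<in> pw_poly" using assms(2) by (intro pw_poly_mult)
  from fibre_span.fibre_span_gen[OF this fibre_span_gen(2,3), of k s] show ?case by (simp add: mult_ac)
qed (auto simp: distrib_right intro: fibre_span.intros)

lemma fibre_span_uminus: "f \<in> fibre_span \<Longrightarrow> (\<lambda>z. - f z) \<in> fibre_span"
  using fibre_span_mult_base[OF _ pw_poly_const[of "-1"]] by (simp add: uminus_in)

lemma fibre_span_diff: "f \<in> fibre_span \<Longrightarrow> g \<in> fibre_span \<Longrightarrow> (\<lambda>z. f z - g z) \<in> fibre_span"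
  using fibre_span_add[OF _ fibre_span_uminus, of f g] by simp

lemma fibre_span_mult_snd: assumes "f \<in> fibre_span" shows "(\<lambda>z. f z * snd z) \<in> fibre_span"
  using assms
proof (induction f rule: fibre_span.induct)
  case (fibre_span_gen g w c k s)
  from fibre_span.fibre_span_gen[OF this, of "Suc k" s] show ?case by (simp add: mult_ac)
qed (auto simp: distrib_right intro: fibre_span.intros)

text \<open>Two lower bounds combine into the larger one. \<open>P\<close> and \<open>Q\<close> say
  which one that is; the comparison does not involve the last coordinate, so it moves into the
  coefficient. Ties, where both vanish, are kept apart because there strictness decides.\<close>

lemma fibre_span_mult_above:
  assumes "f \<in> fibre_span" "w' \<in> points" "c' \<in> E"
  shows "(\<lambda>z. f z * of_bool (above s' (snd z - (w' \<bullet> fst z + c')))) \<in> fibre_span"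
  using assms(1)
proof (induction f rule: fibre_span.induct)
  case (fibre_span_gen g w c k s)
  define P where "P x = (of_bool ((w - w') \<bullet> x + (c - c') > 0) :: real)" for x
  define Q where "Q x = (of_bool ((w' - w) \<bullet> x + (c' - c) > 0) :: real)" for x
  have PQ: "P \<in> pw_poly" "Q \<in> pw_poly"
    unfolding P_def Q_def using fibre_span_gen assms(2,3) by (auto intro!: pw_poly_pos points_diff diff)
  have "(\<lambda>z. (g (fst z) * P (fst z)) * snd z ^ k * of_bool (above s (snd z - (w \<bullet> fst z + c)))
      + (g (fst z) * Q (fst z)) * snd z ^ k * of_bool (above s' (snd z - (w' \<bullet> fst z + c')))
      + (g (fst z) * (1 - P (fst z) - Q (fst z))) * snd z ^ k * of_bool (above (s \<or> s') (snd z - (w \<bullet> fst z + c)))) \<in> fibre_span"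
    by (intro fibre_span_add fibre_span.fibre_span_gen pw_poly_mult pw_poly_diff pw_poly_const PQ fibre_span_gen assms one_in)
  moreover have "(g (fst z) * P (fst z)) * snd z ^ k * of_bool (above s (snd z - (w \<bullet> fst z + c)))
      + (g (fst z) * Q (fst z)) * snd z ^ k * of_bool (above s' (snd z - (w' \<bullet> fst z + c')))
      + (g (fst z) * (1 - P (fst z) - Q (fst z))) * snd z ^ k * of_bool (above (s \<or> s') (snd z - (w \<bullet> fst z + c)))
      = g (fst z) * snd z ^ k * of_bool (above s (snd z - (w \<bullet> fst z + c))) * of_bool (above s' (snd z - (w' \<bullet> fst z + c')))"
      (is "?l = ?r") for z
  proof -
    have "?r = g (fst z) * snd z ^ k * of_bool (above s (snd z - (w \<bullet> fst z + c)) \<and> above s' (snd z - (w' \<bullet> fst z + c')))"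
      by simp
    also have "\<dots> = ?l"
      unfolding above_conj
      by (cases "w \<bullet> fst z + c" "w' \<bullet> fst z + c'" rule: linorder_cases)
        (auto simp: P_def Q_def inner_diff_left)
    finally show ?thesis by simp
  qed
  ultimately show ?case by simp
qed (auto simp: distrib_right intro: fibre_span.intros)

lemma fibre_span_mult_pw_poly:
  assumes "h \<in> pw_poly" "f \<in> fibre_span" shows "(\<lambda>z. f z * h z) \<in> fibre_span"
  using assms
proof (induction h arbitrary: f rule: pw_poly.induct)
  case (pw_poly_const c)
  then show ?case using fibre_span_mult_base[OF _ pw_poly.pw_poly_const[of c]] by simp
next
  case (pw_poly_inner v)
  then have "(\<lambda>z. f z * (fst v \<bullet> fst z) + f z * snd z * snd v) \<in> fibre_span"
    by (intro fibre_span_add fibre_span_mult_base[where h="\<lambda>x. fst v \<bullet> x"] fibre_span_mult_base[where h="\<lambda>x. snd v"] fibre_span_mult_snd pw_poly.intros)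
      (auto dest: points_fst points_snd)
  then show ?case by (simp add: inner_prod_def algebra_simps)
next
  case (pw_poly_pos v b)
  define a d where "a = fst v" "d = snd v"
  have ad: "a \<in> points" "d \<in> E" using points_fst[OF pw_poly_pos(1)] points_snd[OF pw_poly_pos(1)] by (auto simp: a_d_def)
  have in': "(- 1 / d) *\<^sub>R a \<in> points" "- (b / d) \<in> E"
    using ad pw_poly_pos(2) by (intro points_scaleR in_intros; simp)+
  consider "d = 0" | "d > 0" | "d < 0" by linarith
  then show ?case
  proof cases
    case 1
    have "(\<lambda>z. f z * of_bool (a \<bullet> fst z + b > 0)) \<in> fibre_span"
      using pw_poly_pos ad by (intro fibre_span_mult_base[where h="\<lambda>x. of_bool (a \<bullet> x + b > 0)"] pw_poly.pw_poly_pos)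
    then show ?thesis using 1 by (simp add: inner_prod_def a_d_def)
  next
    case 2
    have "v \<bullet> z + b > 0 \<longleftrightarrow> above True (snd z - (((- 1 / d) *\<^sub>R a) \<bullet> fst z + - (b / d)))" for z
      using 2 by (simp add: above_def inner_prod_def a_d_def[symmetric] field_simps)
    then show ?thesis using fibre_span_mult_above[OF pw_poly_pos(3) in', of True] by simp
  next
    \<comment> \<open>Division by a negative coefficient gives a strict upper bound, the complement
      of a weak lower bound.\<close>
    case 3
    have "v \<bullet> z + b > 0 \<longleftrightarrow> \<not> above False (snd z - (((- 1 / d) *\<^sub>R a) \<bullet> fst z + - (b / d)))" for z
      using 3 by (auto simp: above_def inner_prod_def a_d_def[symmetric] field_simps)
    then have "(\<lambda>z. f z * of_bool (v \<bullet> z + b > 0)) = (\<lambda>z. f z - f z *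
        of_bool (above False (snd z - (((- 1 / d) *\<^sub>R a) \<bullet> fst z + - (b / d)))))"
      by (intro ext) simp
    then show ?thesis using fibre_span_diff[OF pw_poly_pos(3) fibre_span_mult_above[OF pw_poly_pos(3) in', of False]]
      by (simp only:)
  qed
next
  case (pw_poly_add g h)
  then show ?case using fibre_span_add[OF pw_poly_add(3,4)[OF pw_poly_add(5)]] by (simp add: distrib_left)
next
  case (pw_poly_mult g h)
  then show ?case using pw_poly_mult(4)[OF pw_poly_mult(3)[OF pw_poly_mult(5)]] by (simp add: mult.assoc)
qed

text \<open>Truncates the lower limit of a fibre at the cut; a bound beyond the cut then gives an
  interval of length 0.\<close>

lemma pw_poly_min:
  assumes "v \<in> points" "b \<in> E" "c \<in> E" shows "(\<lambda>x. min (v \<bullet> x + b) c) \<in> pw_poly"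
proof -
  have "(\<lambda>x. (v \<bullet> x + b) - (v \<bullet> x + (b - c)) * of_bool (v \<bullet> x + (b - c) > 0)) \<in> pw_poly"
    using assms by (intro pw_poly_diff pw_poly_mult pw_poly_affine pw_poly_pos diff)
  moreover have "(v \<bullet> x + b) - (v \<bullet> x + (b - c)) * of_bool (v \<bullet> x + (b - c) > 0) = min (v \<bullet> x + b) c" for x
    by (auto simp: min_def)
  ultimately show ?thesis by simp
qed

text \<open>The cut at \<open>N\<close> and the lower bound make every generator integrable by
  itself, so integrals may be added generator by generator; \<open>has_bochner_integral\<close>
  carries the integrability along.\<close>

lemma fibre_span_integral:
  assumes "f \<in> fibre_span" "N \<in> E"
  shows "\<exists>g\<in>pw_poly. \<forall>x. has_bochner_integral lborel (\<lambda>t. indicator {..N} t * f (x, t)) (g x)"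
  using assms(1)
proof (induction f rule: fibre_span.induct)
  case fibre_span_zero
  then show ?case by (intro bexI[of _ "\<lambda>_. 0"]) (auto intro: pw_poly_const)
next
  case (fibre_span_add f g)
  then obtain f' g' where fg: "f' \<in> pw_poly" "g' \<in> pw_poly"
    "\<And>x. has_bochner_integral lborel (\<lambda>t. indicator {..N} t * f (x, t)) (f' x)"
    "\<And>x. has_bochner_integral lborel (\<lambda>t. indicator {..N} t * g (x, t)) (g' x)" by blast
  then show ?case
    using has_bochner_integral_add[OF fg(3,4)]
    by (intro bexI[of _ "\<lambda>x. f' x + g' x"]) (auto simp: distrib_left intro: pw_poly_add)
next
  case (fibre_span_gen g w c k s)
  show ?case
  proof (intro bexI[of _ "\<lambda>x. g x * ((N ^ Suc k - min (w \<bullet> x + c) N ^ Suc k) * (1 / Suc k))"] allI)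
    show "(\<lambda>x. g x * ((N ^ Suc k - min (w \<bullet> x + c) N ^ Suc k) * (1 / Suc k))) \<in> pw_poly"
      using fibre_span_gen assms(2)
      by (intro pw_poly_mult pw_poly_diff pw_poly_const pw_poly_power pw_poly_min divide_in power_in one_in of_nat_in)
  next
    fix x :: 'a
    let ?m = "min (w \<bullet> x + c) N"
    have "has_bochner_integral lborel (\<lambda>t. g x * (t ^ k * indicator {?m..N} t)) (g x * ((N ^ Suc k - ?m ^ Suc k) / Suc k))"
    proof (intro has_bochner_integral_mult_right)
      have "has_bochner_integral lborel (\<lambda>t. t ^ k * indicator {?m..N} t) (N ^ Suc k / Suc k - ?m ^ Suc k / Suc k)"
        by (rule has_bochner_integral_FTC_Icc_real)
          (auto intro!: derivative_eq_intros simp del: of_nat_Suc power_Suc)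
      then show "has_bochner_integral lborel (\<lambda>t. t ^ k * indicator {?m..N} t) ((N ^ Suc k - ?m ^ Suc k) / Suc k)"
        by (simp only: diff_divide_distrib)
    qed
    \<comment> \<open>The exceptional point is either the bound itself, where strictness matters, or
      \<open>N\<close>, when the bound exceeds \<open>N\<close> and the interval has shrunk to one
      point.\<close>
    moreover have "AE t in lborel. g x * (t ^ k * indicator {?m..N} t) = indicator {..N} t *
        (g x * t ^ k * of_bool (above s (t - (w \<bullet> x + c))))"
      by (rule AE_mp[OF AE_lborel_singleton[of ?m]])
        (intro AE_I2, auto simp: indicator_def above_def min_def split: if_splits)
    ultimately have "has_bochner_integral lborel (\<lambda>t. indicator {..N} t *
        (g x * t ^ k * of_bool (above s (t - (w \<bullet> x + c))))) (g x * ((N ^ Suc k - ?m ^ Suc k) / Suc k))"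
      by (subst has_bochner_integral_cong_AE[symmetric]) (auto simp: above_def)
    then show "has_bochner_integral lborel (\<lambda>t. indicator {..N} t *
        (g (fst (x, t)) * snd (x, t) ^ k * of_bool (above s (snd (x, t) - (w \<bullet> fst (x, t) + c)))))
        (g x * ((N ^ Suc k - ?m ^ Suc k) * (1 / Suc k)))"
      by simp
  qed
qed

lemma pw_poly_integral_real:
  assumes "h \<in> pw_poly" "\<And>x t. h (x, t) \<noteq> 0 \<Longrightarrow> \<bar>t\<bar> \<le> real N"
  shows "(\<lambda>x. \<integral>t. h (x, t) \<partial>lborel) \<in> pw_poly"
proof -
  \<comment> \<open>The indicator of \<open>t \<ge> - real N\<close> is 1 on the support of
    \<open>h\<close>; it provides the lower bound that each generator must have.\<close>
  have "(\<lambda>z. 1 * snd z ^ 0 * of_bool (above False (snd z - (0 \<bullet> fst z + - real N)))) \<in> fibre_span"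
    by (rule fibre_span_gen[OF pw_poly_const]) (auto intro: uminus_in)
  then have "(\<lambda>z. 1 * snd z ^ 0 * of_bool (above False (snd z - (0 \<bullet> fst z + - real N))) * h z) \<in> fibre_span"
    by (rule fibre_span_mult_pw_poly[OF assms(1)])
  moreover have "(\<lambda>z. 1 * snd z ^ 0 * of_bool (above False (snd z - (0 \<bullet> fst z + - real N))) * h z) = h"
  proof
    show "1 * snd z ^ 0 * of_bool (above False (snd z - (0 \<bullet> fst z + - real N))) * h z = h z" for z
      using assms(2)[of "fst z" "snd z"] by (cases "h z = 0") (auto simp: above_def)
  qed
  ultimately have "h \<in> fibre_span" by (simp only:)
  from fibre_span_integral[OF this of_nat_in[of N]] obtain g where g: "g \<in> pw_poly"
    "\<And>x. has_bochner_integral lborel (\<lambda>t. indicator {..real N} t * h (x, t)) (g x)" by blast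
  have "(\<lambda>t. indicator {..real N} t * h (x, t)) = (\<lambda>t. h (x, t))" for x
  proof
    show "indicator {..real N} t * h (x, t) = h (x, t)" for t
      using assms(2)[of x t] by (cases "h (x, t) = 0") (auto simp: indicator_def)
  qed
  then have "(\<integral>t. h (x, t) \<partial>lborel) = g x" for x
    using g(2)[of x] by (simp only: has_bochner_integral_integral_eq)
  then show ?thesis using g(1) by simp
qed

lemma pw_poly_integrable_section:
  assumes "h \<in> pw_poly" "\<And>x. h (z, x) \<noteq> 0 \<Longrightarrow> norm x \<le> r" shows "integrable lborel (\<lambda>x. h (z, x))"
proof -
  have [measurable]: "h \<in> borel_measurable (borel \<Otimes>\<^sub>M borel)"
    using assms(1) by (simp add: borel_prod pw_poly_measurable)
  obtain B where B: "\<And>w. norm w \<le> norm z + r \<Longrightarrow> \<bar>h w\<bar> \<le> B" using pw_poly_bounded[OF assms(1)] by blast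
  have "\<bar>h (z, x)\<bar> \<le> max B 0" for x
    using assms(2)[of x] B[of "(z, x)"] norm_Pair_le[of z x] by (cases "h (z, x) = 0") auto
  then show ?thesis using assms(2) by (intro integrable_bounded_support[where r=r]) auto
qed

lemma pw_poly_integral_real3:
  assumes h: "h \<in> pw_poly" and N: "\<And>z x. h (z, x) \<noteq> 0 \<Longrightarrow> norm x \<le> real N"
  shows "(\<lambda>z. \<integral>x. h (z, x :: real \<times> real \<times> real) \<partial>lborel) \<in> pw_poly"
proof -
  \<comment> \<open>Reassociated so that the variable to be integrated is always the second
    component of a pair.\<close>
  define h3 where "h3 w = h (fst (fst (fst w)), snd (fst (fst w)), snd (fst w), snd w)" for w
  define h2 where "h2 w = (\<integral>t. h3 (w, t) \<partial>lborel)" for w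
  define h1 where "h1 w = (\<integral>t. h2 (w, t) \<partial>lborel)" for w
  have "h3 \<in> pw_poly" unfolding h3_def by (intro pw_poly_compose[OF _ h] affine_over_intros)
  have N3: "\<bar>x\<bar> \<le> real N \<and> \<bar>y\<bar> \<le> real N \<and> \<bar>t\<bar> \<le> real N" if "h3 (((z, x), y), t) \<noteq> 0" for z x y t
    using N[OF that[unfolded h3_def]] norm_fst_le[of x "(y, t)"] norm_snd_le[of "(y, t)" x]
      norm_fst_le[of y t] norm_snd_le[of t y] by auto
  have "h2 \<in> pw_poly" unfolding h2_def
    by (rule pw_poly_integral_real[OF \<open>h3 \<in> pw_poly\<close>, where N=N]) (metis N3 surj_pair)
  have N2: "\<bar>x\<bar> \<le> real N \<and> \<bar>y\<bar> \<le> real N" if nz: "h2 ((z, x), y) \<noteq> 0" for z x y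
  proof -
    obtain t where "h3 (((z, x), y), t) \<noteq> 0" using nz unfolding h2_def by fastforce
    then show ?thesis using N3 by blast
  qed
  have "h1 \<in> pw_poly" unfolding h1_def
    by (rule pw_poly_integral_real[OF \<open>h2 \<in> pw_poly\<close>, where N=N]) (metis N2 surj_pair)
  have N1: "\<bar>x\<bar> \<le> real N" if nz: "h1 (z, x) \<noteq> 0" for z x
  proof -
    obtain t where "h2 ((z, x), t) \<noteq> 0" using nz unfolding h1_def by fastforce
    then show ?thesis using N2 by blast
  qed
  have "(\<integral>x. h (z, x) \<partial>lborel) = (\<integral>x. h1 (z, x) \<partial>lborel)" for z
  proof -
    have "(\<integral>x. h (z, x) \<partial>lborel) = (\<integral>x. \<integral>y. h (z, x, y) \<partial>lborel \<partial>lborel)"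
      by (intro integral_lborel_Pair pw_poly_integrable_section[OF h N])
    moreover have "(\<integral>y. h (z, x, y) \<partial>lborel) = h1 (z, x)" for x
    proof -
      have "(\<lambda>w. h (fst (fst w), snd (fst w), snd w)) \<in> pw_poly" by (intro pw_poly_compose[OF _ h] affine_over_intros)
      from pw_poly_integrable_section[OF this, where z="(z, x)" and r="real N"]
      have "integrable lborel (\<lambda>y. h (z, x, y))"
        using N[of z "(x, _)"] norm_snd_le order_trans by fastforce
      from integral_lborel_Pair[OF this] show ?thesis by (simp add: h1_def h2_def h3_def)
    qed
    ultimately show ?thesis by simp
  qed
  then show ?thesis using N1 \<open>h1 \<in> pw_poly\<close> by (simp add: pw_poly_integral_real[where N=N])
qed

end

subsection \<open>The facet planes of a polyhedron\<close>

text \<open>In topological terms: \<open>x\<close> is not a frontier point of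
  \<open>K\<close>.\<close>

definition locally_constant_at :: "'a::metric_space set \<Rightarrow> 'a \<Rightarrow> bool" where
  "locally_constant_at K x \<longleftrightarrow> (\<exists>e>0. \<forall>y\<in>ball x e. y \<in> K \<longleftrightarrow> x \<in> K)"

definition off_planes :: "('a::euclidean_space \<times> real) set \<Rightarrow> 'a \<Rightarrow> bool" where
  "off_planes H x \<longleftrightarrow> (\<forall>(a, b)\<in>H. a \<bullet> x \<noteq> b)"

text \<open>The points of the facets of \<open>K\<close> in a given plane, with \<open>a\<close> pointing into \<open>K\<close>.\<close>

definition two_sided :: "'a::euclidean_space set \<Rightarrow> 'a \<Rightarrow> real \<Rightarrow> 'a \<Rightarrow> bool" where
  "two_sided K a b x \<longleftrightarrow>
     a \<bullet> x = b \<and> (\<exists>e>0. \<forall>y\<in>ball x e. (a \<bullet> y > b \<longrightarrow> y \<in> K) \<and> (a \<bullet> y < b \<longrightarrow> y \<notin> K))"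

section \<open>Facets, their extreme points, and the planes that matter\<close>

lemma locally_constant_at_connected:
  assumes "connected C" "\<And>x. x \<in> C \<Longrightarrow> locally_constant_at K x" "x \<in> C" "y \<in> C"
  shows "x \<in> K \<longleftrightarrow> y \<in> K"
proof (rule connected_local_const[OF assms(1,3,4), of "\<lambda>x. x \<in> K"], rule ballI)
  fix z assume "z \<in> C"
  then obtain e where e: "e > 0" "\<forall>y\<in>ball z e. y \<in> K \<longleftrightarrow> z \<in> K" using assms(2) unfolding locally_constant_at_def by blast
  then show "\<forall>\<^sub>F y in at z within C. (z \<in> K) = (y \<in> K)"
    unfolding eventually_at using e(1) by (metis e(2) dist_commute mem_ball)
qed

lemma open_off_planes: assumes "finite H" shows "open {x. off_planes H x}"
proof -
  have "closed (\<Union>(a, b)\<in>H. {x. a \<bullet> x = b})"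
    using assms by (intro closed_UN) (auto simp: closed_hyperplane)
  moreover have "{x. off_planes H x} = - (\<Union>(a, b)\<in>H. {x. a \<bullet> x = b})"
    by (auto simp: off_planes_def)
  ultimately show ?thesis by (simp only: open_Compl)
qed

lemma two_sided_nearby:
  assumes "two_sided K a b x"
  obtains e where "e > 0" "\<And>y. y \<in> ball x e \<Longrightarrow> a \<bullet> y = b \<Longrightarrow> two_sided K a b y"
proof -
  obtain e where e: "e > 0" "\<forall>y\<in>ball x e. (a \<bullet> y > b \<longrightarrow> y \<in> K) \<and> (a \<bullet> y < b \<longrightarrow> y \<notin> K)"
    using assms unfolding two_sided_def by blast
  have "two_sided K a b y" if "y \<in> ball x e" "a \<bullet> y = b" for y
    unfolding two_sided_def
  proof (intro conjI exI[of _ "e - dist x y"] ballI)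
    show "e - dist x y > 0" using that by simp
    fix z assume "z \<in> ball y (e - dist x y)"
    then have "z \<in> ball x e" using dist_triangle[of x z y] by simp
    then show "b < a \<bullet> z \<longrightarrow> z \<in> K" "a \<bullet> z < b \<longrightarrow> z \<notin> K" using e(2) by auto
  qed (rule that)
  then show ?thesis using that e(1) by blast
qed

lemma two_sided_subset_closure:
  assumes "a \<noteq> 0" "two_sided K a b x" shows "x \<in> closure K"
  unfolding closure_approachable
proof (intro allI impI)
  fix d :: real assume "d > 0"
  obtain e where e: "e > 0" "\<forall>y\<in>ball x e. (a \<bullet> y > b \<longrightarrow> y \<in> K) \<and> (a \<bullet> y < b \<longrightarrow> y \<notin> K)"
    and b: "a \<bullet> x = b" using assms unfolding two_sided_def by blast
  define s where "s = min d e / (2 * norm a)"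
  have s: "s > 0" "s * norm a < d" "s * norm a < e" using \<open>d > 0\<close> e(1) assms(1) by (auto simp: s_def)
  have "a \<bullet> (x + s *\<^sub>R a) > b" using s assms(1) b by (simp add: inner_add_right)
  moreover have "x + s *\<^sub>R a \<in> ball x e" using s by (simp add: dist_norm)
  ultimately have "x + s *\<^sub>R a \<in> K" using e(2) by blast
  then show "\<exists>y\<in>K. dist y x < d" using s by (intro bexI[of _ "x + s *\<^sub>R a"]) (auto simp: dist_norm)
qed

text \<open>Near \<open>v\<close>, sliding along \<open>u\<close> changes neither membership in
  \<open>K\<close> nor, as \<open>a \<bullet> u = 0\<close>, the side of the plane. The radius
  \<open>q\<close> keeps a point and its slid copy inside \<open>ball v e\<close>.\<close>

lemma two_sided_translate:
  assumes cyl: "e > 0" "\<forall>x\<in>ball v e. \<forall>t. x + t *\<^sub>R u \<in> ball v e \<longrightarrow> (x \<in> K \<longleftrightarrow> x + t *\<^sub>R u \<in> K)"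
    and "a \<bullet> u = 0" "two_sided K a b w" "dist v w < e / 2" "\<bar>t\<bar> * norm u < e / 2"
  shows "two_sided K a b (w + t *\<^sub>R u)"
proof -
  obtain r where r: "r > 0" "\<forall>y\<in>ball w r. (a \<bullet> y > b \<longrightarrow> y \<in> K) \<and> (a \<bullet> y < b \<longrightarrow> y \<notin> K)"
    and b: "a \<bullet> w = b" using assms(4) unfolding two_sided_def by blast
  define q where "q = min r (e - dist v w - \<bar>t\<bar> * norm u)"
  show ?thesis unfolding two_sided_def
  proof (intro conjI exI[of _ q] ballI)
    show "a \<bullet> (w + t *\<^sub>R u) = b" using b assms(3) by (simp add: inner_add_right)
    show "q > 0" using r assms(5,6) by (simp add: q_def)
    fix y assume y: "y \<in> ball (w + t *\<^sub>R u) q"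
    define x where "x = y - t *\<^sub>R u"
    have yx: "y = x + t *\<^sub>R u" by (simp add: x_def)
    have d: "dist w x < q" using y by (simp add: yx dist_norm)
    then have "dist w x < r" "dist w x < e - dist v w - \<bar>t\<bar> * norm u" by (auto simp: q_def)
    then have "x \<in> ball w r" "x \<in> ball v e"
      using dist_triangle[of v x w] mult_nonneg_nonneg[OF abs_ge_zero[of t] norm_ge_zero[of u]]
      unfolding mem_ball by linarith+
    moreover have "y \<in> ball v e"
    proof -
      have "dist v y \<le> dist v w + dist w x + dist x y" by (metis add.commute add_left_mono dist_triangle dist_triangle_le order_trans)
      then show ?thesis using d by (simp add: q_def yx dist_norm)
    qed
    moreover have "a \<bullet> y = a \<bullet> x" using assms(3) by (simp add: yx inner_add_right)
    ultimately show "b < a \<bullet> y \<longrightarrow> y \<in> K" "a \<bullet> y < b \<longrightarrow> y \<notin> K"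
      using r(2) cyl(2) yx by auto
  qed
qed

text \<open>Suppose \<open>K\<close> is cylindrical along \<open>u \<noteq> 0\<close> near
  \<open>v\<close>. If \<open>u\<close> is parallel to the plane, slides along \<open>u\<close>
  preserve the facet, and \<open>v\<close> is the midpoint of a segment in its closure. Otherwise a
  short segment along \<open>u\<close> through a facet point near \<open>v\<close> has one end in
  \<open>K\<close> and one outside, which cylindricity forbids.\<close>

lemma extreme_two_sided_vertex:
  assumes v: "v extreme_point_of (convex hull (closure {x. two_sided K a b x}))"
  shows "v \<in> vertices_of K"
  unfolding vertices_of_def
proof (intro CollectI allI impI, rule ccontr)
  fix u assume "locally_cylindrical K u v" and u: "u \<noteq> 0"
  then obtain e where e: "e > 0" "\<forall>x\<in>ball v e. \<forall>t. x + t *\<^sub>R u \<in> ball v e \<longrightarrow> (x \<in> K \<longleftrightarrow> x + t *\<^sub>R u \<in> K)"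
    unfolding locally_cylindrical_def by blast
  let ?W = "{x. two_sided K a b x}"
  have vW: "v \<in> closure ?W" using extreme_point_of_convex_hull[OF v] .
  show False
  proof (cases "a \<bullet> u = 0")
    case True
    \<comment> \<open>\<open>v\<close> itself is only a limit of facet points, so nearby facet
      points are slid instead.\<close>
    have cl: "v + t *\<^sub>R u \<in> closure ?W" if t: "\<bar>t\<bar> * norm u < e / 2" for t
      unfolding closure_approachable
    proof (intro allI impI)
      fix d :: real assume "d > 0"
      then obtain w where "two_sided K a b w" "dist w v < min d (e / 2)"
        using vW e(1) unfolding closure_approachable by (metis half_gt_zero mem_Collect_eq min_less_iff_conj)
      then show "\<exists>y\<in>?W. dist y (v + t *\<^sub>R u) < d"
        using two_sided_translate[OF e True _ _ t, of b w]
        by (intro bexI[of _ "w + t *\<^sub>R u"]) (auto simp: dist_commute)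
    qed
    define t where "t = e / (4 * norm u)"
    have t: "\<bar>t\<bar> * norm u < e / 2" "t \<noteq> 0" using u e(1) by (auto simp: t_def)
    have "v + t *\<^sub>R u \<in> convex hull (closure ?W)" "v + (- t) *\<^sub>R u \<in> convex hull (closure ?W)"
      using cl[of t] cl[of "- t"] t by (auto intro: hull_inc)
    moreover have "v = midpoint (v + t *\<^sub>R u) (v + (- t) *\<^sub>R u)"
      by (simp add: midpoint_def flip: scaleR_2)
    moreover have "v + t *\<^sub>R u \<noteq> v + (- t) *\<^sub>R u"
      using t(2) u by (simp add: eq_neg_iff_add_eq_0 scaleR_add_left[symmetric])
    ultimately show False using v unfolding extreme_point_of_def by (metis midpoint_in_open_segment)
  next
    case False
    have "0 < e / 2" using e(1) by simp
    then obtain w where w: "two_sided K a b w" "dist w v < e / 2"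
      using vW unfolding closure_approachable by blast
    then obtain r where r: "r > 0" "\<forall>y\<in>ball w r. (a \<bullet> y > b \<longrightarrow> y \<in> K) \<and> (a \<bullet> y < b \<longrightarrow> y \<notin> K)"
      and b: "a \<bullet> w = b" unfolding two_sided_def by blast
    define t where "t = min r (e / 2) / (2 * norm u)"
    have t: "t > 0" "t * norm u < r" "t * norm u < e / 2" using r u e(1) by (auto simp: t_def)
    let ?x = "w + (- t) *\<^sub>R u" and ?y = "w + t *\<^sub>R u"
    have "?x \<in> ball w r" "?y \<in> ball w r" using t by (auto simp: dist_norm)
    moreover have "?x \<in> ball v e" "?y \<in> ball v e"
      using t w dist_triangle[of v ?x w] dist_triangle[of v ?y w] by (auto simp: dist_norm norm_minus_commute)
    moreover have "?y = ?x + (2 * t) *\<^sub>R u" by (simp add: scaleR_add_left[symmetric] flip: scaleR_minus_left)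
    ultimately have "?x \<in> K \<longleftrightarrow> ?y \<in> K" using e(2) by metis
    moreover have "a \<bullet> ?x = b - t * (a \<bullet> u)" "a \<bullet> ?y = b + t * (a \<bullet> u)"
      using b by (simp_all add: inner_add_right inner_diff_right)
    moreover have "t * (a \<bullet> u) > 0 \<or> t * (a \<bullet> u) < 0" using False t(1) by (metis linorder_neqE_linordered_idom mult_pos_pos mult_pos_neg)
    ultimately show False using r(2) \<open>?x \<in> ball w r\<close> \<open>?y \<in> ball w r\<close> by fastforce
  qed
qed

text \<open>By Krein-Milman the hull of the closed facet is spanned by its extreme points, all of
  them vertices of \<open>K\<close>. Were they collinear, the facet would lie on a line; but it
  contains a disc of the plane around \<open>w\<close>.\<close>

lemma two_sided_vertices:
  fixes a :: "real^3"
  assumes "a \<noteq> 0" "bounded K" "two_sided K a b w"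
  obtains v1 v2 v3 where "v1 \<in> vertices_of K" "v2 \<in> vertices_of K" "v3 \<in> vertices_of K"
    "a \<bullet> v1 = b" "a \<bullet> v2 = b" "a \<bullet> v3 = b" "cross3 (v2 - v1) (v3 - v1) \<noteq> 0"
proof -
  let ?W = "{x. two_sided K a b x}"
  define S where "S = convex hull (closure ?W)"
  define P where "P = {v. v extreme_point_of S}"
  have "?W \<subseteq> closure K" using two_sided_subset_closure[OF assms(1)] by blast
  then have "bounded (closure ?W)" using assms(2) by (meson bounded_closure bounded_subset)
  then have "compact S" unfolding S_def by (intro compact_convex_hull) (simp add: compact_eq_bounded_closed)
  then have S: "S = convex hull P" unfolding P_def S_def by (intro Krein_Milman_Minkowski) auto
  have PV: "P \<subseteq> vertices_of K" unfolding P_def S_def using extreme_two_sided_vertex by blast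
  have "closure ?W \<subseteq> {x. a \<bullet> x = b}"
    by (intro closure_minimal closed_hyperplane) (auto simp: two_sided_def)
  then have Pb: "a \<bullet> v = b" if "v \<in> P" for v
    using that extreme_point_of_convex_hull unfolding P_def S_def by blast
  have WS: "?W \<subseteq> S" unfolding S_def by (meson closure_subset hull_subset order_trans)
  then have "P \<noteq> {}" using assms(3) S by auto
  then obtain v1 where v1: "v1 \<in> P" by blast
  obtain e where e: "e > 0" "\<And>y. y \<in> ball w e \<Longrightarrow> a \<bullet> y = b \<Longrightarrow> two_sided K a b y"
    using two_sided_nearby[OF assms(3)] by blast
  have "\<exists>v2\<in>P. \<exists>v3\<in>P. cross3 (v2 - v1) (v3 - v1) \<noteq> 0"
  proof (rule ccontr)
    assume neg: "\<not> ?thesis"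
    \<comment> \<open>\<open>q\<close> is the direction of the line; if \<open>v1\<close> is the
      only extreme point, any direction within the plane serves.\<close>
    have "\<exists>q. q \<noteq> 0 \<and> a \<bullet> q = 0 \<and> (\<forall>x\<in>P. cross3 q (x - v1) = 0)"
    proof (cases "\<exists>v2\<in>P. v2 \<noteq> v1")
      case True
      then obtain v2 where "v2 \<in> P" "v2 \<noteq> v1" by blast
      then show ?thesis using neg Pb v1 by (intro exI[of _ "v2 - v1"]) (auto simp: inner_diff_right)
    next
      case False
      obtain c where "cross3 a c \<noteq> 0" using cross_basis_nonzero[OF assms(1)] by blast
      then show ?thesis using False by (intro exI[of _ "cross3 a c"]) (auto simp: dot_cross_self)
    qed
    then obtain q where q: "q \<noteq> 0" "a \<bullet> q = 0" "\<And>x. x \<in> P \<Longrightarrow> cross3 q (x - v1) = 0" by blast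
    have "convex {x. cross3 q (x - v1) = 0}"
    proof -
      have "cross3 q (\<alpha> *\<^sub>R x + \<beta> *\<^sub>R y - v1) = \<alpha> *\<^sub>R cross3 q (x - v1) + \<beta> *\<^sub>R cross3 q (y - v1)"
        if "\<alpha> + \<beta> = 1" for x y \<alpha> \<beta>
      proof -
        have "\<alpha> *\<^sub>R x + \<beta> *\<^sub>R y - v1 = \<alpha> *\<^sub>R (x - v1) + \<beta> *\<^sub>R (y - v1)"
          using that by (simp add: scaleR_diff_right scaleR_add_left[symmetric] add_diff_eq diff_add_eq diff_diff_eq)
        then show ?thesis by (simp only: cross_add_right cross_mult_right)
      qed
      then show ?thesis by (intro convexI) auto
    qed
    then have SL: "S \<subseteq> {x. cross3 q (x - v1) = 0}" unfolding S using q(3) by (intro hull_minimal) auto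
    \<comment> \<open>A direction in the plane orthogonal to \<open>q\<close>: a short move of
      \<open>w\<close> along it stays in the facet but leaves the line.\<close>
    define d where "d = cross3 a q"
    have "cross3 q d = (q \<bullet> q) *\<^sub>R a" unfolding d_def Lagrange using q(2) by (simp add: inner_commute)
    then have qd: "cross3 q d \<noteq> 0" using q(1) assms(1) by simp
    then have "d \<noteq> 0" by auto
    define s where "s = e / (2 * norm d)"
    have s: "s > 0" "s * norm d < e" using e(1) \<open>d \<noteq> 0\<close> by (auto simp: s_def)
    have "w + s *\<^sub>R d \<in> ball w e" using s by (simp add: dist_norm)
    moreover have "a \<bullet> (w + s *\<^sub>R d) = b"
      using assms(3) by (simp add: inner_add_right d_def dot_cross_self two_sided_def)
    ultimately have "w + s *\<^sub>R d \<in> S" using e(2) WS by blast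
    moreover have "w \<in> S" using assms(3) WS by blast
    ultimately have "cross3 q (w - v1) = 0" "cross3 q ((w - v1) + s *\<^sub>R d) = 0" using SL by (auto simp: algebra_simps)
    then have "s *\<^sub>R cross3 q d = 0" by (simp add: cross_add_right cross_mult_right)
    then show False using s qd by simp
  qed
  then show ?thesis using that v1 PV Pb by blast
qed

text \<open>Both \<open>a\<close> and the cross product are orthogonal to the edges, hence parallel.
  The new normal is computed from vertex coordinates, while \<open>a\<close>, taken from some
  simplex, may have arbitrary real entries.\<close>

lemma plane_through_three_points:
  fixes a :: "real^3"
  assumes "a \<noteq> 0" "a \<bullet> v1 = b" "a \<bullet> v2 = b" "a \<bullet> v3 = b" and n: "cross3 (v2 - v1) (v3 - v1) \<noteq> 0"
  shows "a \<bullet> x = b \<longleftrightarrow> cross3 (v2 - v1) (v3 - v1) \<bullet> x = cross3 (v2 - v1) (v3 - v1) \<bullet> v1"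
proof -
  let ?n = "cross3 (v2 - v1) (v3 - v1)"
  have "cross3 a ?n = 0" unfolding Lagrange using assms(2-4) by (simp add: inner_diff_right)
  then have "cross3 ?n (cross3 a ?n) = 0" by simp
  then have eq: "(?n \<bullet> ?n) *\<^sub>R a = (?n \<bullet> a) *\<^sub>R ?n" by (simp add: Lagrange[of ?n a ?n])
  then have "?n \<bullet> a \<noteq> 0" using n assms(1) by (metis inner_eq_zero_iff scaleR_eq_0_iff scaleR_zero_left)
  have "(?n \<bullet> ?n) * (a \<bullet> (x - v1)) = (?n \<bullet> a) * (?n \<bullet> (x - v1))"
    using arg_cong[OF eq, of "\<lambda>z. z \<bullet> (x - v1)"] by simp
  then have "a \<bullet> (x - v1) = 0 \<longleftrightarrow> ?n \<bullet> (x - v1) = 0" using n \<open>?n \<bullet> a \<noteq> 0\<close>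
    by (metis inner_eq_zero_iff mult_eq_0_iff)
  then show ?thesis using assms(2) by (simp add: inner_diff_right)
qed

text \<open>Membership in \<open>K\<close> is constant on each open half of a small ball that avoids
  the other planes. Different values would make \<open>x\<close> a facet point for one of the two
  orientations; equal values extend across the plane.\<close>

lemma remove_plane:
  fixes K :: "'a::euclidean_space set"
  assumes "a \<noteq> 0" "closed K" "K \<subseteq> closure (interior K)" "finite H"
    and lc: "\<And>x. off_planes (insert (a, b) H) x \<Longrightarrow> locally_constant_at K x"
    and "\<And>x. \<not> two_sided K a b x" "\<And>x. \<not> two_sided K (- a) (- b) x"
    and x: "off_planes H x"
  shows "locally_constant_at K x"
proof (cases "a \<bullet> x = b")
  case False
  then show ?thesis using x by (intro lc) (auto simp: off_planes_def)
next
  case True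
  obtain e where e: "e > 0" "ball x e \<subseteq> {y. off_planes H y}"
    using open_off_planes[OF assms(4)] x open_contains_ball by (metis mem_Collect_eq)
  define U where "U = ball x e \<inter> {y. a \<bullet> y > b}"
  define L where "L = ball x e \<inter> {y. a \<bullet> y < b}"
  have conn: "connected U" "connected L"
    unfolding U_def L_def by (auto intro!: convex_connected convex_Int convex_halfspace_gt convex_halfspace_lt)
  have lcU: "locally_constant_at K y" if "y \<in> U \<or> y \<in> L" for y
    using that e(2) by (intro lc) (auto simp: U_def L_def off_planes_def)
  define s where "s = e / (2 * norm a)"
  have s: "s > 0" "s * norm a < e" using e(1) assms(1) by (auto simp: s_def)
  have p: "x + s *\<^sub>R a \<in> U" "x + (- s) *\<^sub>R a \<in> L"
    using s True assms(1) by (auto simp: U_def L_def dist_norm inner_add_right inner_diff_right)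
  have cU: "y \<in> K \<longleftrightarrow> x + s *\<^sub>R a \<in> K" if "y \<in> U" for y
    using locally_constant_at_connected[OF conn(1) _ that p(1)] lcU by blast
  have cL: "y \<in> K \<longleftrightarrow> x + (- s) *\<^sub>R a \<in> K" if "y \<in> L" for y
    using locally_constant_at_connected[OF conn(2) _ that p(2)] lcU by blast
  have same: "x + s *\<^sub>R a \<in> K \<longleftrightarrow> x + (- s) *\<^sub>R a \<in> K"
  proof (rule ccontr)
    assume ne: "\<not> ?thesis"
    have "two_sided K a b x \<or> two_sided K (- a) (- b) x"
      using ne cU cL True e(1) unfolding two_sided_def U_def L_def by (auto intro!: exI[of _ e])
    then show False using assms(6,7) by blast
  qed
  have side: "y \<in> K \<longleftrightarrow> x + s *\<^sub>R a \<in> K" if "y \<in> ball x e" "a \<bullet> y \<noteq> b" for y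
    using that cU[of y] cL[of y] same by (cases "a \<bullet> y" b rule: linorder_cases) (auto simp: U_def L_def)
  have flat: "interior {y. a \<bullet> y = b} = {}"
    using assms(1) by (simp add: interior_hyperplane)
  \<comment> \<open>Points in the plane itself are decided by regularity: a point of
    \<open>K\<close> has interior points of \<open>K\<close> nearby, some of them off the plane, and
    a point outside the closed set \<open>K\<close> has a neighbourhood outside, again reaching off
    the plane.\<close>
  have const: "y \<in> K \<longleftrightarrow> x + s *\<^sub>R a \<in> K" if y: "y \<in> ball x e" for y
  proof
    assume "y \<in> K"
    then have "y \<in> closure (interior K)" using assms(3) by blast
    then have "ball x e \<inter> interior K \<noteq> {}" using y by (metis Int_commute disjoint_iff open_Int_closure_eq_empty open_ball)
    moreover have "open (ball x e \<inter> interior K)" by auto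
    ultimately have "\<not> ball x e \<inter> interior K \<subseteq> {y. a \<bullet> y = b}" using flat interior_maximal by blast
    then obtain z where "z \<in> ball x e" "z \<in> K" "a \<bullet> z \<noteq> b" using interior_subset by blast
    then show "x + s *\<^sub>R a \<in> K" using side by blast
  next
    assume K: "x + s *\<^sub>R a \<in> K"
    show "y \<in> K"
    proof (rule ccontr)
      assume "y \<notin> K"
      then have "open (ball x e - K)" "y \<in> ball x e - K" using assms(2) y by (auto intro: open_Diff)
      then have "\<not> ball x e - K \<subseteq> {y. a \<bullet> y = b}" using flat interior_maximal by blast
      then show False using side K by blast
    qed
  qed
  show ?thesis unfolding locally_constant_at_def using const e(1) centre_in_ball by metis
qed

text \<open>These are the face planes of all simplices. They depend on the chosen decomposition,
  whose corners need not be vertices of \<open>K\<close>, so nothing is known yet about their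
  coefficients.\<close>

lemma solid_polyhedron_planes:
  assumes "solid_polyhedron K"
  obtains H where "finite H" "\<And>a b. (a, b) \<in> H \<Longrightarrow> a \<noteq> 0"
    "\<And>x. off_planes H x \<Longrightarrow> locally_constant_at K x"
proof -
  obtain \<S> where S: "finite \<S>" "\<And>T. T \<in> \<S> \<Longrightarrow> 3 simplex T" "K = \<Union>\<S>"
    using assms unfolding solid_polyhedron_def by blast
  have "\<exists>H. finite H \<and> (\<forall>(a, b)\<in>H. a \<noteq> 0) \<and> T = {x. \<forall>(a, b)\<in>H. a \<bullet> x \<le> b}" if "T \<in> \<S>" for T
  proof -
    have "polyhedron T" using S(2)[OF that] by (rule simplex_imp_polyhedron)
    then obtain F where F: "finite F" "T = \<Inter>F" "\<forall>h\<in>F. \<exists>a b. a \<noteq> 0 \<and> h = {x. a \<bullet> x \<le> b}"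
      unfolding polyhedron_def by blast
    then have "\<forall>h\<in>F. \<exists>c. fst c \<noteq> 0 \<and> h = {x. fst c \<bullet> x \<le> snd c}" by fastforce
    then obtain c where c: "\<forall>h\<in>F. fst (c h) \<noteq> 0 \<and> h = {x. fst (c h) \<bullet> x \<le> snd (c h)}"
      by (rule bchoice[THEN exE])
    have "x \<in> T \<longleftrightarrow> (\<forall>h\<in>F. fst (c h) \<bullet> x \<le> snd (c h))" for x
      unfolding F(2) using c by blast
    then show ?thesis using F(1) c by (intro exI[of _ "c ` F"]) (auto simp: case_prod_beta)
  qed
  then have "\<forall>T\<in>\<S>. \<exists>H. finite H \<and> (\<forall>(a, b)\<in>H. a \<noteq> 0) \<and> T = {x. \<forall>(a, b)\<in>H. a \<bullet> x \<le> b}" by blast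
  then obtain G where G: "\<forall>T\<in>\<S>. finite (G T) \<and> (\<forall>(a, b)\<in>G T. a \<noteq> 0) \<and> T = {x. \<forall>(a, b)\<in>G T. a \<bullet> x \<le> b}"
    by (rule bchoice[THEN exE])
  show ?thesis
  proof
    show "finite (\<Union>T\<in>\<S>. G T)" using S(1) G by blast
    show "a \<noteq> 0" if "(a, b) \<in> (\<Union>T\<in>\<S>. G T)" for a b using that G by blast
    fix x assume x: "off_planes (\<Union>T\<in>\<S>. G T) x"
    define S where "S p = {y. if fst p \<bullet> x < snd p then fst p \<bullet> y < snd p else fst p \<bullet> y > snd p}" for p
    define C where "C = (\<Inter>p\<in>(\<Union>T\<in>\<S>. G T). S p)"
    have "open (S p)" for p
      by (cases "fst p \<bullet> x < snd p") (auto simp: S_def open_halfspace_lt open_halfspace_gt)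
    then have "open C" unfolding C_def using \<open>finite (\<Union>T\<in>\<S>. G T)\<close> by (intro open_INT) auto
    have off: "fst p \<bullet> x \<noteq> snd p" if "p \<in> (\<Union>T\<in>\<S>. G T)" for p
      using x that unfolding off_planes_def by (cases p) auto
    have "x \<in> S p" if "p \<in> (\<Union>T\<in>\<S>. G T)" for p
      using off[OF that] by (auto simp: S_def)
    then have "x \<in> C" unfolding C_def by blast
    with \<open>open C\<close> obtain e where e: "e > 0" "ball x e \<subseteq> C" by (rule openE)
    have "y \<in> T \<longleftrightarrow> x \<in> T" if y: "y \<in> C" and T: "T \<in> \<S>" for y T
    proof -
      have "a \<bullet> y \<le> b \<longleftrightarrow> a \<bullet> x \<le> b" if ab: "(a, b) \<in> G T" for a b
      proof -
        have "y \<in> S (a, b)" using y T ab unfolding C_def by blast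
        moreover have "a \<bullet> x \<noteq> b" using off[of "(a, b)"] T ab by auto
        ultimately show ?thesis by (auto simp: S_def split: if_splits)
      qed
      then have "(\<forall>(a, b)\<in>G T. a \<bullet> y \<le> b) \<longleftrightarrow> (\<forall>(a, b)\<in>G T. a \<bullet> x \<le> b)" by blast
      moreover have "z \<in> T \<longleftrightarrow> (\<forall>(a, b)\<in>G T. a \<bullet> z \<le> b)" for z using G T by blast
      ultimately show ?thesis by (simp only:)
    qed
    then have "y \<in> K \<longleftrightarrow> x \<in> K" if "y \<in> ball x e" for y
      using that e(2) unfolding S(3) by (metis UnionE UnionI subsetD)
    then show "locally_constant_at K x" unfolding locally_constant_at_def using e(1) by blast
  qed
qed

lemma solid_polyhedron_regular:
  assumes "solid_polyhedron K"
  shows "compact K" "K \<subseteq> closure (interior K)" "interior K \<noteq> {}"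
proof -
  obtain \<S> where S: "finite \<S>" "\<S> \<noteq> {}" "\<And>T. T \<in> \<S> \<Longrightarrow> 3 simplex T" "K = \<Union>\<S>"
    using assms unfolding solid_polyhedron_def by blast
  show "compact K" unfolding S(4) using S(1,3) by (intro compact_Union) (auto intro: compact_simplex)
  have ne: "interior T \<noteq> {}" if "T \<in> \<S>" for T
  proof -
    have "aff_dim T = 3" using S(3)[OF that] by (rule aff_dim_simplex)
    then have "affine hull T = UNIV" "T \<noteq> {}" using aff_dim_eq_full[of T] by auto
    then show ?thesis using rel_interior_interior rel_interior_eq_empty convex_simplex[OF S(3)[OF that]] by metis
  qed
  have "T \<subseteq> closure (interior K)" if "T \<in> \<S>" for T
  proof -
    have "T \<subseteq> closure (interior T)"
      using convex_closure_interior[OF convex_simplex[OF S(3)[OF that]] ne[OF that]] closure_subset by blast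
    also have "\<dots> \<subseteq> closure (interior K)" using that S(4) by (intro closure_mono interior_mono) auto
    finally show ?thesis .
  qed
  then show "K \<subseteq> closure (interior K)" using S(4) by blast
  show "interior K \<noteq> {}" using ne S(2,4) interior_mono by (metis Sup_upper all_not_in_conv subset_empty)
qed

lemma AE_off_planes:
  assumes "finite H" "\<And>a b. (a, b) \<in> H \<Longrightarrow> a \<noteq> (0::'a::euclidean_space)"
  shows "AE x in lborel. off_planes H x"
proof -
  have "AE x in lborel. a \<bullet> x \<noteq> b" if "a \<noteq> 0" for a :: 'a and b
  proof -
    have "{x. a \<bullet> x = b} \<in> null_sets lebesgue"
      using negligible_hyperplane[of a b] that by (simp add: negligible_iff_null_sets)
    then have "{x. a \<bullet> x = b} \<in> null_sets lborel"
      by (subst (asm) null_sets_completion_iff) (auto intro: borel_closed closed_hyperplane)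
    then show ?thesis by (rule AE_I') auto
  qed
  then show ?thesis using assms unfolding off_planes_def by (auto simp: AE_ball_countable countable_finite split: prod.split)
qed

section \<open>Planes over the subfield and the indicator of the polyhedron\<close>

context real_subfield
begin

lemma points_vec: "v \<in> points \<longleftrightarrow> (\<forall>i. v $ i \<in> E)" for v :: "real^'n"
  by (auto simp: points_def Basis_vec_def inner_axis)

lemma points_cross3: "v \<in> points \<Longrightarrow> w \<in> points \<Longrightarrow> cross3 v w \<in> points"
  by (auto simp: points_vec forall_3 cross_components intro: in_intros)

text \<open>Rational over \<open>E\<close>, not over the rational numbers.\<close>

definition rational_planes :: "('a::euclidean_space \<times> real) set \<Rightarrow> bool" where
  "rational_planes H \<longleftrightarrow> finite H \<and> (\<forall>(a, b)\<in>H. a \<noteq> 0 \<and> a \<in> points \<and> b \<in> E)"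

text \<open>An exchange argument: \<open>H\<close> holds the planes still to be treated,
  \<open>G\<close> those already over \<open>E\<close>. A plane that carries a facet, for either
  orientation, is exchanged for its equation through three vertices; any other is dropped.\<close>

lemma replace_planes:
  fixes K :: "(real^3) set"
  assumes K: "compact K" "K \<subseteq> closure (interior K)" and V: "vertices_of K \<subseteq> points"
    and "finite H" "\<And>a b. (a, b) \<in> H \<Longrightarrow> a \<noteq> 0"
    and "rational_planes G" "\<And>x. off_planes (H \<union> G) x \<Longrightarrow> locally_constant_at K x"
  shows "\<exists>G. rational_planes G \<and> (\<forall>x. off_planes G x \<longrightarrow> locally_constant_at K x)"
  using assms(4-7)
proof (induction H arbitrary: G rule: finite_induct)
  case empty
  then show ?case by auto
next
  case (insert h H)
  obtain a b where h: "h = (a, b)" by (cases h)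
  have a: "a \<noteq> 0" using insert.prems(1) h by blast
  have Kc: "closed K" "bounded K" using K(1) by (auto simp: compact_imp_closed compact_imp_bounded)
  show ?case
  proof (cases "(\<exists>x. two_sided K a b x) \<or> (\<exists>x. two_sided K (- a) (- b) x)")
    case True
    then obtain v1 v2 v3 where v: "v1 \<in> vertices_of K" "v2 \<in> vertices_of K" "v3 \<in> vertices_of K"
      "a \<bullet> v1 = b" "a \<bullet> v2 = b" "a \<bullet> v3 = b" "cross3 (v2 - v1) (v3 - v1) \<noteq> 0"
    proof
      assume "\<exists>x. two_sided K a b x"
      then show ?thesis using two_sided_vertices[OF a Kc(2)] that by blast
    next
      assume "\<exists>x. two_sided K (- a) (- b) x"
      moreover have "- a \<noteq> 0" using a by simp
      ultimately obtain v1 v2 v3 where "v1 \<in> vertices_of K" "v2 \<in> vertices_of K" "v3 \<in> vertices_of K"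
        "- a \<bullet> v1 = - b" "- a \<bullet> v2 = - b" "- a \<bullet> v3 = - b" "cross3 (v2 - v1) (v3 - v1) \<noteq> 0"
        using two_sided_vertices[OF _ Kc(2)] by blast
      then show ?thesis using that by simp
    qed
    let ?n = "cross3 (v2 - v1) (v3 - v1)"
    have n: "?n \<in> points" using V v by (intro points_cross3 points_diff) auto
    have "rational_planes (insert (?n, ?n \<bullet> v1) G)"
      using insert.prems(2) v n V inner_in[OF n, of v1] by (auto simp: rational_planes_def)
    moreover have "locally_constant_at K x" if "off_planes (H \<union> insert (?n, ?n \<bullet> v1) G) x" for x
      using that plane_through_three_points[OF a v(4-7), of x]
      by (intro insert.prems(3)) (auto simp: off_planes_def h)
    ultimately show ?thesis using insert.IH[of "insert (?n, ?n \<bullet> v1) G"] insert.prems(1) by blast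
  next
    case False
    have "finite (H \<union> G)" using insert.hyps insert.prems(2) by (auto simp: rational_planes_def)
    then have "locally_constant_at K x" if "off_planes (H \<union> G) x" for x
      using remove_plane[OF a Kc(1) K(2), of "H \<union> G" b x] insert.prems(3) h False that by auto
    then show ?thesis using insert.IH[OF _ insert.prems(2)] insert.prems(1) by blast
  qed
qed

text \<open>Cuts \<open>C\<close> along the planes one by one. The pieces stay convex, and once no
  plane is left each piece is connected with locally constant membership in
  \<open>K\<close>.\<close>

lemma indicator_convex_pw_poly:
  assumes "finite H" "\<forall>(a, b)\<in>H. a \<in> points \<and> b \<in> E" "convex C"
    "\<And>x. x \<in> C \<Longrightarrow> off_planes H x \<Longrightarrow> locally_constant_at K x"
  shows "\<exists>g\<in>pw_poly. \<forall>x\<in>C. off_planes H x \<longrightarrow> indicator K x = g x"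
  using assms
proof (induction H arbitrary: C rule: finite_induct)
  case empty
  then have "\<And>x. x \<in> C \<Longrightarrow> locally_constant_at K x" by (simp add: off_planes_def)
  then have const: "x \<in> K \<longleftrightarrow> y \<in> K" if "x \<in> C" "y \<in> C" for x y
    using locally_constant_at_connected[OF convex_connected[OF empty(2)]] that by blast
  then show ?case
  proof (cases "C \<subseteq> K")
    case True
    then show ?thesis by (intro bexI[OF _ pw_poly_const[OF one_in]]) auto
  next
    case False
    then have "x \<notin> K" if "x \<in> C" for x using const that by blast
    then show ?thesis by (intro bexI[OF _ pw_poly_const[OF zero_in]]) auto
  qed
next
  case (insert h H)
  obtain a b where h: "h = (a, b)" by (cases h)
  have ab: "a \<in> points" "b \<in> E" and H: "\<forall>(a, b)\<in>H. a \<in> points \<and> b \<in> E" using insert.prems(1) h by auto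
  have "\<exists>g\<in>pw_poly. \<forall>x\<in>C \<inter> {x. a \<bullet> x > b}. off_planes H x \<longrightarrow> indicator K x = g x"
    using insert.prems(2,3) by (intro insert.IH[OF H]) (auto intro: convex_Int convex_halfspace_gt simp: off_planes_def h)
  moreover have "\<exists>g\<in>pw_poly. \<forall>x\<in>C \<inter> {x. a \<bullet> x < b}. off_planes H x \<longrightarrow> indicator K x = g x"
    using insert.prems(2,3) by (intro insert.IH[OF H]) (auto intro: convex_Int convex_halfspace_lt simp: off_planes_def h)
  ultimately obtain f g where fg: "f \<in> pw_poly" "g \<in> pw_poly"
    "\<And>x. x \<in> C \<Longrightarrow> a \<bullet> x > b \<Longrightarrow> off_planes H x \<Longrightarrow> indicator K x = f x"
    "\<And>x. x \<in> C \<Longrightarrow> a \<bullet> x < b \<Longrightarrow> off_planes H x \<Longrightarrow> indicator K x = g x" by auto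
  show ?case
  proof (intro bexI ballI impI)
    show "(\<lambda>x. f x * of_bool (a \<bullet> x + - b > 0) + g x * of_bool ((- a) \<bullet> x + b > 0)) \<in> pw_poly"
      using fg ab by (intro pw_poly_add pw_poly_mult pw_poly_pos points_uminus uminus_in)
    fix x assume "x \<in> C" "off_planes (insert h H) x"
    then show "indicator K x = f x * of_bool (a \<bullet> x + - b > 0) + g x * of_bool ((- a) \<bullet> x + b > 0)"
      using fg(3,4)[of x] by (cases "a \<bullet> x" b rule: linorder_cases) (auto simp: off_planes_def h)
  qed
qed

lemma solid_polyhedron_pw_poly:
  assumes "solid_polyhedron K" "vertices_of K \<subseteq> points"
  shows "\<exists>g\<in>pw_poly. AE x in lborel. indicator K x = g x"
proof -
  obtain H where H: "finite H" "\<And>a b. (a, b) \<in> H \<Longrightarrow> a \<noteq> 0"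
    "\<And>x. off_planes H x \<Longrightarrow> locally_constant_at K x" using solid_polyhedron_planes[OF assms(1)] by blast
  have "rational_planes {}" by (simp add: rational_planes_def)
  have "\<exists>G. rational_planes G \<and> (\<forall>x. off_planes G x \<longrightarrow> locally_constant_at K x)"
    by (rule replace_planes[OF solid_polyhedron_regular(1,2)[OF assms(1)] assms(2) H(1), where G="{}"])
      (use H \<open>rational_planes {}\<close> in auto)
  then obtain G where G: "rational_planes G" "\<And>x. off_planes G x \<Longrightarrow> locally_constant_at K x" by blast
  have "\<forall>(a, b)\<in>G. a \<in> points \<and> b \<in> E" "finite G" using G(1) by (auto simp: rational_planes_def)
  then obtain g where "g \<in> pw_poly" "\<And>x. off_planes G x \<Longrightarrow> indicator K x = g x"
    using indicator_convex_pw_poly[of G UNIV K] G(2) by auto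
  moreover have "AE x in lborel. off_planes G x" using G(1) by (intro AE_off_planes) (auto simp: rational_planes_def)
  ultimately show ?thesis by (intro bexI[of _ g]) auto
qed

end

subsection \<open>Radial integration\<close>

text \<open>All half-spaces pass through 0, so these functions are homogeneous under positive
  scaling. The degree is an index because radial integration turns it into a power of the radial
  variable.\<close>

inductive (in real_subfield) hom_poly :: "nat \<Rightarrow> ('a::euclidean_space \<Rightarrow> real) \<Rightarrow> bool" where
  hom_poly_const: "c \<in> E \<Longrightarrow> hom_poly 0 (\<lambda>_. c)"
| hom_poly_inner: "v \<in> points \<Longrightarrow> hom_poly 1 (\<lambda>x. v \<bullet> x)"
| hom_poly_pos: "v \<in> points \<Longrightarrow> hom_poly 0 (\<lambda>x. of_bool (v \<bullet> x > 0))"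
| hom_poly_add: "hom_poly k f \<Longrightarrow> hom_poly k g \<Longrightarrow> hom_poly k (\<lambda>x. f x + g x)"
| hom_poly_mult: "hom_poly k f \<Longrightarrow> hom_poly l g \<Longrightarrow> hom_poly (k + l) (\<lambda>x. f x * g x)"

context real_subfield
begin

lemma hom_poly_pw_poly: "hom_poly k f \<Longrightarrow> f \<in> pw_poly"
proof (induction k f rule: hom_poly.induct)
  case (hom_poly_pos v)
  then show ?case using pw_poly_pos[of v 0] by simp
qed (auto intro: pw_poly.intros)

lemma hom_poly_scale: "hom_poly k f \<Longrightarrow> s > 0 \<Longrightarrow> f (s *\<^sub>R x) = s ^ k * f x"
  by (induction k f rule: hom_poly.induct) (auto simp: zero_less_mult_iff power_add algebra_simps)

lemma hom_poly_compose:
  assumes L: "\<And>v. v \<in> points \<Longrightarrow> \<exists>w\<in>points. \<forall>x. v \<bullet> L x = w \<bullet> x" and "hom_poly k f"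
  shows "hom_poly k (\<lambda>x. f (L x))"
  using assms(2)
proof (induction k f rule: hom_poly.induct)
  case (hom_poly_inner v)
  from L[OF this] show ?case using hom_poly.hom_poly_inner by auto
next
  case (hom_poly_pos v)
  from L[OF this] show ?case using hom_poly.hom_poly_pos by auto
qed (auto intro: hom_poly.intros)

lemma hom_poly_mult_0: "hom_poly k f \<Longrightarrow> hom_poly 0 g \<Longrightarrow> hom_poly k (\<lambda>x. f x * g x)"
  using hom_poly_mult[of k f 0 g] by simp

lemma hom_poly_uminus_0: "hom_poly 0 f \<Longrightarrow> hom_poly 0 (\<lambda>x. - f x)"
  using hom_poly_mult_0[OF hom_poly_const[of "-1"], of f] by (simp add: uminus_in)

lemma hom_poly_diff_0: "hom_poly 0 f \<Longrightarrow> hom_poly 0 g \<Longrightarrow> hom_poly 0 (\<lambda>x. f x - g x)"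
  using hom_poly_add[of 0 f "\<lambda>x. - g x"] hom_poly_uminus_0[of g] by simp

lemma hom_poly_prod_0: "(\<And>i. i \<in> I \<Longrightarrow> hom_poly 0 (f i)) \<Longrightarrow> hom_poly 0 (\<lambda>x. \<Prod>i\<in>I. f i x)"
  by (induction I rule: infinite_finite_induct) (auto intro: hom_poly_const hom_poly_mult_0)

text \<open>The generators are integrable: the lower bound on \<^term>\<open>a \<bullet> z\<close> makes their support bounded.\<close>

inductive_set cone_span :: "('a::euclidean_space \<Rightarrow> real) set" where
  cone_span_zero: "(\<lambda>_. 0) \<in> cone_span"
| cone_span_add: "f \<in> cone_span \<Longrightarrow> g \<in> cone_span \<Longrightarrow> (\<lambda>z. f z + g z) \<in> cone_span"
| cone_span_gen: "hom_poly k h \<Longrightarrow> a \<in> points \<Longrightarrow> \<epsilon> > 0 \<Longrightarrow> (\<And>z. h z \<noteq> 0 \<Longrightarrow> a \<bullet> z \<ge> \<epsilon> * norm z) \<Longrightarrow>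
    (\<lambda>z. h z * of_bool (\<not> above s (a \<bullet> z - 1))) \<in> cone_span"

lemma cone_span_sum: "(\<And>i. i \<in> I \<Longrightarrow> f i \<in> cone_span) \<Longrightarrow> (\<lambda>x. \<Sum>i\<in>I. f i x) \<in> cone_span"
  by (induction I rule: infinite_finite_induct) (auto intro: cone_span_zero cone_span_add)

lemma cone_span_mult_hom_poly:
  assumes "f \<in> cone_span" "hom_poly l g" shows "(\<lambda>z. f z * g z) \<in> cone_span"
  using assms(1)
proof (induction f rule: cone_span.induct)
  case (cone_span_gen k h a \<epsilon> s)
  have "(\<lambda>z. (h z * g z) * of_bool (\<not> above s (a \<bullet> z - 1))) \<in> cone_span"
    using cone_span_gen by (intro cone_span.cone_span_gen[OF hom_poly_mult[OF cone_span_gen(1) assms(2)], of a \<epsilon>]) auto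
  then show ?case by (simp add: mult_ac)
qed (auto simp: distrib_right intro: cone_span.intros)

lemma cone_span_uminus: "f \<in> cone_span \<Longrightarrow> (\<lambda>z. - f z) \<in> cone_span"
  using cone_span_mult_hom_poly[OF _ hom_poly_const[of "-1"]] by (simp add: uminus_in)

lemma cone_span_diff: "f \<in> cone_span \<Longrightarrow> g \<in> cone_span \<Longrightarrow> (\<lambda>z. f z - g z) \<in> cone_span"
  using cone_span_add[OF _ cone_span_uminus, of f g] by simp

text \<open>
  Where \<^term>\<open>a' \<bullet> z > a \<bullet> z\<close>, the part of the pyramid beyond the plane of \<^term>\<open>a'\<close> is a difference of
  two pyramids; where \<^term>\<open>a' \<bullet> z < a \<bullet> z\<close>, it is empty.
\<close>

lemma cone_span_mult_above:
  assumes "f \<in> cone_span" "a' \<in> points"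
  shows "(\<lambda>z. f z * of_bool (above s' (a' \<bullet> z - 1))) \<in> cone_span"
  using assms(1)
proof (induction f rule: cone_span.induct)
  case (cone_span_gen k h a \<epsilon> s)
  define P where "P x = (of_bool ((a' - a) \<bullet> x > 0) :: real)" for x
  define Q where "Q x = (of_bool ((a - a') \<bullet> x > 0) :: real)" for x
  have PQ: "hom_poly 0 P" "hom_poly 0 Q"
    unfolding P_def Q_def using cone_span_gen(2) assms(2) by (auto intro!: hom_poly_pos points_diff)
  \<comment> \<open>Where both bounds agree, two upper bounds combine into one that is weak only if
    both are; hence the flag \<open>s \<and> s'\<close> below.\<close>
  define Z where "Z x = 1 - P x - Q x" for x
  have Z: "hom_poly 0 Z" unfolding Z_def by (intro hom_poly_diff_0 hom_poly_const one_in PQ)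
  \<comment> \<open>Makes the pyramid cut off by \<open>a'\<close> bounded as well: on this part
    \<open>a'\<close> dominates \<open>a\<close>.\<close>
  have P': "a' \<bullet> z \<ge> \<epsilon> * norm z" if "h z * P z \<noteq> 0" for z
    using cone_span_gen(4)[of z] that by (auto simp: P_def inner_diff_left)
  have "(\<lambda>z. ((h z * P z) * of_bool (\<not> above s (a \<bullet> z - 1)) - (h z * P z) * of_bool (\<not> above s' (a' \<bullet> z - 1)))
      + ((h z * Z z) * of_bool (\<not> above s (a \<bullet> z - 1)) - (h z * Z z) * of_bool (\<not> above (s \<and> s') (a \<bullet> z - 1)))) \<in> cone_span"
    using cone_span_gen(4)
    by (intro cone_span_add cone_span_diff cone_span.cone_span_gen[OF hom_poly_mult_0[OF cone_span_gen(1)] cone_span_gen(2,3)] PQ Z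
        cone_span.cone_span_gen[OF hom_poly_mult_0[OF cone_span_gen(1)] assms(2) cone_span_gen(3) P']) auto
  moreover have "((h z * P z) * of_bool (\<not> above s (a \<bullet> z - 1)) - (h z * P z) * of_bool (\<not> above s' (a' \<bullet> z - 1)))
      + ((h z * Z z) * of_bool (\<not> above s (a \<bullet> z - 1)) - (h z * Z z) * of_bool (\<not> above (s \<and> s') (a \<bullet> z - 1)))
      = h z * of_bool (\<not> above s (a \<bullet> z - 1)) * of_bool (above s' (a' \<bullet> z - 1))" for z
    by (cases "a \<bullet> z" "a' \<bullet> z" rule: linorder_cases)
      (auto simp: P_def Q_def Z_def inner_diff_left above_def split: if_splits)
  ultimately show ?case by simp
qed (auto simp: distrib_right intro: cone_span.intros)

text \<open>Dividing by the offset normalises a plane off the origin to height 1. For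
  \<open>b < 0\<close> the half-space lies beyond the plane; for \<open>b > 0\<close> it contains 0
  and is the complement of such a set.\<close>

lemma cone_span_mult_pw_poly:
  assumes "h \<in> pw_poly" "f \<in> cone_span" shows "(\<lambda>z. f z * h z) \<in> cone_span"
  using assms
proof (induction h arbitrary: f rule: pw_poly.induct)
  case (pw_poly_const c)
  then show ?case using cone_span_mult_hom_poly[OF _ hom_poly_const] by blast
next
  case (pw_poly_inner v)
  then show ?case using cone_span_mult_hom_poly[OF _ hom_poly_inner] by blast
next
  case (pw_poly_pos v b)
  have in': "(- 1 / b) *\<^sub>R v \<in> points"
    using pw_poly_pos by (intro points_scaleR in_intros; simp)+
  consider "b = 0" | "b < 0" | "b > 0" by linarith
  then show ?case
  proof cases
    case 1
    then show ?thesis using cone_span_mult_hom_poly[OF pw_poly_pos(3) hom_poly_pos[OF pw_poly_pos(1)]] by simp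
  next
    case 2
    have "v \<bullet> z + b > 0 \<longleftrightarrow> above True (((- 1 / b) *\<^sub>R v) \<bullet> z - 1)" for z
      using 2 by (auto simp: above_def field_simps)
    then show ?thesis using cone_span_mult_above[OF pw_poly_pos(3) in', of True] by simp
  next
    case 3
    have "v \<bullet> z + b > 0 \<longleftrightarrow> \<not> above False (((- 1 / b) *\<^sub>R v) \<bullet> z - 1)" for z
      using 3 by (auto simp: above_def field_simps)
    then have "(\<lambda>z. f z * of_bool (v \<bullet> z + b > 0)) =
        (\<lambda>z. f z - f z * of_bool (above False (((- 1 / b) *\<^sub>R v) \<bullet> z - 1)))"
      by (intro ext) simp
    then show ?thesis using cone_span_diff[OF pw_poly_pos(3) cone_span_mult_above[OF pw_poly_pos(3) in', of False]]
      by (simp only:)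
  qed
next
  case (pw_poly_add g h)
  then show ?case using cone_span_add[OF pw_poly_add(3,4)[OF pw_poly_add(5)]] by (simp add: distrib_left)
next
  case (pw_poly_mult g h)
  then show ?case using pw_poly_mult(4)[OF pw_poly_mult(3)[OF pw_poly_mult(5)]] by (simp add: mult.assoc)
qed

text \<open>A large cube is, up to ties, the disjoint union of the pyramids over its faces with apex 0.\<close>

lemma pw_poly_bounded_support_cone_span:
  fixes f :: "'a::euclidean_space \<Rightarrow> real"
  assumes "f \<in> pw_poly" "\<And>z. f z \<noteq> 0 \<Longrightarrow> norm z \<le> real N"
  shows "\<exists>g\<in>cone_span. AE z in lborel. f z = g z"
proof -
  define r where "r = real N + 1"
  have r: "r > 0" "r \<in> E" by (auto simp: r_def intro: in_intros)
  \<comment> \<open>The linear forms that take the value 1 on the faces of the cube of half-side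
    \<open>r\<close>; as \<open>r\<close> exceeds \<open>N\<close>, the support lies strictly
    inside.\<close>
  define D :: "'a set" where "D = (\<lambda>b. (1 / r) *\<^sub>R b) ` Basis \<union> (\<lambda>b. (- 1 / r) *\<^sub>R b) ` Basis"
  have D: "finite D" "D \<noteq> {}" by (auto simp: D_def)
  have Dpts: "d \<in> points" if "d \<in> D" for d
    using that r unfolding D_def by (auto intro!: points_scaleR points_uminus divide_in intro: points_Basis)
  have D1: "d \<bullet> z < 1" if "d \<in> D" "norm z \<le> real N" for d z
  proof -
    have "norm d = 1 / r" using that(1) r by (auto simp: D_def)
    then have "d \<bullet> z \<le> 1 / r * real N"
      using norm_cauchy_schwarz[of d z] mult_left_mono[OF that(2), of "norm d"] r by simp
    moreover have "1 / r * real N < 1" using r by (simp add: r_def)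
    ultimately show ?thesis by linarith
  qed
  \<comment> \<open>Says that \<open>d\<close> is the strict maximum of the forms at
    \<open>z\<close>: the ray from 0 through \<open>z\<close> leaves the cube through the relative
    interior of the face of \<open>d\<close>.\<close>
  define c where "c d z = (\<Prod>d'\<in>D - {d}. of_bool ((d - d') \<bullet> z > 0) :: real)" for d z :: 'a
  define \<gamma> where "\<gamma> z = (\<Sum>d\<in>D. c d z * of_bool (\<not> above True (d \<bullet> z - 1)))" for z
  have "\<gamma> \<in> cone_span" unfolding \<gamma>_def
  proof (intro cone_span_sum cone_span_gen)
    fix d assume d: "d \<in> D"
    then show "d \<in> points" by (rule Dpts)
    show "hom_poly 0 (c d)" unfolding c_def using d Dpts by (intro hom_poly_prod_0 hom_poly_pos points_diff) auto
    \<comment> \<open>\<open>norm z\<close> is at most the sum of the \<open>DIM('a)\<close>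
      absolute coordinates, each of them at most \<open>r * (d \<bullet> z)\<close>.\<close>
    show "1 / (r * DIM('a)) > 0" using r by simp
    fix z assume "c d z \<noteq> 0"
    then have "d' \<bullet> z \<le> d \<bullet> z" if "d' \<in> D" for d'
      using D(1) that unfolding c_def by (cases "d' = d") (auto simp: inner_diff_left intro: less_imp_le)
    then have *: "\<bar>z \<bullet> b\<bar> \<le> r * (d \<bullet> z)" if "b \<in> Basis" for b
      using that r by (force simp: D_def abs_le_iff field_simps inner_commute)
    have "norm z \<le> (\<Sum>b\<in>Basis. \<bar>z \<bullet> b\<bar>)" by (rule norm_le_l1)
    also have "\<dots> \<le> (\<Sum>b\<in>(Basis :: 'a set). r * (d \<bullet> z))" by (intro sum_mono *)
    finally show "1 / (r * DIM('a)) * norm z \<le> d \<bullet> z" using r by (simp add: field_simps)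
  qed
  then have "(\<lambda>z. \<gamma> z * f z) \<in> cone_span" by (rule cone_span_mult_pw_poly[OF assms(1)])
  moreover have "AE z in lborel. f z = \<gamma> z * f z"
  proof -
    define H where "H = (\<lambda>(d, d'). (d - d', 0::real)) ` (D \<times> D - Id)"
    have "AE z in lborel. off_planes H z"
      using D(1) by (intro AE_off_planes) (auto simp: H_def)
    then show ?thesis
    proof (rule AE_mp, intro AE_I2 impI)
      fix z assume off: "off_planes H z"
      show "f z = \<gamma> z * f z"
      proof (cases "f z = 0")
        case False
        obtain d where d: "d \<in> D" "\<And>d'. d' \<in> D \<Longrightarrow> d' \<bullet> z \<le> d \<bullet> z"
          using Max_in[of "(\<lambda>d. d \<bullet> z) ` D"] Max_ge[of "(\<lambda>d. d \<bullet> z) ` D"] D by fastforce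
        have strict: "d' \<bullet> z < d \<bullet> z" if "d' \<in> D" "d' \<noteq> d" for d'
        proof -
          have "(d - d', 0) \<in> H" using that d(1) by (force simp: H_def)
          then have "(d - d') \<bullet> z \<noteq> 0" using off by (auto simp: off_planes_def)
          then show ?thesis using d(2)[OF that(1)] by (simp add: inner_diff_left)
        qed
        have "c d z = 1" unfolding c_def using strict by (intro prod.neutral) (auto simp: inner_diff_left)
        moreover have "c d' z = 0" if "d' \<in> D - {d}" for d'
          unfolding c_def using that D(1) d by (auto simp: inner_diff_left not_less intro!: bexI[of _ d])
        ultimately have "\<gamma> z = of_bool (\<not> above True (d \<bullet> z - 1))"
          unfolding \<gamma>_def using sum.remove[OF D(1) d(1), of "\<lambda>d. c d z * of_bool (\<not> above True (d \<bullet> z - 1))"]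
          by (simp add: sum.neutral del: sum_mult_of_bool_eq)
        then show ?thesis using D1[OF d(1) assms(2)[OF False]] by (simp add: above_def)
      qed simp
    qed
  qed
  ultimately show ?thesis by (intro bexI[of _ "\<lambda>z. \<gamma> z * f z"])
qed

end

section \<open>Rotating and scaling a pyramid\<close>

lemma integral_lborel_scaleR:
  fixes f :: "'a::euclidean_space \<Rightarrow> real"
  assumes [measurable]: "f \<in> borel_measurable borel" and "x > 0"
  shows "(\<integral>w. f w \<partial>lborel) = x ^ DIM('a) * (\<integral>w. f (x *\<^sub>R w) \<partial>lborel)"
proof -
  have "(\<integral>w. f w \<partial>lborel) = (\<integral>w. f w \<partial>density (distr lborel borel (\<lambda>w. 0 + x *\<^sub>R w)) (\<lambda>_. ennreal (\<bar>x\<bar> ^ DIM('a))))"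
    using lborel_affine[of x "0::'a"] assms(2) by simp
  also have "\<dots> = x ^ DIM('a) * (\<integral>w. f (x *\<^sub>R w) \<partial>lborel)"
    using assms(2) by (subst integral_density) (auto simp: integral_distr)
  finally show ?thesis .
qed

locale real_sqrt_field = real_subfield +
  assumes sqrt_in: "x \<in> E \<Longrightarrow> x \<ge> 0 \<Longrightarrow> sqrt x \<in> E"
begin

lemma norm_in: "v \<in> points \<Longrightarrow> norm v \<in> E"
  by (simp add: norm_eq_sqrt_inner sqrt_in inner_in)

text \<open>The reflection orthogonal to \<open>a - norm a *\<^sub>R e\<close>, with
  \<open>e\<close> the first unit vector, exchanges \<open>a\<close> and
  \<open>norm a *\<^sub>R e\<close>, two vectors of equal length. Beyond field operations it uses
  only \<open>norm a\<close>, and it is self-adjoint, whence the last two claims.\<close>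

lemma householder:
  fixes a :: "real \<times> 'b::euclidean_space"
  assumes a: "a \<in> points"
  shows "\<exists>H :: real \<times> 'b \<Rightarrow> real \<times> 'b. linear H \<and> (\<forall>z. norm (H z) = norm z) \<and> surj H \<and>
    (\<forall>z. a \<bullet> H z = norm a * fst z) \<and> (\<forall>v\<in>points. \<exists>w\<in>points. \<forall>z. v \<bullet> H z = w \<bullet> z)"
proof -
  define e :: "real \<times> 'b" where "e = (1, 0)"
  have e: "e \<in> points" "e \<bullet> z = fst z" "e \<bullet> e = 1" for z by (auto simp: e_def inner_prod_def)
  define u where "u = a - norm a *\<^sub>R e"
  show ?thesis
  proof (cases "u = 0")
    case True
    then have "a = norm a *\<^sub>R e" by (simp add: u_def)
    then have "a \<bullet> z = norm a * fst z" for z by (metis e(2) inner_scaleR_left)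
    then show ?thesis by (intro exI[of _ "\<lambda>z. z"]) (auto simp: linear_id[unfolded id_def] surj_id[unfolded id_def])
  next
    case False
    define H where "H z = z - (2 * (u \<bullet> z) / (u \<bullet> u)) *\<^sub>R u" for z
    have uu: "u \<bullet> u \<noteq> 0" using False by simp
    have adj: "v \<bullet> H z = H v \<bullet> z" for v z
      by (simp add: H_def inner_diff_left inner_diff_right inner_commute)
    have HH: "H (H z) = z" for z
    proof -
      have "u \<bullet> H z = - (u \<bullet> z)" using uu by (simp add: H_def inner_diff_right)
      then show ?thesis unfolding H_def[of "H z"] by (simp add: H_def)
    qed
    have "2 * (u \<bullet> a) = u \<bullet> u"
    proof -
      have "norm a * norm a = a \<bullet> a" by (simp add: dot_square_norm power2_eq_square)
      then show ?thesis by (simp add: u_def inner_diff_left inner_diff_right e(3) inner_commute algebra_simps)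
    qed
    then have "H a = norm a *\<^sub>R e" using uu by (simp add: H_def) (simp add: u_def)
    then have 1: "a \<bullet> H z = norm a * fst z" for z by (simp add: adj e(2))
    have 2: "linear H" unfolding H_def
      by (intro linearI) (auto simp: inner_add_right algebra_simps add_divide_distrib)
    have 3: "norm (H z) = norm z" for z by (simp add: norm_eq_sqrt_inner adj HH)
    have u: "u \<in> points" unfolding u_def using a e(1) norm_in[OF a] by (intro points_diff points_scaleR)
    have 4: "H v \<in> points" if "v \<in> points" for v unfolding H_def
      using that u by (intro points_diff points_scaleR in_intros inner_in)
    have 5: "surj H" by (metis HH surjI)
    show ?thesis by (intro exI[of _ H] conjI allI ballI 1 2 3 5) (use adj 4 in blast)
  qed
qed

text \<open>After the rotation a pyramid is cut off at \<open>x = 1 / norm a\<close>. Scaling its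
  slices to height 1 gives \<open>x ^ DIM('b)\<close> as Jacobian and \<open>x ^ k\<close> by
  homogeneity, so the \<open>x\<close>-integral can be done for fixed \<open>w\<close>. What remains
  over the slice is assumed as \<open>base\<close>, to be discharged separately in each
  dimension.\<close>

lemma radial_integral:
  fixes \<phi> :: "real \<Rightarrow> real" and f :: "real \<times> 'b::euclidean_space \<Rightarrow> real"
  assumes \<phi>: "continuous_on UNIV \<phi>"
    and base: "\<And>k h R \<rho>. hom_poly k (h :: real \<times> 'b \<Rightarrow> real) \<Longrightarrow> R > 0 \<Longrightarrow> R \<in> E \<Longrightarrow> (\<And>w. h (1, w) \<noteq> 0 \<Longrightarrow> norm w \<le> \<rho>) \<Longrightarrow>
      (\<integral>w. h (1, w) * (LBINT x:{0..R}. x ^ (k + DIM('b)) * \<phi> (x * sqrt (1 + (norm w)\<^sup>2))) \<partial>lborel) \<in> E"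
    and f: "f \<in> pw_poly" "\<And>z. f z \<noteq> 0 \<Longrightarrow> norm z \<le> real N"
  shows "(\<integral>z. \<phi> (norm z) * f z \<partial>lborel) \<in> E"
proof -
  have [measurable]: "\<phi> \<in> borel_measurable borel" using \<phi> by (rule borel_measurable_continuous_onI)
  have \<phi>_bounded: "\<exists>B. \<forall>x. \<bar>x\<bar> \<le> r \<longrightarrow> \<bar>\<phi> x\<bar> \<le> B" for r
  proof -
    have "compact (\<phi> ` {- r..r})" using \<phi> by (intro compact_continuous_image) (auto intro: continuous_on_subset)
    then have "bounded (\<phi> ` {- r..r})" by (rule compact_imp_bounded)
    then obtain B where "\<And>x. x \<in> {- r..r} \<Longrightarrow> norm (\<phi> x) \<le> B" unfolding bounded_iff by blast
    then show ?thesis by (intro exI[of _ B]) (auto simp: abs_le_iff)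
  qed
  have cone_span: "integrable lborel (\<lambda>z. \<phi> (norm z) * g z) \<and> (\<integral>z. \<phi> (norm z) * g z \<partial>lborel) \<in> E" if "g \<in> cone_span"
    for g :: "real \<times> 'b \<Rightarrow> real"
    using that
  proof (induction g rule: cone_span.induct)
    case (cone_span_add f g)
    then show ?case by (simp add: distrib_left add)
  next
    case (cone_span_gen k h a \<epsilon> s)
    have [measurable]: "h \<in> borel_measurable borel" using hom_poly_pw_poly[OF cone_span_gen(1)] by measurable
    define g where "g z = h z * of_bool (\<not> above s (a \<bullet> z - 1))" for z
    have [measurable]: "g \<in> borel_measurable borel" unfolding g_def above_def by measurable
    have supp: "norm z \<le> 1 / \<epsilon>" if "g z \<noteq> 0" for z
      using that cone_span_gen(3) cone_span_gen(4)[of z] by (auto simp: g_def above_def field_simps split: if_splits)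
    obtain B where B: "\<And>x. \<bar>x\<bar> \<le> 1 / \<epsilon> \<Longrightarrow> \<bar>\<phi> x\<bar> \<le> B" using \<phi>_bounded by blast
    obtain C where C: "\<And>x. norm x \<le> 1 / \<epsilon> \<Longrightarrow> \<bar>h x\<bar> \<le> C" using pw_poly_bounded[OF hom_poly_pw_poly[OF cone_span_gen(1)]] by blast
    have int: "integrable lborel (\<lambda>z. \<phi> (norm z) * g z)"
    proof (rule integrable_bounded_support)
      show "\<bar>\<phi> (norm z) * g z\<bar> \<le> \<bar>B\<bar> * \<bar>C\<bar>" for z
      proof (cases "g z = 0")
        case False
        then have "\<bar>\<phi> (norm z)\<bar> \<le> \<bar>B\<bar>" "\<bar>h z\<bar> \<le> \<bar>C\<bar>"
          using supp[of z] B[of "norm z"] C[of z] by auto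
        moreover have "\<bar>g z\<bar> \<le> \<bar>h z\<bar>" by (auto simp: g_def)
        ultimately show ?thesis unfolding abs_mult by (intro mult_mono) auto
      qed auto
    qed (use supp in auto)
    have "(\<integral>z. \<phi> (norm z) * g z \<partial>lborel) \<in> E"
    proof (cases "a = 0")
      \<comment> \<open>The bound \<open>\<epsilon> * norm z \<le> a \<bullet> z\<close> then
        confines \<open>h\<close> to the origin, a null set.\<close>
      case True
      have zero: "g z = 0" if "z \<noteq> 0" for z
        using that cone_span_gen(3) cone_span_gen(4)[of z] True by (auto simp: g_def mult_le_0_iff)
      have "AE z in lborel. \<phi> (norm z) * g z = 0"
        using AE_lborel_singleton[of "0 :: real \<times> 'b"] by eventually_elim (simp add: zero)
      then have "(\<integral>z. \<phi> (norm z) * g z \<partial>lborel) = 0" by (rule integral_eq_zero_AE)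
      then show ?thesis by simp
    next
      case False
      obtain H :: "real \<times> 'b \<Rightarrow> real \<times> 'b" where H': "linear H" "\<forall>z. norm (H z) = norm z" "surj H"
        "\<forall>z. a \<bullet> H z = norm a * fst z" "\<forall>v\<in>points. \<exists>w\<in>points. \<forall>z. v \<bullet> H z = w \<bullet> z"
        using householder[OF cone_span_gen(2)] by (elim exE conjE)
      note H = H'(1) H'(2)[rule_format] H'(3) H'(4)[rule_format] H'(5)[rule_format]
      have [measurable]: "H \<in> borel_measurable borel"
        using H(1) by (intro borel_measurable_continuous_onI linear_continuous_on) (simp add: linear_conv_bounded_linear)
      define h' where "h' z = h (H z)" for z
      have h': "hom_poly k h'" unfolding h'_def by (rule hom_poly_compose[OF H(5) cone_span_gen(1)])
      have [measurable]: "h' \<in> borel_measurable (borel \<Otimes>\<^sub>M borel)"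
        using pw_poly_measurable[OF hom_poly_pw_poly[OF h']] by (simp add: borel_prod)
      define \<alpha> where "\<alpha> = norm a"
      have \<alpha>: "\<alpha> > 0" "\<alpha> \<in> E" using False norm_in[OF cone_span_gen(2)] by (auto simp: \<alpha>_def)
      have pos: "\<alpha> * fst z \<ge> \<epsilon> * norm z" if "h' z \<noteq> 0" for z
        using cone_span_gen(4)[of "H z"] that by (simp add: h'_def H(2,4) \<alpha>_def)
      define F where "F z = \<phi> (norm z) * (h' z * of_bool (\<not> above s (\<alpha> * fst z - 1)))" for z
      have F_H: "F z = \<phi> (norm (H z)) * g (H z)" for z by (simp add: F_def g_def h'_def H(2,4) \<alpha>_def)
      have [measurable]: "F \<in> borel_measurable (borel \<Otimes>\<^sub>M borel)"
      proof -
        have [measurable]: "(fst :: real \<times> 'b \<Rightarrow> real) \<in> borel_measurable borel"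
          by (intro borel_measurable_continuous_onI continuous_intros)
        have [measurable]: "h' \<in> borel_measurable borel" using pw_poly_measurable[OF hom_poly_pw_poly[OF h']] .
        have "F \<in> borel_measurable borel" unfolding F_def above_def by measurable
        then show ?thesis by (simp add: borel_prod)
      qed
      have "integrable lborel F"
      proof -
        have "integrable (distr lborel borel H) (\<lambda>z. \<phi> (norm z) * g z)"
          using int lborel_distr_isometry[OF H(1-3)] by simp
        then have "integrable lborel (\<lambda>z. \<phi> (norm (H z)) * g (H z))" by (subst (asm) integrable_distr_eq) auto
        moreover have "F = (\<lambda>z. \<phi> (norm (H z)) * g (H z))" using F_H by (rule ext)
        ultimately show ?thesis by (simp only:)
      qed
      define R where "R = 1 / \<alpha>"
      have R: "R > 0" "R \<in> E" using \<alpha> by (auto simp: R_def intro: in_intros)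
      define n where "n = DIM('b)"
      \<comment> \<open>\<open>F\<close> with the fibre over each \<open>x\<close> rescaled: the
        slice integrals agree, but \<open>w\<close> now ranges over the fixed slice at height 1, and
        the order of integration can be exchanged.\<close>
      define G where "G z = indicator {0..R} (fst z) * fst z ^ (k + n) * \<phi> (fst z * sqrt (1 + (norm (snd z))\<^sup>2)) * h' (1, snd z)" for z
      have [measurable]: "G \<in> borel_measurable (borel \<Otimes>\<^sub>M borel)" unfolding G_def by measurable
      \<comment> \<open>The bound \<open>\<epsilon> * norm z \<le> \<alpha> * fst z\<close> of the
        pyramid, read at height 1.\<close>
      define \<rho> where "\<rho> = \<alpha> / \<epsilon>"
      have \<rho>: "norm w \<le> \<rho>" if "h' (1, w) \<noteq> 0" for w
      proof -
        have "\<epsilon> * norm w \<le> \<epsilon> * norm (1::real, w)" using norm_snd_le[of w "1::real"] cone_span_gen(3) by simp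
        also have "\<dots> \<le> \<alpha>" using pos[OF that] by simp
        finally show ?thesis using cone_span_gen(3) by (simp add: \<rho>_def field_simps)
      qed
      have "integrable lborel G"
      proof -
        obtain B where B: "\<And>x. \<bar>x\<bar> \<le> R * sqrt (1 + \<rho>\<^sup>2) \<Longrightarrow> \<bar>\<phi> x\<bar> \<le> B" using \<phi>_bounded by blast
        obtain C where C: "\<And>x. norm x \<le> 1 + \<rho> \<Longrightarrow> \<bar>h' x\<bar> \<le> C" using pw_poly_bounded[OF hom_poly_pw_poly[OF h']] by blast
        show ?thesis
        proof (rule integrable_bounded_support)
          show "G \<in> borel_measurable borel" by (simp add: borel_prod[symmetric])
          show "norm z \<le> R + \<rho>" if "G z \<noteq> 0" for z
            using that \<rho>[of "snd z"] norm_Pair_le[of "fst z" "snd z"] by (auto simp: G_def indicator_def split: if_splits)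
          show "\<bar>G z\<bar> \<le> R ^ (k + n) * \<bar>B\<bar> * \<bar>C\<bar>" for z
          proof (cases "G z = 0")
            case False
            then have z: "0 \<le> fst z" "fst z \<le> R" "norm (snd z) \<le> \<rho>" using \<rho>[of "snd z"]
              by (auto simp: G_def indicator_def split: if_splits)
            then have "fst z * sqrt (1 + (norm (snd z))\<^sup>2) \<le> R * sqrt (1 + \<rho>\<^sup>2)"
              by (intro mult_mono) (auto intro: power_mono)
            then have "\<bar>\<phi> (fst z * sqrt (1 + (norm (snd z))\<^sup>2))\<bar> \<le> B"
              using z(1) by (intro B) (simp add: abs_mult)
            then have 1: "\<bar>\<phi> (fst z * sqrt (1 + (norm (snd z))\<^sup>2))\<bar> \<le> \<bar>B\<bar>" by linarith
            have "norm (1::real, snd z) \<le> 1 + \<rho>"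
              using norm_Pair_le[of "1::real" "snd z"] z(3) by simp
            then have "\<bar>h' (1, snd z)\<bar> \<le> C" by (rule C)
            then have 2: "\<bar>h' (1, snd z)\<bar> \<le> \<bar>C\<bar>" by linarith
            have 3: "fst z ^ (k + n) \<le> R ^ (k + n)" using z by (intro power_mono)
            have "\<bar>G z\<bar> = fst z ^ (k + n) * \<bar>\<phi> (fst z * sqrt (1 + (norm (snd z))\<^sup>2))\<bar> * \<bar>h' (1, snd z)\<bar>"
              using z by (simp add: G_def abs_mult indicator_def)
            then show ?thesis using 1 2 3 R(1) by (simp only:) (intro mult_mono; simp)
          qed (use R in auto)
        qed
      qed
      \<comment> \<open>At 0 the scaling degenerates and at \<open>R\<close> the strictness of the
        bound matters; for negative \<open>x\<close> both sides vanish.\<close>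
      have slice: "(\<integral>w. F (x, w) \<partial>lborel) = (\<integral>w. G (x, w) \<partial>lborel)" if "x \<noteq> 0" "x \<noteq> R" for x
      proof (cases "x > 0")
        case True
        have "F (x, x *\<^sub>R w) = indicator {0..R} x * x ^ k * \<phi> (x * sqrt (1 + (norm w)\<^sup>2)) * h' (1, w)" for w
        proof -
          have "(x, x *\<^sub>R w) = x *\<^sub>R (1, w)" by simp
          then have "h' (x, x *\<^sub>R w) = x ^ k * h' (1, w)" "norm (x, x *\<^sub>R w) = x * sqrt (1 + (norm w)\<^sup>2)"
            using hom_poly_scale[OF h' True, of "(1, w)"] True by (simp_all add: norm_Pair norm_scaleR del: scaleR_Pair)
          moreover have "\<not> above s (\<alpha> * x - 1) \<longleftrightarrow> x \<in> {0..R}"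
            using True that \<alpha> by (auto simp: above_def R_def field_simps)
          ultimately show ?thesis by (simp add: F_def indicator_def)
        qed
        moreover have "(\<integral>w. F (x, w) \<partial>lborel) = x ^ n * (\<integral>w. F (x, x *\<^sub>R w) \<partial>lborel)"
          unfolding n_def using True by (intro integral_lborel_scaleR) measurable
        ultimately show ?thesis by (simp add: G_def power_add mult_ac flip: integral_mult_right_zero)
      next
        case False
        have "h' (x, w) = 0" for w
        proof (rule ccontr)
          assume "h' (x, w) \<noteq> 0"
          from pos[OF this] have "\<epsilon> * norm (x, w) \<le> \<alpha> * x" by simp
          moreover have "\<alpha> * x < 0" using False that \<alpha> by (simp add: mult_less_0_iff)
          moreover have "0 \<le> \<epsilon> * norm (x, w)" using cone_span_gen(3) by simp
          ultimately show False by linarith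
        qed
        then show ?thesis using False that by (simp add: F_def G_def indicator_def)
      qed
      have "(\<integral>z. \<phi> (norm z) * g z \<partial>lborel) = (\<integral>z. F z \<partial>lborel)"
        unfolding F_H by (intro integral_lborel_isometry[OF H(1-3), symmetric]) auto
      also have "\<dots> = (\<integral>x. \<integral>w. F (x, w) \<partial>lborel \<partial>lborel)" by (rule integral_lborel_Pair) fact
      also have "\<dots> = (\<integral>x. \<integral>w. G (x, w) \<partial>lborel \<partial>lborel)"
      proof (rule integral_cong_AE)
        show "AE x in lborel. (\<integral>w. F (x, w) \<partial>lborel) = (\<integral>w. G (x, w) \<partial>lborel)"
          using AE_lborel_singleton[of 0] AE_lborel_singleton[of R] by eventually_elim (rule slice)
      qed measurable
      also have "\<dots> = (\<integral>w. \<integral>x. G (x, w) \<partial>lborel \<partial>lborel)" by (rule integral_lborel_swap) fact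
      also have "\<dots> = (\<integral>w. h' (1, w) * (LBINT x:{0..R}. x ^ (k + n) * \<phi> (x * sqrt (1 + (norm w)\<^sup>2))) \<partial>lborel)"
        by (simp add: G_def set_lebesgue_integral_def mult_ac)
      also have "\<dots> \<in> E" unfolding n_def by (rule base[OF h' R \<rho>])
      finally show ?thesis .
    qed
    then show ?case using int by (simp add: g_def)
  qed simp
  obtain g where g: "g \<in> cone_span" "AE z in lborel. f z = g z" using pw_poly_bounded_support_cone_span[OF f] by blast
  have "(\<integral>z. \<phi> (norm z) * f z \<partial>lborel) = (\<integral>z. \<phi> (norm z) * g z \<partial>lborel)"
  proof (rule integral_cong_AE)
    show "AE z in lborel. \<phi> (norm z) * f z = \<phi> (norm z) * g z" using g(2) by eventually_elim simp
    show "(\<lambda>z. \<phi> (norm z) * g z) \<in> borel_measurable lborel" using cone_span[OF g(1)] by (auto dest: borel_measurable_integrable)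
  qed (use f(1) in measurable)
  then show ?thesis using cone_span[OF g(1)] by simp
qed

end

subsection \<open>Moments of piecewise polynomials\<close>

text \<open>The index bounds the degree and does not fix it, since setting the first coordinate to 1
  mixes the powers of \<open>t\<close>. Again one lower bound per generator is enough, now with a
  constant of \<open>E\<close> as breakpoint.\<close>

inductive (in real_subfield) step_poly :: "nat \<Rightarrow> (real \<Rightarrow> real) \<Rightarrow> bool" where
  step_poly_zero: "step_poly k (\<lambda>_. 0)"
| step_poly_add: "step_poly k f \<Longrightarrow> step_poly k g \<Longrightarrow> step_poly k (\<lambda>t. f t + g t)"
| step_poly_power: "c \<in> E \<Longrightarrow> j \<le> k \<Longrightarrow> step_poly k (\<lambda>t. c * t ^ j)"
| step_poly_above: "c \<in> E \<Longrightarrow> j \<le> k \<Longrightarrow> m \<in> E \<Longrightarrow> step_poly k (\<lambda>t. c * t ^ j * of_bool (above s (t - m)))"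

context real_subfield
begin

lemma step_poly_mult_power:
  assumes "step_poly k f" "c \<in> E" "j \<le> l" shows "step_poly (k + l) (\<lambda>t. f t * (c * t ^ j))"
  using assms(1)
proof (induction k f rule: step_poly.induct)
  case (step_poly_power d i k)
  then have "step_poly (k + l) (\<lambda>t. (d * c) * t ^ (i + j))"
    using assms by (intro step_poly.step_poly_power mult add_mono)
  then show ?case by (simp add: power_add mult_ac)
next
  case (step_poly_above d i k m s)
  then have "step_poly (k + l) (\<lambda>t. (d * c) * t ^ (i + j) * of_bool (above s (t - m)))"
    using assms by (intro step_poly.step_poly_above mult add_mono)
  then show ?case by (simp add: power_add mult_ac)
qed (auto simp: distrib_right intro: step_poly.intros)

lemma step_poly_mult_above:
  assumes "step_poly k f" "m' \<in> E" shows "step_poly k (\<lambda>t. f t * of_bool (above s' (t - m')))"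
  using assms(1)
proof (induction k f rule: step_poly.induct)
  case (step_poly_power d i k)
  then show ?case using step_poly.step_poly_above[OF step_poly_power assms(2), of s'] by simp
next
  case (step_poly_above d i k m s)
  have eq: "d * t ^ i * of_bool (above s (t - m)) * of_bool (above s' (t - m')) =
     d * t ^ i * of_bool (if m > m' then above s (t - m) else if m < m' then above s' (t - m') else above (s \<or> s') (t - m))" for t
    unfolding above_conj[symmetric] by simp
  show ?case unfolding eq
    using step_poly.step_poly_above[OF step_poly_above(1,2)] step_poly_above(3) assms(2) by (cases m m' rule: linorder_cases) auto
qed (auto simp: distrib_right intro: step_poly.intros)

lemma step_poly_mult:
  assumes "step_poly l g" "step_poly k f" shows "step_poly (k + l) (\<lambda>t. f t * g t)"
  using assms(1)
proof (induction l g rule: step_poly.induct)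
  case (step_poly_power c j l)
  then show ?case using assms(2) by (intro step_poly_mult_power)
next
  case (step_poly_above c j l m s)
  have "step_poly (k + l) (\<lambda>t. f t * (c * t ^ j) * of_bool (above s (t - m)))"
    using step_poly_above assms(2) by (intro step_poly_mult_above step_poly_mult_power)
  then show ?case by (simp add: mult_ac)
qed (auto simp: distrib_left intro: step_poly.intros)

text \<open>The degree bound is what keeps the integrals below elementary: without it dilogarithms would appear.\<close>

lemma hom_poly_slice_step_poly: "hom_poly k (h :: real \<times> real \<Rightarrow> real) \<Longrightarrow> step_poly k (\<lambda>t. h (1, t))"
proof (induction k h rule: hom_poly.induct)
  case (hom_poly_const c)
  then show ?case using step_poly_power[of c 0 0] by simp
next
  case (hom_poly_inner v)
  have "step_poly 1 (\<lambda>t. fst v * t ^ 0 + snd v * t ^ 1)"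
    using points_fst[OF hom_poly_inner] points_snd[OF hom_poly_inner] by (intro step_poly_add step_poly_power) auto
  then show ?case by (simp add: inner_prod_def)
next
  case (hom_poly_pos v)
  define a d where "a = fst v" "d = snd v"
  have ad: "a \<in> E" "d \<in> E" using points_fst[OF hom_poly_pos] points_snd[OF hom_poly_pos] by (auto simp: a_d_def)
  have v: "v \<bullet> (1, t) = a + d * t" for t by (simp add: inner_prod_def a_d_def)
  have m: "- (a / d) \<in> E" using ad by (intro in_intros)
  have one: "step_poly 0 (\<lambda>t. c * t ^ 0)" if "c \<in> E" for c using that by (intro step_poly_power) auto
  consider "d = 0" | "d > 0" | "d < 0" by linarith
  then show ?case
  proof cases
    case 1
    then show ?thesis using one[of "of_bool (a > 0)"] by (simp add: v of_bool_def)
  next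
    case 2
    then have "a + d * t > 0 \<longleftrightarrow> above True (t - - (a / d))" for t by (simp add: above_def field_simps)
    then show ?thesis using step_poly_mult_above[OF one[OF one_in] m, of True] by (simp add: v)
  next
    case 3
    then have "a + d * t > 0 \<longleftrightarrow> \<not> above False (t - - (a / d))" for t by (auto simp: above_def field_simps)
    then have "of_bool (v \<bullet> (1, t) > 0) = 1 * t ^ 0 + (- 1) * t ^ 0 * of_bool (above False (t - - (a / d)))" for t
      by (simp add: v)
    then show ?thesis
      using step_poly_add[OF one[OF one_in] step_poly_mult_above[OF one[OF uminus_in[OF one_in]] m, of False]] by (simp only:)
  qed
qed (auto intro: step_poly_add step_poly_mult)

lemma pw_poly_integral_in:
  fixes f :: "real \<times> real \<times> real \<Rightarrow> real"
  assumes "f \<in> pw_poly" "\<And>x. f x \<noteq> 0 \<Longrightarrow> norm x \<le> real N"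
  shows "(\<integral>x. f x \<partial>lborel) \<in> E"
proof -
  \<comment> \<open>A dummy parameter is added so that the statement with parameters applies and can
    be evaluated at 0.\<close>
  have "(\<lambda>w :: real \<times> real \<times> real \<times> real. f (snd w)) \<in> pw_poly"
    by (intro pw_poly_compose[OF _ assms(1)] affine_over_intros)
  then have "(\<lambda>z::real. \<integral>x. f (snd (z, x)) \<partial>lborel) \<in> pw_poly"
    using assms(2) by (intro pw_poly_integral_real3[where N=N]) auto
  from pw_poly_in[OF this, of 0] show ?thesis by simp
qed

end

interpretation elementary: real_sqrt_field "elementary_in A" for A
  by unfold_locales (auto intro: elementary_in.intros elementary_sqrt)

text \<open>The inner integral of the planar radial pass as a function of the slope
  \<open>t\<close>; as in \<open>wedge_quot\<close>, the Jacobian adds 1 to the degree.\<close>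

definition profile :: "real \<Rightarrow> nat \<Rightarrow> real \<Rightarrow> real" where
  "profile R k t = integral {0..R} (\<lambda>x. x ^ Suc k / slant x t)"

lemma profile_eq_LBINT:
  "profile R k t = (LBINT x:{0..R}. x ^ Suc k * (1 / sqrt (1 + (x * sqrt (1 + t\<^sup>2))\<^sup>2)))"
proof -
  have eq: "slant x t = sqrt (1 + (x * sqrt (1 + t\<^sup>2))\<^sup>2)" for x
    by (simp add: slant_def power_mult_distrib)
  have "continuous_on {0..R} (\<lambda>x. x ^ Suc k / slant x t)" by (intro continuous_intros) simp
  from set_borel_integral_eq_integral(2)[OF borel_integrable_atLeastAtMost'[OF this]]
  have "profile R k t = (LBINT x:{0..R}. x ^ Suc k / slant x t)" by (simp add: profile_def)
  then show ?thesis by (simp add: eq)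
qed

lemma continuous_on_profile: "continuous_on S (profile R k)"
proof -
  have "continuous_on UNIV (\<lambda>t. integral (cbox 0 R) (\<lambda>x. x ^ Suc k / slant x t))"
    by (rule integral_continuous_on_param) (auto intro!: continuous_intros simp: case_prod_beta)
  then show ?thesis unfolding profile_def[abs_def] by (auto intro: continuous_on_subset)
qed

lemma profile_minus [simp]: "profile R k (- t) = profile R k t"
  by (simp add: profile_def slant_def)

context
  fixes A :: "real set" and R :: real and k :: nat
  assumes R: "R > 0" "R \<in> elementary_in A"
begin

private abbreviation (input) "I j a b \<equiv> integral {a..b} (\<lambda>t. t ^ j * profile R k t)"

private lemma integrable: "(\<lambda>t. t ^ j * profile R k t) integrable_on {a..b}"
  by (intro integrable_continuous_real continuous_intros continuous_on_profile)

text \<open>By Fubini this is the wedge integral \<open>wedge_quot R b k j\<close>.\<close>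

private lemma nonneg:
  assumes "j \<le> k" "b \<ge> 0" "b \<in> elementary_in A" shows "I j 0 b \<in> elementary_in A"
proof -
  have c: "continuous_on (cbox (0,0) (R,b)) (\<lambda>(x,t). x ^ Suc k * t ^ j / slant x t)"
    by (auto intro!: continuous_intros simp: case_prod_beta)
  have "wedge_quot R b k j = integral {0..b} (\<lambda>t. integral {0..R} (\<lambda>x. x ^ Suc k * t ^ j / slant x t))"
    unfolding wedge_quot_def using integral_swap_continuous[OF c] integral_prod_continuous[OF c]
    by (simp add: case_prod_unfold)
  also have "\<dots> = I j 0 b"
    unfolding profile_def integral_mult_right[symmetric] by (simp add: mult_ac)
  finally show ?thesis using wedge_quot_elementary[OF R assms(2,3,1)] by simp
qed

private lemma nonpos:
  assumes "j \<le> k" "a \<le> 0" "a \<in> elementary_in A" shows "I j a 0 \<in> elementary_in A"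
proof -
  have "I j a 0 = integral {- 0..- a} (\<lambda>t. (- t) ^ j * profile R k (- t))"
    by (rule Henstock_Kurzweil_Integration.integral_reflect_real[symmetric])
  also have "\<dots> = integral {0..- a} (\<lambda>t. (- 1) ^ j * (t ^ j * profile R k t))"
  proof -
    have "(\<lambda>t. (- t) ^ j * profile R k (- t)) = (\<lambda>t. (- 1) ^ j * (t ^ j * profile R k t))"
      by (rule ext, subst power_minus) simp
    then show ?thesis by simp
  qed
  also have "\<dots> = (- 1) ^ j * I j 0 (- a)" by (rule integral_mult_right)
  also have "\<dots> \<in> elementary_in A" using assms by (intro elementary_intros nonneg) auto
  finally show ?thesis .
qed

text \<open>The wedge integrals cover only segments that start at 0 and go to the right; evenness of
  \<open>profile\<close> reflects them, and additivity yields all others.\<close>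

lemma profile_segment_elementary:
  assumes "j \<le> k" "a \<le> b" "a \<in> elementary_in A" "b \<in> elementary_in A"
  shows "I j a b \<in> elementary_in A"
proof -
  consider "0 \<le> a" | "a < 0" "0 \<le> b" | "b < 0" by linarith
  then show ?thesis
  proof cases
    case 1
    then have "I j a b = I j 0 b - I j 0 a"
      using Henstock_Kurzweil_Integration.integral_combine[OF _ _ integrable, of 0 a b j] assms by simp
    moreover have "\<dots> \<in> elementary_in A" using 1 assms by (intro elementary_intros nonneg) auto
    ultimately show ?thesis by (simp only:)
  next
    case 2
    then have "I j a b = I j a 0 + I j 0 b"
      using Henstock_Kurzweil_Integration.integral_combine[OF _ _ integrable, of a 0 b j] assms by simp
    moreover have "\<dots> \<in> elementary_in A" using 2 assms by (intro elementary_intros nonneg nonpos) auto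
    ultimately show ?thesis by (simp only:)
  next
    case 3
    then have "I j a b = I j a 0 - I j b 0"
      using Henstock_Kurzweil_Integration.integral_combine[OF _ _ integrable, of a b 0 j] assms by simp
    moreover have "\<dots> \<in> elementary_in A" using 3 assms by (intro elementary_intros nonpos) auto
    ultimately show ?thesis by (simp only:)
  qed
qed

lemma step_poly_profile_integral:
  assumes "elementary.step_poly A k f"
  shows "\<exists>r\<in>elementary_in A. has_bochner_integral lborel (\<lambda>t. indicator {- real N..real N} t * (f t * profile R k t)) r"
proof -
  have N: "real N \<in> elementary_in A" "- real N \<in> elementary_in A" by (auto intro: elementary_intros)
  have seg: "has_bochner_integral lborel (\<lambda>t. indicator {a..real N} t * (t ^ j * profile R k t)) (I j a (real N))" for j a
  proof -
    have "set_integrable lborel {a..real N} (\<lambda>t. t ^ j * profile R k t)"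
      by (intro borel_integrable_atLeastAtMost' continuous_intros continuous_on_profile)
    from this set_borel_integral_eq_integral(2)[OF this] show ?thesis
      unfolding set_integrable_def set_lebesgue_integral_def by (simp add: has_bochner_integral_iff)
  qed
  have [measurable]: "profile R k \<in> borel_measurable borel"
    using continuous_on_profile by (rule borel_measurable_continuous_onI)
  \<comment> \<open>\<open>k\<close> is fixed by the context but varies as an index of
    \<open>step_poly\<close>; hence a fresh \<open>l\<close> with \<open>l = k\<close>.\<close>
  have "\<exists>r\<in>elementary_in A. has_bochner_integral lborel (\<lambda>t. indicator {- real N..real N} t * (f t * profile R l t)) r"
    if "elementary.step_poly A l f" "l = k" for l f
    using that
  proof (induction l f rule: elementary.step_poly.induct)
    case (step_poly_zero k)
    then show ?case by (intro bexI[of _ 0]) auto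
  next
    case (step_poly_add l f g)
    then obtain r s where "r \<in> elementary_in A" "s \<in> elementary_in A"
      "has_bochner_integral lborel (\<lambda>t. indicator {- real N..real N} t * (f t * profile R l t)) r"
      "has_bochner_integral lborel (\<lambda>t. indicator {- real N..real N} t * (g t * profile R l t)) s" by auto
    then show ?case using has_bochner_integral_add
      by (intro bexI[of _ "r + s"]) (auto simp: algebra_simps intro: elementary_in.add)
  next
    case (step_poly_power c j l)
    have "has_bochner_integral lborel (\<lambda>t. c * (indicator {- real N..real N} t * (t ^ j * profile R k t)))
       (c * I j (- real N) (real N))" by (intro has_bochner_integral_mult_right seg)
    moreover have "c * I j (- real N) (real N) \<in> elementary_in A"
      using step_poly_power N by (intro elementary_in.mult profile_segment_elementary) auto
    ultimately show ?case using step_poly_power(3) by (auto simp: mult_ac)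
  next
    case (step_poly_above c j l m s)
    \<comment> \<open>\<open>m\<close> clamped to the window: the part of the window above
      \<open>m\<close> is \<open>{a..real N}\<close> up to single points, also when \<open>m\<close>
      lies outside.\<close>
    define a where "a = max (- real N) (min m (real N))"
    have a: "a \<in> elementary_in A" "a \<le> real N" using N step_poly_above(3) by (auto simp: a_def max_def min_def)
    have "has_bochner_integral lborel (\<lambda>t. c * (indicator {a..real N} t * (t ^ j * profile R k t))) (c * I j a (real N))"
      by (intro has_bochner_integral_mult_right seg)
    moreover have "AE t in lborel. c * (indicator {a..real N} t * (t ^ j * profile R k t)) =
        indicator {- real N..real N} t * (c * t ^ j * of_bool (elementary.above s (t - m)) * profile R k t)"
      using AE_lborel_singleton[of m] AE_lborel_singleton[of "real N"]
      by eventually_elim (auto simp: a_def indicator_def elementary.above_def split: if_splits)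
    ultimately have "has_bochner_integral lborel (\<lambda>t. indicator {- real N..real N} t *
        (c * t ^ j * of_bool (elementary.above s (t - m)) * profile R k t)) (c * I j a (real N))"
      by (subst has_bochner_integral_cong_AE[symmetric]) (auto simp: elementary.above_def)
    moreover have "c * I j a (real N) \<in> elementary_in A"
      using step_poly_above N a by (intro elementary_in.mult profile_segment_elementary) auto
    ultimately show ?case using step_poly_above(4) by blast
  qed
  then show ?thesis using assms by blast
qed

end

text \<open>The second radial pass, with base dimension 1. The radial integral is
  \<open>profile\<close>, and the slice is a \<open>step_poly\<close> of degree at most
  \<open>k\<close>, which meets the exponent condition of the wedge integrals.\<close>

lemma plane_integral_elementary:
  fixes f :: "real \<times> real \<Rightarrow> real"
  assumes "f \<in> elementary.pw_poly A" "\<And>z. f z \<noteq> 0 \<Longrightarrow> norm z \<le> real N"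
  shows "(\<integral>z. 1 / sqrt (1 + (norm z)\<^sup>2) * f z \<partial>lborel) \<in> elementary_in A"
proof (rule elementary.radial_integral[where \<phi>="\<lambda>s. 1 / sqrt (1 + s\<^sup>2)", OF _ _ assms])
  have "1 + s\<^sup>2 \<noteq> 0" for s :: real by (metis add_eq_0_iff not_one_le_zero order_refl sum_power2_eq_zero_iff power_one one_neq_zero)
  then show "continuous_on UNIV (\<lambda>s::real. 1 / sqrt (1 + s\<^sup>2))" by (intro continuous_intros) auto
next
  fix k R \<rho> and h :: "real \<times> real \<Rightarrow> real"
  assume h: "elementary.hom_poly A k h" and R: "R > 0" "R \<in> elementary_in A" and \<rho>: "\<And>w. h (1, w) \<noteq> 0 \<Longrightarrow> norm w \<le> \<rho>"
  obtain N where N: "\<rho> \<le> real N" using real_arch_simple by blast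
  obtain r where r: "r \<in> elementary_in A"
    "has_bochner_integral lborel (\<lambda>t. indicator {- real N..real N} t * (h (1, t) * profile R k t)) r"
    using step_poly_profile_integral[OF R elementary.hom_poly_slice_step_poly[OF h]] by blast
  have "indicator {- real N..real N} t * (h (1, t) * profile R k t) = h (1, t) * profile R k t" for t
    using \<rho>[of t] N by (cases "h (1, t) = 0") (auto simp: indicator_def)
  then have "(\<integral>t. h (1, t) * profile R k t \<partial>lborel) = r" using has_bochner_integral_integral_eq[OF r(2)] by (simp only:)
  then show "(\<integral>w. h (1, w) * (LBINT x:{0..R}. x ^ (k + DIM(real)) * (1 / sqrt (1 + (x * sqrt (1 + (norm w)\<^sup>2))\<^sup>2))) \<partial>lborel)
      \<in> elementary_in A" using r(1) by (simp add: profile_eq_LBINT)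
qed

text \<open>The first radial pass. The radial integral is a multiple of
  \<open>sqrt (1 + (norm w)\<^sup>2)\<close>; writing this root as its square divided by itself
  makes it the kernel of the plane times a polynomial.\<close>

lemma space_integral_elementary:
  fixes f :: "real \<times> real \<times> real \<Rightarrow> real"
  assumes "f \<in> elementary.pw_poly A" "\<And>z. f z \<noteq> 0 \<Longrightarrow> norm z \<le> real N"
  shows "(\<integral>z. norm z * f z \<partial>lborel) \<in> elementary_in A"
proof (rule elementary.radial_integral[where \<phi>="\<lambda>s. s", OF _ _ assms])
  fix k R \<rho> and h :: "real \<times> real \<times> real \<Rightarrow> real"
  assume h: "elementary.hom_poly A k h" and R: "R > 0" "R \<in> elementary_in A" and \<rho>: "\<And>w. h (1, w) \<noteq> 0 \<Longrightarrow> norm w \<le> \<rho>"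
  obtain N where N: "\<rho> \<le> real N" using real_arch_simple by blast
  \<comment> \<open>The powers of \<open>x\<close> are \<open>k\<close> from homogeneity, 2 from the
    Jacobian and 1 from the norm; integration gives \<open>k + 4\<close> as exponent and
    divisor.\<close>
  define c where "c = R ^ (k + 4) / (k + 4)"
  define g where "g w = c * ((1 + (norm w)\<^sup>2) * h (1, w))" for w :: "real \<times> real"
  have "c \<in> elementary_in A" unfolding c_def using R by (intro elementary_intros) auto
  moreover have "(1 :: real, 0 :: real \<times> real) \<in> elementary.points A" by simp
  ultimately have "g \<in> elementary.pw_poly A" unfolding g_def
    by (intro elementary.pw_poly_mult elementary.pw_poly_const elementary.pw_poly_add elementary.pw_poly_norm_power2 elementary_1
      elementary.pw_poly_compose[OF _ elementary.hom_poly_pw_poly[OF h]] elementary.affine_over_intros) auto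
  moreover have "norm w \<le> real N" if "g w \<noteq> 0" for w using that \<rho>[of w] N by (auto simp: g_def)
  ultimately have "(\<integral>w. 1 / sqrt (1 + (norm w)\<^sup>2) * g w \<partial>lborel) \<in> elementary_in A"
    by (rule plane_integral_elementary)
  moreover have "1 / sqrt (1 + (norm w)\<^sup>2) * g w =
      h (1, w) * (LBINT x:{0..R}. x ^ (k + DIM(real \<times> real)) * (x * sqrt (1 + (norm w)\<^sup>2)))" for w
  proof -
    have "(LBINT x:{0..R}. x ^ (k + 2) * (x * sqrt (1 + (norm w)\<^sup>2))) =
       (\<integral>x. sqrt (1 + (norm w)\<^sup>2) * (x ^ (k + 3) * indicator {0..R} x) \<partial>lborel)"
      by (simp add: set_lebesgue_integral_def mult_ac numeral_3_eq_3)
    also have "\<dots> = sqrt (1 + (norm w)\<^sup>2) * c"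
      using integral_power[of 0 R "k + 3"] R by (simp add: c_def numeral_eq_Suc add_ac)
    finally have eq: "(LBINT x:{0..R}. x ^ (k + 2) * (x * sqrt (1 + (norm w)\<^sup>2))) = sqrt (1 + (norm w)\<^sup>2) * c" .
    have "(1 + (norm w)\<^sup>2) / sqrt (1 + (norm w)\<^sup>2) = sqrt (1 + (norm w)\<^sup>2)"
      by (intro real_div_sqrt) simp
    then have "1 / sqrt (1 + (norm w)\<^sup>2) * g w = c * sqrt (1 + (norm w)\<^sup>2) * h (1, w)"
      by (simp add: g_def) (metis (no_types, lifting) mult.assoc mult.commute times_divide_eq_left)
    then show ?thesis using eq by simp
  qed
  ultimately show "(\<integral>w. h (1, w) * (LBINT x:{0..R}. x ^ (k + DIM(real \<times> real)) * (x * sqrt (1 + (norm w)\<^sup>2))) \<partial>lborel)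
      \<in> elementary_in A" by (simp only:)
qed (intro continuous_intros)

text \<open>Even powers of the norm are polynomials and are absorbed into \<open>f\<close>; at most
  one factor \<open>norm z\<close> is left.\<close>

lemma moment_elementary:
  fixes f :: "real \<times> real \<times> real \<Rightarrow> real"
  assumes f: "f \<in> elementary.pw_poly A" "\<And>z. f z \<noteq> 0 \<Longrightarrow> norm z \<le> real N"
  shows "(\<integral>z. norm z ^ p * f z \<partial>lborel) \<in> elementary_in A"
proof -
  have even: "(\<lambda>z. norm z ^ (2 * q) * f z) \<in> elementary.pw_poly A" for q
    unfolding power_mult by (intro elementary.pw_poly_mult elementary.pw_poly_power elementary.pw_poly_norm_power2 f(1))
  show ?thesis
  proof (cases "even p")
    case True
    then obtain q where "p = 2 * q" by blast
    then show ?thesis using even[of q] f(2) by (auto intro!: elementary.pw_poly_integral_in)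
  next
    case False
    then obtain q where q: "p = Suc (2 * q)" by (auto elim: oddE)
    have "(\<integral>z. norm z * (norm z ^ (2 * q) * f z) \<partial>lborel) \<in> elementary_in A"
      using f(2) by (intro space_integral_elementary[OF even]) auto
    then show ?thesis by (simp add: q mult.assoc)
  qed
qed

subsection \<open>Random points in a polyhedron\<close>

text \<open>Nested pairs suit coordinatewise integration, while \<open>real^3\<close> carries the
  cross product; this isometry connects the two.\<close>

definition of_triple :: "real \<times> real \<times> real \<Rightarrow> real^3" where
  "of_triple z = vector [fst z, fst (snd z), snd (snd z)]"

lemma linear_of_triple: "linear of_triple"
  by (rule linearI) (simp_all add: of_triple_def vec_eq_iff forall_3)

lemma inner_of_triple: "v \<bullet> of_triple z = (v $ 1, v $ 2, v $ 3) \<bullet> z"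
  by (simp add: of_triple_def inner_vec_def sum_3 inner_prod_def)

lemma norm_of_triple: "norm (of_triple z) = norm z"
  by (simp add: norm_eq_sqrt_inner inner_of_triple) (simp add: of_triple_def inner_prod_def)

lemma surj_of_triple: "surj of_triple"
proof (rule surjI)
  show "of_triple (v $ 1, v $ 2, v $ 3) = v" for v
    by (simp add: of_triple_def vec_eq_iff forall_3)
qed

lemma measurable_of_triple [measurable]: "of_triple \<in> borel_measurable borel"
  using linear_of_triple
  by (intro borel_measurable_continuous_onI linear_continuous_on) (simp add: linear_conv_bounded_linear)

lemma distr_of_triple: "distr lborel borel of_triple = lborel"
  by (intro lborel_distr_isometry linear_of_triple norm_of_triple surj_of_triple) simp

lemma integral_of_triple:
  fixes f :: "real^3 \<Rightarrow> real"
  assumes "f \<in> borel_measurable borel"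
  shows "(\<integral>z. f (of_triple z) \<partial>lborel) = (\<integral>x. f x \<partial>lborel)"
  using assms by (intro integral_lborel_isometry linear_of_triple norm_of_triple surj_of_triple) auto

lemma (in real_subfield) affine_over_of_triple: "affine_over of_triple"
  unfolding affine_over_def
proof
  fix v :: "real^3" assume "v \<in> points"
  then show "\<exists>w\<in>points. \<exists>c\<in>E. \<forall>x. v \<bullet> of_triple x = w \<bullet> x + c"
    by (intro bexI[of _ "(v $ 1, v $ 2, v $ 3)"] bexI[of _ 0]) (auto simp: inner_of_triple points_vec)
qed

text \<open>A function that equals the indicator of \<open>K\<close> almost everywhere may still be
  nonzero far away, on a null set. Multiplying by the indicator of a cube repairs this inside
  \<open>pw_poly\<close> and gives the bounded support that the integration lemmas demand.\<close>

lemma (in real_subfield) cutoff_pw_poly: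
  obtains \<eta> :: "'a::euclidean_space \<Rightarrow> real" and M :: nat where "\<eta> \<in> pw_poly" "\<And>z. norm z \<le> real N \<Longrightarrow> \<eta> z = 1"
    "\<And>z. \<eta> z \<noteq> 0 \<Longrightarrow> norm z \<le> real M"
proof
  let ?\<eta> = "\<lambda>z::'a. \<Prod>b\<in>Basis. of_bool (b \<bullet> z + real (N + 1) > 0) * of_bool ((- b) \<bullet> z + real (N + 1) > 0) :: real"
  show "?\<eta> \<in> pw_poly" by (intro pw_poly_prod pw_poly_mult pw_poly_pos points_uminus of_nat_in) (auto intro: points_Basis)
  show "?\<eta> z = 1" if "norm z \<le> real N" for z
  proof (rule prod.neutral, rule ballI)
    fix b :: 'a assume "b \<in> Basis"
    then have "\<bar>b \<bullet> z\<bar> \<le> real N" using Basis_le_norm[of b z] that by (simp add: inner_commute)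
    then show "of_bool (b \<bullet> z + real (N + 1) > 0) * of_bool ((- b) \<bullet> z + real (N + 1) > 0) = (1 :: real)" by auto
  qed
  show "norm z \<le> real (DIM('a) * (N + 1))" if "?\<eta> z \<noteq> 0" for z
  proof -
    have "\<bar>z \<bullet> b\<bar> \<le> real (N + 1)" if "b \<in> Basis" for b
      using \<open>?\<eta> z \<noteq> 0\<close> that by (auto simp: inner_commute abs_le_iff split: if_splits)
    then have "(\<Sum>b\<in>Basis. \<bar>z \<bullet> b\<bar>) \<le> (\<Sum>b\<in>(Basis::'a set). real (N + 1))" by (intro sum_mono)
    then show ?thesis using norm_le_l1[of z] by (simp add: distrib_left)
  qed
qed

lemma moment_uniform_pair:
  fixes K :: "'b::euclidean_space set" and X Y :: "'a \<Rightarrow> 'b"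
  assumes K: "K \<in> sets borel" "bounded K" "measure lborel K > 0"
    and "prob_space M" "prob_space.indep_var M borel X borel Y"
    and dX: "distr M borel X = uniform_measure lborel K"
    and dY: "distr M borel Y = uniform_measure lborel K"
  shows "(LINT \<omega>|M. norm (X \<omega> - Y \<omega>) ^ p) =
    (\<integral>x. \<integral>y. indicator K x * indicator K y * norm (x - y) ^ p \<partial>lborel \<partial>lborel) / (measure lborel K)\<^sup>2"
proof -
  interpret prob_space M by fact
  have XY [measurable]: "X \<in> measurable M borel" "Y \<in> measurable M borel"
    and joint: "distr M borel X \<Otimes>\<^sub>M distr M borel Y = distr M (borel \<Otimes>\<^sub>M borel) (\<lambda>\<omega>. (X \<omega>, Y \<omega>))"
    using assms(5) unfolding indep_var_distribution_eq by auto
  define V where "V = measure lborel K"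
  have [measurable]: "K \<in> sets borel" by (rule K)
  obtain r where r: "\<And>x. x \<in> K \<Longrightarrow> norm x \<le> r" using K(2) unfolding bounded_iff by blast
  have "emeasure lborel K \<le> emeasure lborel (cball (0::'b) r)"
    using r by (intro emeasure_mono) (auto simp: borel_closed)
  then have fin: "emeasure lborel K = ennreal V"
    unfolding V_def using emeasure_lborel_cball_finite[of "0::'b" r]
    by (intro emeasure_eq_ennreal_measure) (auto simp: top_unique)
  have V: "V > 0" using K(3) by (simp add: V_def)
  define u :: "'b \<Rightarrow> real" where "u x = indicator K x / V" for x
  have [measurable]: "u \<in> borel_measurable borel" unfolding u_def by measurable
  have unif: "uniform_measure lborel K = density lborel (\<lambda>x. ennreal (u x))"
    unfolding uniform_measure_def fin using V divide_ennreal[of 1 V]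
    by (intro density_cong AE_I2) (auto simp: u_def indicator_def)
  define F :: "'b \<times> 'b \<Rightarrow> real" where "F z = u (fst z) * u (snd z) * norm (fst z - snd z) ^ p" for z
  have F [measurable]: "F \<in> borel_measurable (borel \<Otimes>\<^sub>M borel)" unfolding F_def by measurable
  have "(LINT \<omega>|M. norm (X \<omega> - Y \<omega>) ^ p) =
      (\<integral>z. norm (fst z - snd z) ^ p \<partial>distr M (borel \<Otimes>\<^sub>M borel) (\<lambda>\<omega>. (X \<omega>, Y \<omega>)))"
    by (subst integral_distr) auto
  also have "distr M (borel \<Otimes>\<^sub>M borel) (\<lambda>\<omega>. (X \<omega>, Y \<omega>)) =
      density lborel (\<lambda>x. ennreal (u x)) \<Otimes>\<^sub>M density lborel (\<lambda>x. ennreal (u x))"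
    unfolding joint[symmetric] dX dY unif ..
  also have "\<dots> = density (lborel \<Otimes>\<^sub>M lborel) (\<lambda>(x, y). ennreal (u x) * ennreal (u y))"
  proof (rule pair_measure_density)
    \<comment> \<open>The uniform measure is the law of \<open>X\<close>, hence a probability
      measure.\<close>
    have "sigma_finite_measure (uniform_measure lborel K)"
      unfolding dX[symmetric] by (intro prob_space_imp_sigma_finite prob_space_distr) simp
    then show "sigma_finite_measure (density lborel (\<lambda>x. ennreal (u x)))" unfolding unif .
  qed (auto intro: sigma_finite_lborel)
  also have "\<dots> = density (lborel \<Otimes>\<^sub>M lborel) (\<lambda>z. ennreal (u (fst z) * u (snd z)))"
    using V by (intro density_cong AE_I2) (auto simp: u_def indicator_def ennreal_mult[symmetric])
  also have "(\<integral>z. norm (fst z - snd z) ^ p \<partial>\<dots>) = (\<integral>z. F z \<partial>(lborel \<Otimes>\<^sub>M lborel))"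
    unfolding F_def using V by (subst integral_density) (auto simp: u_def)
  also have "\<dots> = (\<integral>z. F z \<partial>lborel)" by (simp add: lborel_prod)
  also have "\<dots> = (\<integral>x. \<integral>y. F (x, y) \<partial>lborel \<partial>lborel)"
  proof (rule integral_lborel_Pair, rule integrable_bounded_support)
    show "F \<in> borel_measurable borel" using F by (simp add: borel_prod)
    show "norm z \<le> \<bar>r\<bar> + \<bar>r\<bar>" if "F z \<noteq> 0" for z
      using that r[of "fst z"] r[of "snd z"] norm_Pair_le[of "fst z" "snd z"]
      by (auto simp: F_def u_def indicator_def split: if_splits)
    show "\<bar>F z\<bar> \<le> 1 / V * (1 / V) * (\<bar>r\<bar> + \<bar>r\<bar>) ^ p" for z
    proof (cases "fst z \<in> K \<and> snd z \<in> K")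
      case True
      then have "norm (fst z - snd z) \<le> \<bar>r\<bar> + \<bar>r\<bar>"
        using r[of "fst z"] r[of "snd z"] norm_triangle_ineq4[of "fst z" "snd z"] by auto
      then have "norm (fst z - snd z) ^ p \<le> (\<bar>r\<bar> + \<bar>r\<bar>) ^ p" by (intro power_mono) auto
      then show ?thesis using True V by (simp add: F_def u_def abs_mult divide_right_mono)
    next
      case False
      then show ?thesis using V by (auto simp: F_def u_def)
    qed
  qed
  also have "\<dots> = (\<integral>x. \<integral>y. indicator K x * indicator K y * norm (x - y) ^ p / V\<^sup>2 \<partial>lborel \<partial>lborel)"
    by (simp add: F_def u_def power2_eq_square)
  also have "\<dots> = (\<integral>x. \<integral>y. indicator K x * indicator K y * norm (x - y) ^ p \<partial>lborel \<partial>lborel) / V\<^sup>2"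
    by (simp only: integral_divide_zero)
  finally show ?thesis by (simp add: V_def)
qed

lemma solid_polyhedron_measure_pos:
  assumes "solid_polyhedron K" shows "measure lborel K > 0"
proof -
  obtain c where "c \<in> interior K" using solid_polyhedron_regular(3)[OF assms] by blast
  then obtain e where e: "e > 0" "ball c e \<subseteq> K" by (meson interior_subset mem_interior)
  have "0 < measure lborel (ball c e)" using content_ball_pos[OF e(1)] by simp
  also have "\<dots> \<le> measure lborel K"
    using e(2) solid_polyhedron_regular(1)[OF assms]
    by (intro measure_mono_fmeasurable) (auto intro: fmeasurable_compact)
  finally show ?thesis .
qed

lemma uniform_moment_elementary:
  fixes K :: "(real^3) set"
  assumes "solid_polyhedron K"
  shows "(\<integral>x. \<integral>y. indicator K x * indicator K y * norm (x - y) ^ p \<partial>lborel \<partial>lborel)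
      \<in> elementary_in (vertex_coordinates K)" (is "?I \<in> ?E")
    and "measure lborel K \<in> elementary_in (vertex_coordinates K)"
proof -
  let ?A = "vertex_coordinates K"
  let ?T = of_triple
  have compact: "compact K" using solid_polyhedron_regular(1)[OF assms] .
  then have [measurable]: "K \<in> sets borel" by (simp add: borel_compact)
  have "vertices_of K \<subseteq> elementary.points ?A"
    unfolding elementary.points_vec[abs_def] vertex_coordinates_def
    by (blast intro: elementary_in.base elementary.points_vec[THEN iffD2])
  then obtain g where g: "g \<in> elementary.pw_poly ?A" "AE x in lborel. indicator K x = g x"
    using elementary.solid_polyhedron_pw_poly[OF assms] by blast
  obtain r where r: "\<And>x. x \<in> K \<Longrightarrow> norm x \<le> r"
    using compact_imp_bounded[OF compact] unfolding bounded_iff by blast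
  obtain N where N: "r \<le> real N" using real_arch_simple by blast
  obtain \<eta> :: "real \<times> real \<times> real \<Rightarrow> real" and M where \<eta>: "\<eta> \<in> elementary.pw_poly ?A"
    "\<And>z. norm z \<le> real N \<Longrightarrow> \<eta> z = 1" "\<And>z. \<eta> z \<noteq> 0 \<Longrightarrow> norm z \<le> real M"
    using elementary.cutoff_pw_poly[of ?A N] by blast
  \<comment> \<open>A boundedly supported representative of the indicator of \<open>K\<close>,
    carried over to triples; it replaces the indicator in all integrals below.\<close>
  define k where "k z = g (?T z) * \<eta> z" for z
  have k: "k \<in> elementary.pw_poly ?A" unfolding k_def
    by (intro elementary.pw_poly_mult elementary.pw_poly_compose[OF elementary.affine_over_of_triple g(1)] \<eta>(1))
  then have [measurable]: "k \<in> borel_measurable borel" by (rule elementary.pw_poly_measurable)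
  have k_supp: "norm z \<le> real M" if "k z \<noteq> 0" for z using that \<eta>(3) by (auto simp: k_def)
  have "AE z in lborel. indicator K (?T z) = g (?T z)"
    using g(2) unfolding distr_of_triple[symmetric] by (rule AE_distrD[rotated]) measurable
  then have AE_k: "AE z in lborel. indicator K (?T z) = k z"
  proof eventually_elim
    fix z assume "indicator K (?T z) = g (?T z)"
    then show "indicator K (?T z) = k z"
      using \<eta>(2)[of z] r[of "?T z"] N by (cases "?T z \<in> K") (auto simp: k_def norm_of_triple)
  qed
  define G where "G z = (\<integral>x. k x * k (x + z) \<partial>lborel)" for z
  have "(\<lambda>w. k (snd w) * k (snd w + fst w)) \<in> elementary.pw_poly ?A"
    by (intro elementary.pw_poly_mult elementary.pw_poly_compose[OF _ k] elementary.affine_over_intros)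
  then have "(\<lambda>z. \<integral>x. k (snd (z, x)) * k (snd (z, x) + fst (z, x)) \<partial>lborel) \<in> elementary.pw_poly ?A"
    using k_supp by (intro elementary.pw_poly_integral_real3[where N=M]) auto
  then have G: "G \<in> elementary.pw_poly ?A" by (simp add: G_def[abs_def])
  have G_supp: "norm z \<le> real (2 * M)" if nz: "G z \<noteq> 0" for z
  proof -
    have "\<exists>x. k x * k (x + z) \<noteq> 0"
    proof (rule ccontr)
      assume "\<not> ?thesis"
      then have "(\<lambda>x. k x * k (x + z)) = (\<lambda>_. 0)" by (intro ext) blast
      then show False using nz by (simp add: G_def)
    qed
    then obtain x where "k x * k (x + z) \<noteq> 0" by blast
    then show ?thesis using k_supp[of x] k_supp[of "x + z"] norm_triangle_ineq4[of "x + z" x] by simp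
  qed
  have "measure lborel K = (\<integral>x. indicator K x \<partial>lborel)" by simp
  also have "\<dots> = (\<integral>z. indicator K (?T z) \<partial>lborel)" by (rule integral_of_triple[symmetric]) measurable
  \<comment> \<open>An indicator equals its square, so the volume is the covariogram at 0.
    \<open>G\<close> agrees with a piecewise polynomial at every point, not just almost everywhere,
    and may be evaluated at this single one.\<close>
  also have "\<dots> = (\<integral>z. k z * k (z + 0) \<partial>lborel)"
  proof (rule integral_cong_AE)
    show "AE z in lborel. indicator K (?T z) = k z * k (z + 0)"
      using AE_k
    proof eventually_elim
      show "indicator K (?T z) = k z * k (z + 0)" if "indicator K (?T z) = k z" for z
        using that[symmetric] by (cases "?T z \<in> K") auto
    qed
  qed measurable
  also have "\<dots> = G 0" by (simp add: G_def)
  finally show "measure lborel K \<in> ?E" using elementary.pw_poly_in[OF G elementary.points_zero] by simp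
  have "?I = (\<integral>z. \<integral>y. indicator K (?T z) * indicator K y * norm (?T z - y) ^ p \<partial>lborel \<partial>lborel)"
    by (rule integral_of_triple[symmetric]) measurable
  also have "\<dots> = (\<integral>z. \<integral>w. indicator K (?T z) * indicator K (?T w) * norm (z - w) ^ p \<partial>lborel \<partial>lborel)"
  proof (rule Bochner_Integration.integral_cong[OF refl])
    fix z
    have "norm (?T z - ?T w) = norm (z - w)" for w
      by (metis linear_diff linear_of_triple norm_of_triple)
    then have "(\<integral>w. indicator K (?T z) * indicator K (?T w) * norm (z - w) ^ p \<partial>lborel)
       = (\<integral>w. indicator K (?T z) * indicator K (?T w) * norm (?T z - ?T w) ^ p \<partial>lborel)" by simp
    also have "\<dots> = (\<integral>y. indicator K (?T z) * indicator K y * norm (?T z - y) ^ p \<partial>lborel)"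
      by (rule integral_of_triple) measurable
    finally show "(\<integral>y. indicator K (?T z) * indicator K y * norm (?T z - y) ^ p \<partial>lborel)
       = (\<integral>w. indicator K (?T z) * indicator K (?T w) * norm (z - w) ^ p \<partial>lborel)" ..
  qed
  also have "\<dots> = (\<integral>z. \<integral>w. k z * k w * norm (z - w) ^ p \<partial>lborel \<partial>lborel)"
  proof (rule integral_cong_AE)
    show "AE z in lborel. (\<integral>w. indicator K (?T z) * indicator K (?T w) * norm (z - w) ^ p \<partial>lborel)
        = (\<integral>w. k z * k w * norm (z - w) ^ p \<partial>lborel)"
      using AE_k
    proof eventually_elim
      fix z assume z: "indicator K (?T z) = k z"
      show "(\<integral>w. indicator K (?T z) * indicator K (?T w) * norm (z - w) ^ p \<partial>lborel)
        = (\<integral>w. k z * k w * norm (z - w) ^ p \<partial>lborel)"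
      proof (rule integral_cong_AE)
        show "AE w in lborel. indicator K (?T z) * indicator K (?T w) * norm (z - w) ^ p = k z * k w * norm (z - w) ^ p"
          using AE_k by eventually_elim (simp add: z)
      qed measurable
    qed
  qed measurable
  also have "\<dots> = (\<integral>z. \<integral>w. k z * k (z + w) * norm w ^ p \<partial>lborel \<partial>lborel)"
  proof (rule Bochner_Integration.integral_cong[OF refl])
    fix z
    have "(\<integral>w. k z * k (z + w) * norm (z - (z + w)) ^ p \<partial>lborel) = (\<integral>w. k z * k w * norm (z - w) ^ p \<partial>lborel)"
      by (rule integral_lborel_shift) measurable
    then show "(\<integral>w. k z * k w * norm (z - w) ^ p \<partial>lborel) = (\<integral>w. k z * k (z + w) * norm w ^ p \<partial>lborel)" by simp
  qed
  also have "\<dots> = (\<integral>w. \<integral>z. k z * k (z + w) * norm w ^ p \<partial>lborel \<partial>lborel)"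
  proof -
    let ?F = "\<lambda>z. k (fst z) * k (fst z + snd z) * norm (snd z) ^ p"
    obtain B where B: "\<And>z. norm z \<le> real M \<Longrightarrow> \<bar>k z\<bar> \<le> B" using elementary.pw_poly_bounded[OF k] by blast
    then have kB: "\<bar>k z\<bar> \<le> \<bar>B\<bar>" for z using k_supp[of z] by (cases "k z = 0") fastforce+
    have supp: "norm (fst z) \<le> real M \<and> norm (snd z) \<le> 2 * real M" if "?F z \<noteq> 0" for z
      using that k_supp[of "fst z"] k_supp[of "fst z + snd z"] norm_triangle_ineq4[of "fst z + snd z" "fst z"] by auto
    have "integrable lborel ?F"
    proof (rule integrable_bounded_support)
      have "?F \<in> borel_measurable (borel \<Otimes>\<^sub>M borel)" by measurable
      then show "?F \<in> borel_measurable borel" by (simp only: borel_prod)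
      show "norm z \<le> 3 * real M" if "?F z \<noteq> 0" for z
        using supp[OF that] norm_Pair_le[of "fst z" "snd z"] by simp
      show "\<bar>?F z\<bar> \<le> \<bar>B\<bar> * \<bar>B\<bar> * (2 * real M) ^ p" for z
      proof (cases "?F z = 0")
        case False
        then have "norm (snd z) ^ p \<le> (2 * real M) ^ p" using supp by (intro power_mono) auto
        then show ?thesis unfolding abs_mult using kB by (intro mult_mono) auto
      next
        case True
        then show ?thesis by (simp only: abs_zero) simp
      qed
    qed
    from integral_lborel_swap[OF this] show ?thesis by simp
  qed
  also have "\<dots> = (\<integral>w. norm w ^ p * G w \<partial>lborel)"
    by (simp add: G_def mult.commute)
  also have "\<dots> \<in> ?E" by (rule moment_elementary[OF G G_supp])
  finally show "?I \<in> ?E" .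
qed

theorem theorem1:
  fixes K :: "(real^3) set" and M :: "'a measure" and X Y :: "'a \<Rightarrow> real^3" and p :: nat
  assumes "solid_polyhedron K"
    and "prob_space M"
    and "prob_space.indep_var M borel X borel Y"
    and "distr M borel X = uniform_measure lborel K"
    and "distr M borel Y = uniform_measure lborel K"
    and "p \<ge> 1"
  shows "(LINT \<omega>|M. norm (X \<omega> - Y \<omega>) ^ p) \<in> elementary_in (vertex_coordinates K)"
proof -
  have K: "K \<in> sets borel" "bounded K"
    using solid_polyhedron_regular(1)[OF assms(1)] by (auto simp: borel_compact compact_imp_bounded)
  have "measure lborel K > 0" using solid_polyhedron_measure_pos[OF assms(1)] .
  then show ?thesis
    unfolding moment_uniform_pair[OF K \<open>measure lborel K > 0\<close> assms(2-5)]
    by (intro elementary_in.divide elementary_power uniform_moment_elementary[OF assms(1)]) simp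
qed

end
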